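(* The dynamical system $$\dot x=(u+y^2+z^2)\,x,\quad \dot y=(u+y^2-2z^2)\,y,\quad \dot z=(u-2y^2+z^2)\,z,\quad \dot u=u^2-y^4+y^2z^2-z^4$$ has the only (up to functional dependence) algebraic (rational) integral $$\pi\boldsymbol{I}^2=\frac{y^2-z^2}{x^2}$$ and the two transcendental multi-valued integrals $$\boldsymbol{J}_1=\frac1y\,(u-2y^2+z^2)\,K\Big(\frac zy\Big)+3y\,E\Big(\frac zy\Big),\qquad \boldsymbol{J}_2=\frac1y\,(u+y^2+z^2)\,K'\Big(\frac zy\Big)-3y\,E'\Big(\frac zy\Big),$$ that is, $\dot{\boldsymbol{J}}_1=\dot{\boldsymbol{J}}_2\equiv0$ along solutions. These integrals satisfy the identity $$\boldsymbol{J}_1\,K'\Big(\frac zy\Big)-\boldsymbol{J}_2\,K\Big(\frac zy\Big)=\frac32\,\pi\,y .$$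
   Context: The dot denotes $d/d\tau$. An integral is a (possibly multi-valued) function of $(x,y,z,u)$ constant along solutions. The Legendre complete elliptic integrals of modulus $k$ are $$K(k)=\int_0^1\frac{d\lambda}{\sqrt{(1-\lambda^2)(1-k^2\lambda^2)}},\quad K'(k)=\int_k^1\frac{d\lambda}{\sqrt{(1-\lambda^2)(\lambda^2-k^2)}},$$ $$E(k)=\int_0^1\sqrt{\frac{1-k^2\lambda^2}{1-\lambda^2}}\,d\lambda,\quad E'(k)=\int_0^1\sqrt{\frac{1-(1-k^2)\lambda^2}{1-\lambda^2}}\,d\lambda$$ (continued analytically; at each point the branches of these functions are continued consistently); the prime is not a derivative. *)

theory Defs
  imports "HOL-Complex_Analysis.Complex_Analysis"
begin

section \<open>Functions of several complex variables\<close>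

text \<open>Complex differentiability: the Frechet derivative is complex linear.\<close>

definition holomorphic_several_on :: "(complex^'n) set \<Rightarrow> (complex^'n \<Rightarrow> complex) \<Rightarrow> bool" where
  "holomorphic_several_on S F \<longleftrightarrow>
     (\<forall>p\<in>S. \<exists>g :: complex^'n. (F has_derivative (\<lambda>h. \<Sum>i\<in>UNIV. g $ i * h $ i)) (at p))"

inductive complex_polynomial :: "(complex^'n \<Rightarrow> complex) \<Rightarrow> bool" where
  const: "complex_polynomial (\<lambda>p. c)"
| coord: "complex_polynomial (\<lambda>p. p $ i)"
| add: "complex_polynomial P \<Longrightarrow> complex_polynomial Q \<Longrightarrow> complex_polynomial (\<lambda>p. P p + Q p)"
| mult: "complex_polynomial P \<Longrightarrow> complex_polynomial Q \<Longrightarrow> complex_polynomial (\<lambda>p. P p * Q p)"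

definition rational_on :: "(complex^'n) set \<Rightarrow> (complex^'n \<Rightarrow> complex) \<Rightarrow> bool" where
  "rational_on S F \<longleftrightarrow>
     (\<exists>P Q. complex_polynomial P \<and> complex_polynomial Q \<and>
        (\<forall>p\<in>S. Q p \<noteq> 0 \<and> F p = P p / Q p))"

text \<open>\<open>F\<close> is a branch, over \<open>S\<close>, of an algebraic function of the coordinates. Since the field is
  infinite, a polynomial is nonzero iff it is nonzero as a function.\<close>

definition algebraic_on :: "(complex^'n) set \<Rightarrow> (complex^'n \<Rightarrow> complex) \<Rightarrow> bool" where
  "algebraic_on S F \<longleftrightarrow>
     (\<exists>(n::nat) a. (\<forall>i\<le>n. complex_polynomial (a i)) \<and> (\<exists>i\<le>n. \<exists>p. a i p \<noteq> 0) \<and>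
        (\<forall>p\<in>S. (\<Sum>i\<le>n. a i p * F p ^ i) = 0))"

text \<open>Near every point outside a nowhere dense closed subset of \<open>S\<close>, \<open>F\<close> is a holomorphic function
  of \<open>G\<close>. The exceptional set accommodates singular and critical points of \<open>G\<close>.\<close>

definition functionally_dependent_on ::
    "(complex^'n) set \<Rightarrow> (complex^'n \<Rightarrow> complex) \<Rightarrow> (complex^'n \<Rightarrow> complex) \<Rightarrow> bool" where
  "functionally_dependent_on S F G \<longleftrightarrow>
     (\<exists>S'. open S' \<and> S' \<subseteq> S \<and> S \<subseteq> closure S' \<and>
        (\<forall>p\<in>S'. \<exists>V W \<phi>. open V \<and> p \<in> V \<and> V \<subseteq> S' \<and> open W \<and> \<phi> holomorphic_on W \<and>
           (\<forall>q\<in>V. G q \<in> W \<and> F q = \<phi> (G q))))"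


section \<open>The dynamical system\<close>

text \<open>The coordinates \<open>1, 2, 3, 4\<close> are \<open>x, y, z, u\<close>; time is complex.\<close>

definition vfield :: "complex^4 \<Rightarrow> complex^4" where
  "vfield p =
     (let x = p $ 1; y = p $ 2; z = p $ 3; u = p $ 4 in
      vector [(u + y^2 + z^2) * x,
              (u + y^2 - 2 * z^2) * y,
              (u - 2 * y^2 + z^2) * z,
              u^2 - y^4 + y^2 * z^2 - z^4])"

definition solution_on :: "complex set \<Rightarrow> (complex \<Rightarrow> complex^4) \<Rightarrow> bool" where
  "solution_on T p \<longleftrightarrow>
     (\<forall>\<tau>\<in>T. \<forall>i. ((\<lambda>s. p s $ i) has_field_derivative vfield (p \<tau>) $ i) (at \<tau>))"

definition first_integral_on :: "(complex^4) set \<Rightarrow> (complex^4 \<Rightarrow> complex) \<Rightarrow> bool" where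
  "first_integral_on S F \<longleftrightarrow>
     (\<forall>T p. open T \<and> connected T \<and> solution_on T p \<and> p ` T \<subseteq> S \<longrightarrow>
        (\<lambda>\<tau>. F (p \<tau>)) constant_on T)"


section \<open>Complete elliptic integrals and their branches\<close>

text \<open>The integrals are used for a real modulus \<open>0 < k < 1\<close> only, where all radicands are
  nonnegative; everything else is analytic continuation. The value at an endpoint where the
  integrand is singular is irrelevant.\<close>

definition legendre_K :: "real \<Rightarrow> real" where
  "legendre_K k = integral {0..1} (\<lambda>t. 1 / sqrt ((1 - t^2) * (1 - k^2 * t^2)))"

definition legendre_K' :: "real \<Rightarrow> real" where
  "legendre_K' k = integral {k..1} (\<lambda>t. 1 / sqrt ((1 - t^2) * (t^2 - k^2)))"

definition legendre_E :: "real \<Rightarrow> real" where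
  "legendre_E k = integral {0..1} (\<lambda>t. sqrt ((1 - k^2 * t^2) / (1 - t^2)))"

definition legendre_E' :: "real \<Rightarrow> real" where
  "legendre_E' k = integral {0..1} (\<lambda>t. sqrt ((1 - (1 - k^2) * t^2) / (1 - t^2)))"

text \<open>\<open>branch fs D gs\<close>: the tuple \<open>gs\<close> of holomorphic functions on the disc \<open>D\<close> arises from the
  tuple \<open>fs\<close> of functions on the real interval \<open>(0,1)\<close> by continuation along a chain of
  overlapping discs. All members of the tuple are continued along the same chain, which is what
  makes their branches consistent.\<close>

inductive branch :: "(real \<Rightarrow> real) list \<Rightarrow> complex set \<Rightarrow> (complex \<Rightarrow> complex) list \<Rightarrow> bool"
  for fs where
  start: "\<lbrakk>D = ball c r; \<exists>k\<in>{0<..<1}. complex_of_real k \<in> D; \<forall>g\<in>set gs. g holomorphic_on D;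
      list_all2 (\<lambda>f g. \<forall>k\<in>{0<..<1}. complex_of_real k \<in> D \<longrightarrow> g (of_real k) = of_real (f k)) fs gs\<rbrakk>
      \<Longrightarrow> branch fs D gs"
| step: "\<lbrakk>branch fs D gs; D' = ball c r; D \<inter> D' \<noteq> {}; \<forall>h\<in>set hs. h holomorphic_on D';
      list_all2 (\<lambda>g h. \<forall>w\<in>D \<inter> D'. g w = h w) gs hs\<rbrakk>
      \<Longrightarrow> branch fs D' hs"


section \<open>The integrals\<close>

definition pi_I_squared :: "complex^4 \<Rightarrow> complex" where
  "pi_I_squared p = (let x = p $ 1; y = p $ 2; z = p $ 3 in (y^2 - z^2) / x^2)"

text \<open>The arguments \<open>K, E\<close> (respectively \<open>K', E'\<close>) are the chosen branches, on a disc \<open>D\<close> of moduli;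
  the resulting branch of the integral lives on \<open>over D\<close>.\<close>

definition J1 :: "(complex \<Rightarrow> complex) \<Rightarrow> (complex \<Rightarrow> complex) \<Rightarrow> complex^4 \<Rightarrow> complex" where
  "J1 K E p =
     (let y = p $ 2; z = p $ 3; u = p $ 4 in
      1 / y * (u - 2 * y^2 + z^2) * K (z / y) + 3 * y * E (z / y))"

definition J2 :: "(complex \<Rightarrow> complex) \<Rightarrow> (complex \<Rightarrow> complex) \<Rightarrow> complex^4 \<Rightarrow> complex" where
  "J2 K' E' p =
     (let y = p $ 2; z = p $ 3; u = p $ 4 in
      1 / y * (u + y^2 + z^2) * K' (z / y) - 3 * y * E' (z / y))"

definition over :: "complex set \<Rightarrow> (complex^4) set" where
  "over D = {p. p $ 2 \<noteq> 0 \<and> p $ 3 / p $ 2 \<in> D}"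

text \<open>Two branches of \<open>J\<close> over the same disc, both continued from \<open>[f, g]\<close>, take different values.\<close>

definition multi_valued ::
    "((complex \<Rightarrow> complex) \<Rightarrow> (complex \<Rightarrow> complex) \<Rightarrow> complex^4 \<Rightarrow> complex) \<Rightarrow>
     (real \<Rightarrow> real) \<Rightarrow> (real \<Rightarrow> real) \<Rightarrow> bool" where
  "multi_valued J f g \<longleftrightarrow>
     (\<exists>D A B A' B'. branch [f, g] D [A, B] \<and> branch [f, g] D [A', B'] \<and>
        (\<exists>p\<in>over D. J A B p \<noteq> J A' B' p))"

end

theory Submission
  imports Defs
begin

text \<open>The system is integrable by complete elliptic integrals because it is a Picard--Fuchs system in disguise.
  Put \<open>m = (z / y)\<^sup>2\<close>, \<open>b = 3 y\<close> and \<open>a = (u - 2 y\<^sup>2 + z\<^sup>2) / y\<close>. Along a solution, \<open>(a, b)\<close> as a function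
  of \<open>m\<close> satisfies the linear system adjoint to that of the periods \<open>(K, E)\<close>. Hence the pairings
  \<open>J\<^sub>1 = a K + b E\<close> and \<open>J\<^sub>2 = (a + b) K' - b E'\<close> are constant, and the identity between them is Legendre's
  relation. Since \<open>x\<^sup>2\<close> is a constant multiple of \<open>y\<^sup>2 - z\<^sup>2\<close>, the trajectories are known explicitly.

  The main point is that there are no further algebraic integrals. Let \<open>F\<close> be an algebraic first integral. Its value
  \<open>w\<close> on a trajectory is constant, so the polynomial relation satisfied by \<open>F\<close>, with \<open>w\<close> inserted, is a polynomial
  that vanishes along the trajectory. Continuing the trajectory around \<open>m = 0\<close> and \<open>m = 1\<close>, where the periods
  acquire logarithms, keeps this polynomial zero but changes \<open>(J\<^sub>1, J\<^sub>2)\<close> by unipotent matrices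
  (\<open>vanishing_shear\<close>, \<open>vanishing_shear'\<close>). A polynomial in the integer exponent with infinitely many zeros
  vanishes, so the exponents may be arbitrary complex numbers, and the matrices then generate \<open>SL\<^sub>2\<close>, which is
  transitive on nonzero vectors. So the polynomial vanishes on the whole level set of the rational integral
  (\<open>solution_algebraically_independent\<close>, \<open>integral_value_is_root\<close>), and all values of \<open>F\<close> there are roots of one
  polynomial. By continuity \<open>F\<close> is locally constant on level sets
  (\<open>algebraic_integral_constant_on_fibres\<close>, \<open>algebraic_integral_dependent\<close>).

  The transcendental integrals are then not algebraic, because they depend on \<open>u\<close> while the rational one does not.
  The logarithmic term of the complementary periods, which drives the monodromy argument, also makes the two integrals
  multi-valued. Statements about arbitrary branches reduce to the principal ones by the permanence of analytic
  relations along chains of discs (\<open>branch_relation\<close>).\<close>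

section \<open>Complete elliptic integrals on the plane cut along a ray\<close>

text \<open>Throughout, elliptic integrals are functions of the parameter \<open>m = k\<^sup>2\<close>, the square of the modulus. This
  is the complement of the ray \<open>[1,\<infinity>)\<close>, where the radicand can vanish.\<close>

definition slit_plane :: "complex set" where
  "slit_plane = {m. 1 - m \<notin> \<real>\<^sub>\<le>\<^sub>0}"

definition radicand :: "complex \<Rightarrow> real \<Rightarrow> complex" where
  "radicand m \<theta> = 1 - m * of_real ((sin \<theta>)\<^sup>2)"

definition ell_K :: "complex \<Rightarrow> complex" where
  "ell_K m = integral {0..pi/2} (\<lambda>\<theta>. 1 / csqrt (radicand m \<theta>))"

definition ell_E :: "complex \<Rightarrow> complex" where
  "ell_E m = integral {0..pi/2} (\<lambda>\<theta>. csqrt (radicand m \<theta>))"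

lemma open_slit_plane: "open slit_plane"
proof -
  have "slit_plane = (\<lambda>m. 1 - m) -` (- \<real>\<^sub>\<le>\<^sub>0)"
    by (auto simp: slit_plane_def)
  moreover have "open ((\<lambda>m::complex. 1 - m) -` (- \<real>\<^sub>\<le>\<^sub>0))"
    by (intro continuous_open_vimage continuous_intros open_Compl closed_nonpos_Reals_complex)
  ultimately show ?thesis by simp
qed

lemma radicand_slit:
  assumes "m \<in> slit_plane" shows "radicand m \<theta> \<notin> \<real>\<^sub>\<le>\<^sub>0"
proof -
  define s where "s = (sin \<theta>)\<^sup>2"
  have s: "0 \<le> s" "s \<le> 1" by (auto simp: s_def abs_square_le_1)
  have m: "Im m \<noteq> 0 \<or> Re m < 1"
    using assms by (auto simp: slit_plane_def complex_nonpos_Reals_iff)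
  have R: "Re (radicand m \<theta>) = 1 - Re m * s" "Im (radicand m \<theta>) = - Im m * s"
    by (simp_all add: radicand_def s_def[symmetric])
  have "1 - Re m * s > 0" if "Im m * s = 0"
  proof (cases "s = 0")
    case False
    then have "Re m < 1" using m that by auto
    then have "Re m * s < 1 \<or> Re m * s \<le> 0"
      by (metis False leI less_eq_real_def mult_le_one mult_less_cancel_right2 mult_nonpos_nonneg order_less_le_trans s)
    then show ?thesis by auto
  qed auto
  then show ?thesis by (auto simp: complex_nonpos_Reals_iff R)
qed

lemma radicand_nonzero [simp]: "m \<in> slit_plane \<Longrightarrow> radicand m \<theta> \<noteq> 0"
  using radicand_slit[of m \<theta>] by auto

lemma csqrt_radicand_nonzero: "m \<in> slit_plane \<Longrightarrow> csqrt (radicand m \<theta>) \<noteq> 0"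
  by simp

lemma continuous_csqrt_radicand:
  "continuous_on (slit_plane \<times> A) (\<lambda>(m,\<theta>). csqrt (radicand m \<theta>))"
proof -
  have "continuous_on (slit_plane \<times> A) (\<lambda>p. csqrt (radicand (fst p) (snd p)))"
  proof (rule continuous_on_compose2[OF continuous_on_csqrt])
    show "continuous_on (slit_plane \<times> A) (\<lambda>p. radicand (fst p) (snd p))"
      unfolding radicand_def by (intro continuous_intros)
  qed (auto simp: radicand_slit)
  then show ?thesis by (simp add: case_prod_unfold)
qed

lemma continuous_csqrt_radicand_snd [continuous_intros]:
  assumes "m \<in> slit_plane"
  shows "continuous_on A (\<lambda>\<theta>. csqrt (radicand m \<theta>))"
  by (rule continuous_on_compose2[OF continuous_on_csqrt])
     (use radicand_slit[OF assms] in \<open>auto simp: radicand_def[abs_def] intro!: continuous_intros\<close>)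

text \<open>Differentiation under the integral sign is local, so it suffices to have it on small discs; these are
  convex, whereas the slit plane is not.\<close>

lemma integral_field_derivative:
  fixes f g :: "complex \<Rightarrow> real \<Rightarrow> complex"
  assumes m: "m \<in> slit_plane"
    and der: "\<And>w \<theta>. w \<in> slit_plane \<Longrightarrow> ((\<lambda>w. f w \<theta>) has_field_derivative g w \<theta>) (at w)"
    and cont: "\<And>w. w \<in> slit_plane \<Longrightarrow> continuous_on {a..b} (f w)"
    and contg: "continuous_on (slit_plane \<times> {a..b}) (\<lambda>(w,\<theta>). g w \<theta>)"
  shows "((\<lambda>w. integral {a..b} (f w)) has_field_derivative integral {a..b} (g m)) (at m)"
proof -
  obtain r where r: "r > 0" "ball m r \<subseteq> slit_plane"
    using m open_slit_plane open_contains_ball by blast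
  have "((\<lambda>w. integral (cbox a b) (f w)) has_field_derivative integral (cbox a b) (g m)) (at m within ball m r)"
  proof (rule leibniz_rule_field_derivative)
    show "((\<lambda>w. f w t) has_field_derivative g w t) (at w within ball m r)"
      if "w \<in> ball m r" "t \<in> cbox a b" for w t
      using der[of w t] r that by (meson has_field_derivative_at_within subsetD)
    show "f w integrable_on cbox a b" if "w \<in> ball m r" for w
      using cont[of w] that r by (force intro: integrable_continuous_real)
    show "continuous_on (ball m r \<times> cbox a b) (\<lambda>(x, y). g x y)"
      by (rule continuous_on_subset[OF contg]) (use r in auto)
  qed (use r in auto)
  then show ?thesis
    using at_within_open[of m "ball m r"] r by simp
qed

lemma ell_K_derivative_integral:
  assumes m: "m \<in> slit_plane"
  shows "(ell_K has_field_derivative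
           integral {0..pi/2} (\<lambda>\<theta>. of_real ((sin \<theta>)\<^sup>2) / (2 * csqrt (radicand m \<theta>) ^ 3))) (at m)"
  unfolding ell_K_def
proof (rule integral_field_derivative[OF m])
  show "((\<lambda>w. 1 / csqrt (radicand w \<theta>)) has_field_derivative
          of_real ((sin \<theta>)\<^sup>2) / (2 * csqrt (radicand w \<theta>) ^ 3)) (at w)"
    if w: "w \<in> slit_plane" for w \<theta>
    using w radicand_slit[OF w, of \<theta>] csqrt_radicand_nonzero[OF w, of \<theta>]
    unfolding radicand_def
    by (auto intro!: derivative_eq_intros simp: field_simps power3_eq_cube)
  show "continuous_on {0..pi/2} (\<lambda>\<theta>. 1 / csqrt (radicand w \<theta>))" if "w \<in> slit_plane" for w
    using that by (intro continuous_intros) auto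
  show "continuous_on (slit_plane \<times> {0..pi/2})
     (\<lambda>(w,\<theta>). complex_of_real ((sin \<theta>)\<^sup>2) / (2 * csqrt (radicand w \<theta>) ^ 3))"
    using continuous_csqrt_radicand[of "{0..pi/2}"]
    by (auto simp: case_prod_unfold intro!: continuous_intros)
qed

lemma ell_E_derivative_integral:
  assumes m: "m \<in> slit_plane"
  shows "(ell_E has_field_derivative
           integral {0..pi/2} (\<lambda>\<theta>. - of_real ((sin \<theta>)\<^sup>2) / (2 * csqrt (radicand m \<theta>)))) (at m)"
  unfolding ell_E_def
proof (rule integral_field_derivative[OF m])
  show "((\<lambda>w. csqrt (radicand w \<theta>)) has_field_derivative
          - of_real ((sin \<theta>)\<^sup>2) / (2 * csqrt (radicand w \<theta>))) (at w)"
    if w: "w \<in> slit_plane" for w \<theta>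
    using w radicand_slit[OF w, of \<theta>] csqrt_radicand_nonzero[OF w, of \<theta>]
    unfolding radicand_def
    by (auto intro!: derivative_eq_intros)
  show "continuous_on {0..pi/2} (\<lambda>\<theta>. csqrt (radicand w \<theta>))" if "w \<in> slit_plane" for w
    using that by (intro continuous_intros) auto
  show "continuous_on (slit_plane \<times> {0..pi/2})
     (\<lambda>(w,\<theta>). - complex_of_real ((sin \<theta>)\<^sup>2) / (2 * csqrt (radicand w \<theta>)))"
    using continuous_csqrt_radicand[of "{0..pi/2}"]
    by (auto simp: case_prod_unfold intro!: continuous_intros)
qed

lemma ell_K_has_integral:
  "m \<in> slit_plane \<Longrightarrow> ((\<lambda>\<theta>. 1 / csqrt (radicand m \<theta>)) has_integral ell_K m) {0..pi/2}"
  unfolding ell_K_def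
  by (intro integrable_integral integrable_continuous_real continuous_intros) auto

lemma ell_E_has_integral:
  "m \<in> slit_plane \<Longrightarrow> ((\<lambda>\<theta>. csqrt (radicand m \<theta>)) has_integral ell_E m) {0..pi/2}"
  unfolding ell_E_def
  by (intro integrable_integral integrable_continuous_real continuous_intros) auto

text \<open>The two integrands are related pointwise: with \<open>\<Delta>\<close> the root of the radicand,
  \<open>- m sin\<^sup>2 \<theta> / \<Delta> = \<Delta> - 1 / \<Delta>\<close>. The equation is kept free of denominators, so that it also
  holds at \<open>m = 0\<close>.\<close>

lemma ell_E_ode:
  assumes m: "m \<in> slit_plane"
  shows "2 * m * deriv ell_E m = ell_E m - ell_K m"
proof -
  let ?g = "\<lambda>\<theta>. - of_real ((sin \<theta>)\<^sup>2) / (2 * csqrt (radicand m \<theta>))"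
  have 1: "((\<lambda>\<theta>. csqrt (radicand m \<theta>) - 1 / csqrt (radicand m \<theta>)) has_integral ell_E m - ell_K m) {0..pi/2}"
    by (intro has_integral_diff ell_K_has_integral ell_E_has_integral m)
  have 2: "(?g has_integral deriv ell_E m) {0..pi/2}"
    unfolding DERIV_imp_deriv[OF ell_E_derivative_integral[OF m]]
    by (intro integrable_integral integrable_continuous_real continuous_intros) (use m in auto)
  have 3: "((\<lambda>\<theta>. 2 * m * ?g \<theta>) has_integral 2 * m * deriv ell_E m) {0..pi/2}"
    by (rule has_integral_mult_right[OF 2])
  have "2 * m * ?g \<theta> = csqrt (radicand m \<theta>) - 1 / csqrt (radicand m \<theta>)" for \<theta>
  proof -
    define d where "d = csqrt (radicand m \<theta>)"
    have "m * of_real ((sin \<theta>)\<^sup>2) = 1 - d ^ 2" "d \<noteq> 0"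
      using m by (simp_all add: d_def) (simp add: radicand_def)
    then have "2 * m * (- of_real ((sin \<theta>)\<^sup>2) / (2 * d)) = d - 1 / d"
      by (simp add: divide_simps) (simp add: power2_eq_square algebra_simps)
    then show ?thesis by (simp only: d_def)
  qed
  with 3 have "((\<lambda>\<theta>. csqrt (radicand m \<theta>) - 1 / csqrt (radicand m \<theta>)) has_integral 2 * m * deriv ell_E m) {0..pi/2}"
    by simp
  then show ?thesis using 1 has_integral_unique by blast
qed

text \<open>The difference of the two sides is \<open>-m\<close> times the integral of the derivative of
  \<open>sin \<theta> cos \<theta> / \<Delta>\<close>, where \<open>\<Delta>\<close> is the root of the radicand; this primitive vanishes at both
  ends of the interval.\<close>

lemma ell_K_ode:
  assumes m: "m \<in> slit_plane"
  shows "2 * m * (1 - m) * deriv ell_K m = ell_E m - (1 - m) * ell_K m"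
proof -
  define D where "D = (\<lambda>\<theta>. csqrt (radicand m \<theta>))"
  define S where "S = (\<lambda>\<theta>. complex_of_real (sin \<theta>))"
  define C where "C = (\<lambda>\<theta>. complex_of_real (cos \<theta>))"
  have D0: "D \<theta> \<noteq> 0" for \<theta> using csqrt_radicand_nonzero[OF m] by (simp add: D_def)
  have D2: "D \<theta> ^ 2 = 1 - m * S \<theta> ^ 2" for \<theta> by (simp add: D_def S_def radicand_def)
  have SC: "C \<theta> ^ 2 = 1 - S \<theta> ^ 2" for \<theta>
    unfolding S_def C_def using sin_cos_squared_add[of \<theta>]
    by (metis add_diff_cancel_left' of_real_1 of_real_diff of_real_power)
  have dS: "(S has_vector_derivative C \<theta>) (at \<theta> within A)" for \<theta> A
    unfolding S_def C_def sin_of_real[symmetric] cos_of_real[symmetric]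
    by (intro has_vector_derivative_real_field derivative_eq_intros) auto
  have dC: "(C has_vector_derivative - S \<theta>) (at \<theta> within A)" for \<theta> A
    unfolding S_def C_def sin_of_real[symmetric] cos_of_real[symmetric]
    by (intro has_vector_derivative_real_field derivative_eq_intros) auto
  have dG: "((\<lambda>w. 1 / csqrt (1 - m * w^2)) has_field_derivative m * w / csqrt (1 - m * w^2) ^ 3) (at w)"
    if "1 - m * w^2 \<notin> \<real>\<^sub>\<le>\<^sub>0" for w
  proof -
    have "csqrt (1 - m * w^2) \<noteq> 0" using that by auto
    then show ?thesis
    using that by (auto intro!: derivative_eq_intros simp: divide_simps power3_eq_cube)
  qed
  have dD: "((\<lambda>\<theta>. 1 / D \<theta>) has_vector_derivative C \<theta> * (m * S \<theta> / D \<theta> ^ 3)) (at \<theta> within A)" for \<theta> A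
  proof -
    have "1 - m * (S \<theta>)^2 \<notin> \<real>\<^sub>\<le>\<^sub>0"
      using radicand_slit[OF m, of \<theta>] by (simp add: radicand_def S_def)
    from field_vector_diff_chain_within[OF dS has_field_derivative_at_within[OF dG[OF this]]]
    show ?thesis by (simp add: o_def D_def S_def radicand_def)
  qed
  have ftc: "((\<lambda>\<theta>. S \<theta> * (C \<theta> * (C \<theta> * (m * S \<theta> / D \<theta> ^ 3)) + (- S \<theta>) * (1 / D \<theta>)) + C \<theta> * (C \<theta> * (1 / D \<theta>)))
      has_integral (S (pi/2) * (C (pi/2) * (1 / D (pi/2))) - S 0 * (C 0 * (1 / D 0)))) {0..pi/2}"
    by (rule fundamental_theorem_of_calculus) (simp, intro has_vector_derivative_mult dS dC dD)
  let ?g = "\<lambda>\<theta>. of_real ((sin \<theta>)\<^sup>2) / (2 * csqrt (radicand m \<theta>) ^ 3)"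
  have 2: "(?g has_integral deriv ell_K m) {0..pi/2}"
    unfolding DERIV_imp_deriv[OF ell_K_derivative_integral[OF m]]
    by (intro integrable_integral integrable_continuous_real continuous_intros) (use m in auto)
  have 3: "((\<lambda>\<theta>. 2 * m * (1 - m) * ?g \<theta> - csqrt (radicand m \<theta>) + (1 - m) * (1 / csqrt (radicand m \<theta>)))
     has_integral (2 * m * (1 - m) * deriv ell_K m - ell_E m + (1 - m) * ell_K m)) {0..pi/2}"
    by (intro has_integral_add has_integral_diff has_integral_mult_right ell_K_has_integral ell_E_has_integral m 2)
  have eq: "2 * m * (1 - m) * ?g \<theta> - csqrt (radicand m \<theta>) + (1 - m) * (1 / csqrt (radicand m \<theta>)) =
     - m * (S \<theta> * (C \<theta> * (C \<theta> * (m * S \<theta> / D \<theta> ^ 3)) + (- S \<theta>) * (1 / D \<theta>)) + C \<theta> * (C \<theta> * (1 / D \<theta>)))" for \<theta>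
  proof -
    have L: "2 * m * (1 - m) * ?g \<theta> - csqrt (radicand m \<theta>) + (1 - m) * (1 / csqrt (radicand m \<theta>))
       = (m * (1 - m) * S \<theta> ^ 2 - (D \<theta> ^ 2) ^ 2 + (1 - m) * D \<theta> ^ 2) / D \<theta> ^ 3"
    proof -
      have "2 * m * (1 - m) * (S \<theta> ^ 2 / (2 * D \<theta> ^ 3)) - D \<theta> + (1 - m) * (1 / D \<theta>)
         = (m * (1 - m) * S \<theta> ^ 2 - (D \<theta> ^ 2) ^ 2 + (1 - m) * D \<theta> ^ 2) / D \<theta> ^ 3"
        using D0[of \<theta>]
        by (simp add: divide_simps) (simp add: algebra_simps power2_eq_square power3_eq_cube power4_eq_xxxx)
      then show ?thesis by (simp only: S_def D_def of_real_power)
    qed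
    have R: "S \<theta> * (C \<theta> * (C \<theta> * (m * S \<theta> / D \<theta> ^ 3)) + (- S \<theta>) * (1 / D \<theta>)) + C \<theta> * (C \<theta> * (1 / D \<theta>))
       = (m * S \<theta> ^ 2 * C \<theta> ^ 2 + (C \<theta> ^ 2 - S \<theta> ^ 2) * D \<theta> ^ 2) / D \<theta> ^ 3"
      using D0[of \<theta>] by (simp add: divide_simps) (simp add: algebra_simps power2_eq_square power3_eq_cube)
    show ?thesis unfolding L R D2 SC
      by (simp add: algebra_simps power2_eq_square)
  qed
  have "((\<lambda>\<theta>. 2 * m * (1 - m) * ?g \<theta> - csqrt (radicand m \<theta>) + (1 - m) * (1 / csqrt (radicand m \<theta>)))
     has_integral (- m * (S (pi/2) * (C (pi/2) * (1 / D (pi/2))) - S 0 * (C 0 * (1 / D 0))))) {0..pi/2}"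
    unfolding eq by (rule has_integral_mult_right[OF ftc])
  from has_integral_unique[OF this 3]
  have "2 * m * (1 - m) * deriv ell_K m - ell_E m + (1 - m) * ell_K m = 0"
    by (simp add: C_def S_def)
  then show ?thesis by (simp add: algebra_simps)
qed

lemma holomorphic_ell_K: "ell_K holomorphic_on slit_plane"
  using ell_K_derivative_integral by (meson field_differentiable_at_within field_differentiable_def holomorphic_onI)

lemma holomorphic_ell_E: "ell_E holomorphic_on slit_plane"
  using ell_E_derivative_integral by (meson field_differentiable_at_within field_differentiable_def holomorphic_onI)

lemma ell_K_has_derivative:
  assumes "m \<in> slit_plane" "m \<noteq> 0"
  shows "(ell_K has_field_derivative (ell_E m - (1 - m) * ell_K m) / (2 * m * (1 - m))) (at m)"
proof -
  have "m \<noteq> 1" using assms by (auto simp: slit_plane_def)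
  then have "deriv ell_K m = (ell_E m - (1 - m) * ell_K m) / (2 * m * (1 - m))"
    using ell_K_ode[OF assms(1)] assms(2) by (simp add: field_simps)
  then show ?thesis
    using holomorphic_derivI[OF holomorphic_ell_K open_slit_plane assms(1)] by simp
qed

lemma ell_E_has_derivative:
  assumes "m \<in> slit_plane" "m \<noteq> 0"
  shows "(ell_E has_field_derivative (ell_E m - ell_K m) / (2 * m)) (at m)"
proof -
  have "deriv ell_E m = (ell_E m - ell_K m) / (2 * m)"
    using ell_E_ode[OF assms(1)] assms(2) by (simp add: field_simps)
  then show ?thesis
    using holomorphic_derivI[OF holomorphic_ell_E open_slit_plane assms(1)] by simp
qed

lemma ell_K_0 [simp]: "ell_K 0 = of_real (pi / 2)"
  by (simp add: ell_K_def radicand_def scaleR_conv_of_real)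

lemma ell_E_0 [simp]: "ell_E 0 = of_real (pi / 2)"
  by (simp add: ell_E_def radicand_def scaleR_conv_of_real)


section \<open>Comparison with Legendre's integrals\<close>

text \<open>Change of variables for Legendre's improper integrals. The finite set \<open>N\<close> collects the parameters that are
  sent to singularities of the integrand, where the two integrands disagree because division by zero gives zero.\<close>

lemma integral_substitution_off_finite:
  fixes f g h :: "real \<Rightarrow> real"
  assumes h: "continuous_on {a..b} h" and "finite N"
    and der: "\<And>x. x \<in> {a..b} \<Longrightarrow> (g has_field_derivative g' x) (at x)"
    and inj: "inj_on g {a..b}"
    and eq: "\<And>x. x \<in> {a..b} - N \<Longrightarrow> \<bar>g' x\<bar> * f (g x) = h x"
  shows "integral (g ` {a..b}) f = integral {a..b} h"
proof -
  have "h absolutely_integrable_on {a..b}"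
    using h absolutely_integrable_continuous_real by blast
  then have "(\<lambda>x. \<bar>g' x\<bar> * f (g x)) absolutely_integrable_on {a..b}"
    by (rule absolutely_integrable_spike[OF _ negligible_finite[OF \<open>finite N\<close>]]) (use eq in auto)
  moreover have "integral {a..b} (\<lambda>x. \<bar>g' x\<bar> * f (g x)) = integral {a..b} h"
    by (rule integral_spike[OF negligible_finite[OF \<open>finite N\<close>]]) (use eq in auto)
  ultimately show ?thesis
    using has_absolute_integral_change_of_variables_1'[of "{a..b}" g g' f "integral {a..b} h"] der inj
    by (auto simp: has_field_derivative_at_within)
qed

lemma sin_image_quarter: "sin ` {0..pi/2} = {0..1}"
proof -
  have "t \<in> sin ` {0..pi/2}" if "0 \<le> t" "t \<le> 1" for t
    by (rule image_eqI[of _ _ "arcsin t"]) (use that arcsin_bounded[of t] arcsin_nonneg[of t] in auto)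
  then show ?thesis by (auto simp: sin_ge_zero)
qed

lemma inj_on_sin_quarter: "inj_on sin {0..pi/2}"
  by (rule inj_onI) (auto intro: sin_inj_pi)

lemma real_radicand_pos:
  assumes "(m::real) < 1" shows "0 < 1 - m * (sin \<theta>)\<^sup>2"
proof -
  have s: "(sin \<theta>)\<^sup>2 \<le> 1" by (simp add: abs_square_le_1)
  show ?thesis
  proof (cases "m \<le> 0")
    case True
    then have "m * (sin \<theta>)\<^sup>2 \<le> 0" by (simp add: mult_nonpos_nonneg)
    then show ?thesis by linarith
  next
    case False
    then have "m * (sin \<theta>)\<^sup>2 \<le> m * 1" using s by (intro mult_left_mono) auto
    then show ?thesis using assms by linarith
  qed
qed

lemma of_real_slit: "(m::real) < 1 \<Longrightarrow> of_real m \<in> slit_plane"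
  by (auto simp: slit_plane_def complex_nonpos_Reals_iff)

lemma csqrt_radicand_of_real:
  assumes "(m::real) < 1"
  shows "csqrt (radicand (of_real m) \<theta>) = of_real (sqrt (1 - m * (sin \<theta>)\<^sup>2))"
proof -
  have "radicand (of_real m) \<theta> = of_real (1 - m * (sin \<theta>)\<^sup>2)"
    by (simp add: radicand_def)
  then show ?thesis
    using real_radicand_pos[OF assms, of \<theta>] by (metis less_imp_le of_real_sqrt)
qed

lemma continuous_sqrt_radicand [continuous_intros]:
  "(m::real) < 1 \<Longrightarrow> continuous_on A (\<lambda>\<theta>. sqrt (1 - m * (sin \<theta>)\<^sup>2))"
  by (intro continuous_intros)

lemma sqrt_radicand_nonzero: "(m::real) < 1 \<Longrightarrow> sqrt (1 - m * (sin \<theta>)\<^sup>2) \<noteq> 0"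
  using real_radicand_pos[of m \<theta>] by simp

lemma ell_K_of_real:
  assumes "(m::real) < 1"
  shows "ell_K (of_real m) = of_real (integral {0..pi/2} (\<lambda>\<theta>. 1 / sqrt (1 - m * (sin \<theta>)\<^sup>2)))"
proof -
  have "((\<lambda>\<theta>. 1 / sqrt (1 - m * (sin \<theta>)\<^sup>2)) has_integral
      integral {0..pi/2} (\<lambda>\<theta>. 1 / sqrt (1 - m * (sin \<theta>)\<^sup>2))) {0..pi/2}"
    by (intro integrable_integral integrable_continuous_real continuous_intros)
       (use assms sqrt_radicand_nonzero in auto)
  from has_integral_of_real[OF this, where 'b=complex] show ?thesis
    unfolding ell_K_def csqrt_radicand_of_real[OF assms] by (simp add: integral_unique)
qed

lemma ell_E_of_real:
  assumes "(m::real) < 1"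
  shows "ell_E (of_real m) = of_real (integral {0..pi/2} (\<lambda>\<theta>. sqrt (1 - m * (sin \<theta>)\<^sup>2)))"
proof -
  have "((\<lambda>\<theta>. sqrt (1 - m * (sin \<theta>)\<^sup>2)) has_integral
      integral {0..pi/2} (\<lambda>\<theta>. sqrt (1 - m * (sin \<theta>)\<^sup>2))) {0..pi/2}"
    by (intro integrable_integral integrable_continuous_real continuous_intros assms)
  from has_integral_of_real[OF this, where 'b=complex] show ?thesis
    unfolding ell_E_def csqrt_radicand_of_real[OF assms] by (simp add: integral_unique)
qed

lemma real_modulus_square:
  assumes "k \<in> {0<..<1::real}" shows "k\<^sup>2 < 1" "0 < k\<^sup>2" "1 - k\<^sup>2 < 1" "0 < 1 - k\<^sup>2"
  using assms power_strict_mono[of k 1 2] by auto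

lemma cos_pos_quarter: "x \<in> {0..pi/2} - {pi/2} \<Longrightarrow> 0 < cos x"
  by (intro cos_gt_zero_pi) auto

lemma legendre_K_eq:
  assumes k: "k \<in> {0<..<1}"
  shows "complex_of_real (legendre_K k) = ell_K ((of_real k)\<^sup>2)"
proof -
  note k' = real_modulus_square[OF k]
  have "integral (sin ` {0..pi/2}) (\<lambda>t. 1 / sqrt ((1 - t\<^sup>2) * (1 - k\<^sup>2 * t\<^sup>2))) =
        integral {0..pi/2} (\<lambda>\<theta>. 1 / sqrt (1 - k\<^sup>2 * (sin \<theta>)\<^sup>2))"
  proof (rule integral_substitution_off_finite[where g' = cos and N = "{pi/2}"])
    show "continuous_on {0..pi/2} (\<lambda>\<theta>. 1 / sqrt (1 - k\<^sup>2 * (sin \<theta>)\<^sup>2))"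
      by (intro continuous_intros k') (use sqrt_radicand_nonzero[OF k'(1)] in auto)
    show "\<bar>cos x\<bar> * (1 / sqrt ((1 - (sin x)\<^sup>2) * (1 - k\<^sup>2 * (sin x)\<^sup>2))) = 1 / sqrt (1 - k\<^sup>2 * (sin x)\<^sup>2)"
      if "x \<in> {0..pi/2} - {pi/2}" for x
      using cos_pos_quarter[OF that] real_radicand_pos[OF k'(1), of x]
      by (simp add: real_sqrt_mult cos_squared_eq[symmetric])
  qed (auto intro!: derivative_eq_intros inj_on_sin_quarter)
  then show ?thesis
    using ell_K_of_real[OF k'(1)] by (simp add: legendre_K_def sin_image_quarter)
qed

lemma integral_E_eq:
  assumes m: "(m::real) < 1"
  shows "complex_of_real (integral {0..1} (\<lambda>t. sqrt ((1 - m * t\<^sup>2) / (1 - t\<^sup>2)))) = ell_E (of_real m)"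
proof -
  have "integral (sin ` {0..pi/2}) (\<lambda>t. sqrt ((1 - m * t\<^sup>2) / (1 - t\<^sup>2))) =
        integral {0..pi/2} (\<lambda>\<theta>. sqrt (1 - m * (sin \<theta>)\<^sup>2))"
  proof (rule integral_substitution_off_finite[where g' = cos and N = "{pi/2}"])
    show "continuous_on {0..pi/2} (\<lambda>\<theta>. sqrt (1 - m * (sin \<theta>)\<^sup>2))"
      by (intro continuous_intros m)
    show "\<bar>cos x\<bar> * sqrt ((1 - m * (sin x)\<^sup>2) / (1 - (sin x)\<^sup>2)) = sqrt (1 - m * (sin x)\<^sup>2)"
      if "x \<in> {0..pi/2} - {pi/2}" for x
    proof -
      have "sqrt ((1 - m * (sin x)\<^sup>2) / (1 - (sin x)\<^sup>2)) = sqrt (1 - m * (sin x)\<^sup>2) / cos x"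
        unfolding cos_squared_eq[symmetric] real_sqrt_divide using cos_pos_quarter[OF that] by simp
      then show ?thesis using cos_pos_quarter[OF that] by simp
    qed
  qed (auto intro!: derivative_eq_intros inj_on_sin_quarter)
  then show ?thesis
    using ell_E_of_real[OF m] by (simp add: sin_image_quarter)
qed

lemma legendre_E_eq:
  assumes k: "k \<in> {0<..<1}"
  shows "complex_of_real (legendre_E k) = ell_E ((of_real k)\<^sup>2)"
  using integral_E_eq[OF real_modulus_square(1)[OF k]] by (simp add: legendre_E_def)

lemma legendre_E'_eq:
  assumes k: "k \<in> {0<..<1}"
  shows "complex_of_real (legendre_E' k) = ell_E (1 - (of_real k)\<^sup>2)"
  using integral_E_eq[OF real_modulus_square(3)[OF k]] by (simp add: legendre_E'_def)

text \<open>The substitution \<open>t = \<surd>(1 - (1 - k\<^sup>2) sin\<^sup>2 \<theta>)\<close> turns the integral over \<open>[k,1]\<close> into the complete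
  integral for the complementary parameter \<open>1 - k\<^sup>2\<close>.\<close>

lemma legendre_K'_eq:
  assumes k: "k \<in> {0<..<1}"
  shows "complex_of_real (legendre_K' k) = ell_K (1 - (of_real k)\<^sup>2)"
proof -
  define n where "n = 1 - k\<^sup>2"
  have n: "n < 1" "0 < n" "k\<^sup>2 = 1 - n" "0 < k" "k < 1"
    using real_modulus_square[OF k] k by (auto simp: n_def)
  define g where "g = (\<lambda>\<theta>. sqrt (1 - n * (sin \<theta>)\<^sup>2))"
  have g_pos: "0 < g \<theta>" and g2: "(g \<theta>)\<^sup>2 = 1 - n * (sin \<theta>)\<^sup>2" for \<theta>
    using real_radicand_pos[OF n(1), of \<theta>] by (auto simp: g_def)
  have inj: "inj_on g {0..pi/2}"
  proof (rule inj_onI)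
    fix x y assume xy: "x \<in> {0..pi/2}" "y \<in> {0..pi/2}" and "g x = g y"
    then have "(sin x)\<^sup>2 = (sin y)\<^sup>2" using g2[of x] g2[of y] n by auto
    moreover have "0 \<le> sin x" "0 \<le> sin y" using xy by (auto intro!: sin_ge_zero)
    ultimately have "sin x = sin y" by (simp add: power2_eq_iff_nonneg)
    then show "x = y" using xy inj_on_sin_quarter by (auto dest: inj_onD)
  qed
  have image: "g ` {0..pi/2} = {k..1}"
  proof (intro equalityI subsetI)
    fix t assume "t \<in> g ` {0..pi/2}"
    then obtain x where x: "t = g x" by auto
    have "k\<^sup>2 \<le> t\<^sup>2" "t\<^sup>2 \<le> 1" "0 < t"
      using g2[of x] g_pos[of x] n mult_left_mono[of "(sin x)\<^sup>2" 1 n] by (auto simp: x abs_square_le_1)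
    then show "t \<in> {k..1}"
      using n power2_le_imp_le[of k t] power2_le_imp_le[of t 1] by auto
  next
    fix t assume t: "t \<in> {k..1}"
    have k_eq: "sqrt (1 - n) = k" using n by (metis less_imp_le real_sqrt_unique)
    have "\<exists>x\<ge>0. x \<le> pi/2 \<and> g x = t"
      by (rule IVT2'[of g "pi/2" t 0]) (use t n k_eq in \<open>auto simp: g_def intro!: continuous_intros\<close>)
    then show "t \<in> g ` {0..pi/2}" by auto
  qed
  have "integral (g ` {0..pi/2}) (\<lambda>t. 1 / sqrt ((1 - t\<^sup>2) * (t\<^sup>2 - k\<^sup>2))) =
        integral {0..pi/2} (\<lambda>\<theta>. 1 / g \<theta>)"
  proof (rule integral_substitution_off_finite[where g' = "\<lambda>x. - n * sin x * cos x / g x" and N = "{0, pi/2}"])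
    show "continuous_on {0..pi/2} (\<lambda>\<theta>. 1 / g \<theta>)"
      unfolding g_def by (intro continuous_intros n) (use sqrt_radicand_nonzero[OF n(1)] in auto)
    show "(g has_field_derivative - n * sin x * cos x / g x) (at x)" for x
      unfolding g_def using real_radicand_pos[OF n(1), of x]
      by (auto intro!: derivative_eq_intros simp: field_simps)
    show "\<bar>- n * sin x * cos x / g x\<bar> * (1 / sqrt ((1 - (g x)\<^sup>2) * ((g x)\<^sup>2 - k\<^sup>2))) = 1 / g x"
      if x: "x \<in> {0..pi/2} - {0, pi/2}" for x
    proof -
      have sc: "0 < cos x" "0 < sin x" using x cos_pos_quarter[of x] by (auto intro!: sin_gt_zero)
      have "(1 - (g x)\<^sup>2) * ((g x)\<^sup>2 - k\<^sup>2) = (n * sin x * cos x)\<^sup>2"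
        unfolding g2 n(3) power_mult_distrib cos_squared_eq by (simp add: algebra_simps power2_eq_square)
      then have "sqrt ((1 - (g x)\<^sup>2) * ((g x)\<^sup>2 - k\<^sup>2)) = n * sin x * cos x"
        using sc n by simp
      then show ?thesis using sc n g_pos[of x] by (simp add: abs_mult)
    qed
  qed (use inj in auto)
  then show ?thesis
    using ell_K_of_real[OF n(1)] unfolding image by (simp add: legendre_K'_def g_def n_def)
qed


section \<open>Legendre's relation\<close>

text \<open>The common domain of the functions of \<open>m\<close> and of \<open>1 - m\<close>: the complement of
  \<open>(-\<infinity>,0] \<union> [1,\<infinity>)\<close>. It is star-shaped about \<open>1/2\<close> and invariant under \<open>m \<mapsto> 1 - m\<close>.\<close>

definition cut_plane :: "complex set" where
  "cut_plane = {m. m \<notin> \<real>\<^sub>\<le>\<^sub>0 \<and> 1 - m \<notin> \<real>\<^sub>\<le>\<^sub>0}"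

lemma cut_plane_iff: "m \<in> cut_plane \<longleftrightarrow> Im m \<noteq> 0 \<or> 0 < Re m \<and> Re m < 1"
  by (auto simp: cut_plane_def complex_nonpos_Reals_iff)

lemma open_cut_plane: "open cut_plane"
proof -
  have "cut_plane = - \<real>\<^sub>\<le>\<^sub>0 \<inter> slit_plane" by (auto simp: cut_plane_def slit_plane_def)
  then show ?thesis
    by (metis open_slit_plane closed_nonpos_Reals_complex open_Int open_Compl)
qed

lemma cut_planeD:
  assumes "m \<in> cut_plane"
  shows "m \<in> slit_plane" "1 - m \<in> slit_plane" "1 - m \<in> cut_plane" "m \<noteq> 0" "m \<noteq> 1"
        "m \<notin> \<real>\<^sub>\<le>\<^sub>0" "1 - m \<notin> \<real>\<^sub>\<le>\<^sub>0"
  using assms by (auto simp: cut_plane_def slit_plane_def)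

lemma connected_cut_plane: "connected cut_plane"
proof -
  have "starlike cut_plane"
    unfolding starlike_def
  proof (intro bexI[of _ "1/2"] ballI subsetI)
    fix x m :: complex assume x: "x \<in> cut_plane" and m: "m \<in> closed_segment (1/2) x"
    then obtain u where u: "0 \<le> u" "u \<le> 1" "m = (1 - u) *\<^sub>R (1/2) + u *\<^sub>R x"
      by (auto simp: closed_segment_def)
    show "m \<in> cut_plane"
    proof (cases "u = 0 \<or> Im x \<noteq> 0")
      case True then show ?thesis using u by (auto simp: cut_plane_iff)
    next
      case False
      then have "0 < Re x" "Re x < 1" "u > 0" using x u by (auto simp: cut_plane_iff)
      then have "u * Re x > 0" "u * Re x < u" by auto
      then have "0 < (1 - u) / 2 + u * Re x" "(1 - u) / 2 + u * Re x < 1"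
        using u by (auto simp: field_simps)
      then show ?thesis using u by (auto simp: cut_plane_iff)
    qed
  qed (auto simp: cut_plane_iff)
  then show ?thesis by (rule starlike_imp_connected)
qed

lemma ell_K'_has_derivative:
  assumes "m \<in> cut_plane"
  shows "((\<lambda>m. ell_K (1 - m)) has_field_derivative - (ell_E (1 - m) - m * ell_K (1 - m)) / (2 * m * (1 - m))) (at m)"
proof -
  have "((\<lambda>m. ell_K (1 - m)) has_field_derivative
      (ell_E (1 - m) - (1 - (1 - m)) * ell_K (1 - m)) / (2 * (1 - m) * (1 - (1 - m))) * (-1)) (at m)"
    by (rule DERIV_chain2[where f = ell_K and g = "\<lambda>m. 1 - m", OF ell_K_has_derivative])
       (use cut_planeD[OF assms] in \<open>auto intro!: derivative_eq_intros\<close>)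
  then show ?thesis by (simp add: mult_ac)
qed

lemma ell_E'_has_derivative:
  assumes "m \<in> cut_plane"
  shows "((\<lambda>m. ell_E (1 - m)) has_field_derivative - (ell_E (1 - m) - ell_K (1 - m)) / (2 * (1 - m))) (at m)"
proof -
  have "((\<lambda>m. ell_E (1 - m)) has_field_derivative
      (ell_E (1 - m) - ell_K (1 - m)) / (2 * (1 - m)) * (-1)) (at m)"
    by (rule DERIV_chain2[where f = ell_E and g = "\<lambda>m. 1 - m", OF ell_E_has_derivative])
       (use cut_planeD[OF assms] in \<open>auto intro!: derivative_eq_intros\<close>)
  then show ?thesis by (rule DERIV_cong) (simp add: minus_divide_left)
qed

text \<open>Any bound of order \<open>o(1/m)\<close> on \<open>K(1 - m)\<close> as \<open>m \<rightarrow> 0\<close> suffices to evaluate Legendre's constant, since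
  \<open>E - K = O(m)\<close>.\<close>

lemma norm_ell_K'_le:
  assumes t: "0 < t" "t < 1"
  shows "norm (ell_K (1 - of_real t)) \<le> (pi/2) / sqrt t"
proof -
  have "norm (integral {0..pi/2} (\<lambda>\<theta>. 1 / sqrt (1 - (1 - t) * (sin \<theta>)\<^sup>2))) \<le> (1 / sqrt t) * (pi/2 - 0)"
  proof (rule integral_bound)
    show "continuous_on {0..pi/2} (\<lambda>\<theta>. 1 / sqrt (1 - (1 - t) * (sin \<theta>)\<^sup>2))"
      by (intro continuous_intros) (use t sqrt_radicand_nonzero[of "1 - t"] in auto)
    show "norm (1 / sqrt (1 - (1 - t) * (sin \<theta>)\<^sup>2)) \<le> 1 / sqrt t" for \<theta>
    proof -
      have "(1 - t) * (sin \<theta>)\<^sup>2 \<le> 1 - t" using t mult_left_mono[of "(sin \<theta>)\<^sup>2" 1 "1 - t"] by (auto simp: abs_square_le_1)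
      then have "sqrt t \<le> sqrt (1 - (1 - t) * (sin \<theta>)\<^sup>2)" by simp
      then show ?thesis using t by (auto simp: frac_le)
    qed
  qed auto
  then show ?thesis using ell_K_of_real[of "1 - t"] t by simp
qed

lemma norm_ell_E'_minus_1_le:
  assumes t: "0 < t" "t < 1"
  shows "norm (ell_E (1 - of_real t) - 1) \<le> sqrt t * (pi/2)"
proof -
  have c: "(cos has_integral (sin (pi/2) - sin 0)) {0..pi/2}"
    by (rule fundamental_theorem_of_calculus)
       (auto simp: has_real_derivative_iff_has_vector_derivative[symmetric] intro!: derivative_eq_intros)
  have "integral {0..pi/2} (\<lambda>\<theta>. sqrt (1 - (1 - t) * (sin \<theta>)\<^sup>2)) - 1
      = integral {0..pi/2} (\<lambda>\<theta>. sqrt (1 - (1 - t) * (sin \<theta>)\<^sup>2) - cos \<theta>)"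
    using c t by (subst integral_diff)
      (auto intro!: integrable_continuous_real continuous_intros simp: integral_unique)
  moreover have "norm (integral {0..pi/2} (\<lambda>\<theta>. sqrt (1 - (1 - t) * (sin \<theta>)\<^sup>2) - cos \<theta>)) \<le> sqrt t * (pi/2 - 0)"
  proof (rule integral_bound)
    show "continuous_on {0..pi/2} (\<lambda>\<theta>. sqrt (1 - (1 - t) * (sin \<theta>)\<^sup>2) - cos \<theta>)"
      by (intro continuous_intros) (use t in auto)
    show "norm (sqrt (1 - (1 - t) * (sin \<theta>)\<^sup>2) - cos \<theta>) \<le> sqrt t" if "\<theta> \<in> {0..pi/2}" for \<theta>
    proof -
      have c: "0 \<le> cos \<theta>" using that by (intro cos_ge_zero) auto
      have eq: "1 - (1 - t) * (sin \<theta>)\<^sup>2 = (cos \<theta>)\<^sup>2 + t * (sin \<theta>)\<^sup>2"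
        by (simp add: cos_squared_eq algebra_simps)
      have "sqrt ((cos \<theta>)\<^sup>2 + t * (sin \<theta>)\<^sup>2) \<le> sqrt ((cos \<theta>)\<^sup>2) + sqrt (t * (sin \<theta>)\<^sup>2)"
        using t by (intro sqrt_add_le_add_sqrt) auto
      moreover have "sqrt (t * (sin \<theta>)\<^sup>2) \<le> sqrt t"
        by (rule real_sqrt_le_mono) (use t in \<open>simp add: abs_square_le_1 mult_left_le\<close>)
      moreover have "sqrt ((cos \<theta>)\<^sup>2) \<le> sqrt ((cos \<theta>)\<^sup>2 + t * (sin \<theta>)\<^sup>2)"
        using t by (intro real_sqrt_le_mono) auto
      moreover have "sqrt ((cos \<theta>)\<^sup>2) = cos \<theta>" using c by simp
      ultimately show ?thesis unfolding eq real_norm_def abs_le_iff by linarith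
    qed
  qed auto
  ultimately have "norm (integral {0..pi/2} (\<lambda>\<theta>. sqrt (1 - (1 - t) * (sin \<theta>)\<^sup>2)) - 1) \<le> sqrt t * (pi/2)"
    by simp
  moreover have "ell_E (1 - of_real t) - 1 = of_real (integral {0..pi/2} (\<lambda>\<theta>. sqrt (1 - (1 - t) * (sin \<theta>)\<^sup>2)) - 1)"
    using ell_E_of_real[of "1 - t"] t by simp
  ultimately show ?thesis by (simp only: norm_of_real real_norm_def)
qed

text \<open>The left-hand side is constant by the differential equations, and its value is the limit as \<open>m \<rightarrow> 0\<close>
  from the right: write it as \<open>(E - K) K' + E' K\<close>, where \<open>E - K = O(m)\<close> beats the growth of \<open>K'\<close> and
  \<open>E' K \<rightarrow> \<pi> / 2\<close>.\<close>

theorem legendre_relation: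
  assumes "m \<in> cut_plane"
  shows "ell_E m * ell_K (1 - m) + ell_E (1 - m) * ell_K m - ell_K m * ell_K (1 - m) = of_real (pi / 2)"
proof -
  define L where "L = (\<lambda>m. ell_E m * ell_K (1 - m) + ell_E (1 - m) * ell_K m - ell_K m * ell_K (1 - m))"
  have "(L has_field_derivative 0) (at m)" if m: "m \<in> cut_plane" for m
  proof -
    define K E K' E' where defs: "K = ell_K m" "E = ell_E m" "K' = ell_K (1 - m)" "E' = ell_E (1 - m)"
    have n: "m \<noteq> 0" "1 - m \<noteq> 0" using cut_planeD[OF m] by auto
    let ?d = "((E - K) / (2 * m)) * K' + (- (E' - m * K') / (2 * m * (1 - m))) * E
       + ((- (E' - K') / (2 * (1 - m))) * K + ((E - (1 - m) * K) / (2 * m * (1 - m))) * E')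
       - (((E - (1 - m) * K) / (2 * m * (1 - m))) * K' + (- (E' - m * K') / (2 * m * (1 - m))) * K)"
    have "(L has_field_derivative ?d) (at m)"
      unfolding L_def defs
      by (intro DERIV_add DERIV_diff DERIV_mult ell_K_has_derivative ell_E_has_derivative
          ell_K'_has_derivative ell_E'_has_derivative m) (use cut_planeD[OF m] in auto)
    moreover have "?d = 0"
      using n by (simp add: divide_simps) (simp add: algebra_simps)
    ultimately show ?thesis by simp
  qed
  then obtain c where c: "\<And>m. m \<in> cut_plane \<Longrightarrow> L m = c"
    using has_field_derivative_0_imp_constant_on[OF _ connected_cut_plane open_cut_plane, of L]
    unfolding constant_on_def by blast
  have ev: "eventually (\<lambda>t::real. 0 < t \<and> t < 1) (at_right 0)"
    by (auto simp: eventually_at_right_field intro: exI[of _ 1])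
  have of_real_0: "filterlim complex_of_real (at 0) (at_right 0)"
  proof (rule filterlim_atI)
    show "((\<lambda>t. complex_of_real t) \<longlongrightarrow> 0) (at_right 0)"
      by (rule tendsto_eq_rhs[OF tendsto_of_real[OF tendsto_ident_at]]) simp
    show "eventually (\<lambda>t. complex_of_real t \<noteq> 0) (at_right 0)"
      using ev by eventually_elim auto
  qed
  have sqrt0: "((\<lambda>t. sqrt t) \<longlongrightarrow> 0) (at_right 0)"
    by (rule tendsto_eq_rhs[OF tendsto_real_sqrt[OF tendsto_ident_at]]) auto
  have zero: "0 \<in> slit_plane" using of_real_slit[of 0] by simp
  have "((\<lambda>w. ell_E w - ell_K w) has_field_derivative deriv (\<lambda>w. ell_E w - ell_K w) 0) (at 0)"
    by (rule holomorphic_derivI[OF _ open_slit_plane zero])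
       (intro holomorphic_intros holomorphic_ell_E holomorphic_ell_K)
  then have "((\<lambda>w. (ell_E w - ell_K w) / w) \<longlongrightarrow> deriv (\<lambda>w. ell_E w - ell_K w) 0) (at 0)"
    unfolding has_field_derivative_iff by simp
  from filterlim_compose[OF this of_real_0]
  have A: "((\<lambda>t. (ell_E (of_real t) - ell_K (of_real t)) / of_real t) \<longlongrightarrow> deriv (\<lambda>w. ell_E w - ell_K w) 0) (at_right 0)" .
  have B: "((\<lambda>t. of_real t * ell_K (1 - of_real t)) \<longlongrightarrow> 0) (at_right 0)"
  proof (rule Lim_null_comparison)
    show "eventually (\<lambda>t. norm (of_real t * ell_K (1 - of_real t)) \<le> sqrt t * (pi/2)) (at_right 0)"
      using ev
    proof eventually_elim
      case (elim t)
      then have "norm (of_real t * ell_K (1 - of_real t)) \<le> t * ((pi/2) / sqrt t)"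
        unfolding norm_mult using norm_ell_K'_le[of t] by (intro mult_mono) auto
      also have "\<dots> = sqrt t * (pi/2)" using elim by (simp add: field_simps flip: real_sqrt_mult)
      finally show ?case .
    qed
    show "((\<lambda>t. sqrt t * (pi/2)) \<longlongrightarrow> 0) (at_right 0)" by (rule tendsto_mult_left_zero[OF sqrt0])
  qed
  have C: "((\<lambda>t. ell_E (1 - of_real t) - 1) \<longlongrightarrow> 0) (at_right 0)"
  proof (rule Lim_null_comparison)
    show "eventually (\<lambda>t. norm (ell_E (1 - of_real t) - 1) \<le> sqrt t * (pi/2)) (at_right 0)"
      using ev by eventually_elim (use norm_ell_E'_minus_1_le in auto)
    show "((\<lambda>t. sqrt t * (pi/2)) \<longlongrightarrow> 0) (at_right 0)" by (rule tendsto_mult_left_zero[OF sqrt0])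
  qed
  have "isCont ell_K 0"
    using holomorphic_on_imp_continuous_on[OF holomorphic_ell_K] open_slit_plane zero
    by (simp add: continuous_on_eq_continuous_at)
  then have D: "((\<lambda>t. ell_K (of_real t)) \<longlongrightarrow> of_real (pi/2)) (at_right 0)"
    using filterlim_compose[OF _ of_real_0, of ell_K "nhds (ell_K 0)"] by (simp add: isCont_def)
  let ?f = "\<lambda>t. (ell_E (of_real t) - ell_K (of_real t)) / of_real t * (of_real t * ell_K (1 - of_real t))"
  have "((\<lambda>t. ?f t
     + (ell_E (1 - of_real t) - 1 + 1) * ell_K (of_real t)) \<longlongrightarrow>
      deriv (\<lambda>w. ell_E w - ell_K w) 0 * 0 + (0 + 1) * of_real (pi/2)) (at_right 0)"
    by (intro tendsto_intros A B C D)
  moreover have "eventually (\<lambda>t. ?f t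
     + (ell_E (1 - of_real t) - 1 + 1) * ell_K (of_real t) = c) (at_right 0)"
    using ev
  proof eventually_elim
    case (elim t)
    then have "complex_of_real t \<in> cut_plane" by (simp add: cut_plane_iff)
    from c[OF this] have "L (complex_of_real t) = c" .
    moreover have "?f t
        = (ell_E (of_real t) - ell_K (of_real t)) * ell_K (1 - of_real t)"
      using elim by simp
    ultimately show ?case unfolding L_def by (simp only:) (simp add: algebra_simps)
  qed
  ultimately have "((\<lambda>t::real. c) \<longlongrightarrow> of_real (pi/2)) (at_right 0)"
    by (simp add: tendsto_cong)
  then have "c = of_real (pi/2)" by (simp add: tendsto_const_iff)
  then show ?thesis using c[OF assms] by (simp add: L_def)
qed


section \<open>Logarithmic behaviour of the second period\<close>

lemma ball_01_slit: "w \<in> ball 0 1 \<Longrightarrow> w \<in> slit_plane"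
  using complex_Re_le_cmod[of w] by (auto simp: slit_plane_def complex_nonpos_Reals_iff)

lemma ball_01_cut:
  assumes "w \<in> ball 0 1" "w \<notin> \<real>\<^sub>\<le>\<^sub>0" shows "w \<in> cut_plane"
  using ball_01_slit[OF assms(1)] assms(2) by (simp add: cut_plane_def slit_plane_def)

lemma connected_slit_ball: "connected (ball 0 r - \<real>\<^sub>\<le>\<^sub>0 :: complex set)"
proof (cases "r > 0")
  case True
  have "starlike (ball 0 r - \<real>\<^sub>\<le>\<^sub>0 :: complex set)"
    unfolding starlike_def
  proof (intro bexI[of _ "of_real (r/2)"] ballI subsetI)
    fix x m :: complex
    assume x: "x \<in> ball 0 r - \<real>\<^sub>\<le>\<^sub>0" and m: "m \<in> closed_segment (of_real (r/2)) x"
    have "m \<in> ball 0 r"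
      using closed_segment_subset[of "of_real (r/2)" "ball 0 r" x] m x True by auto
    moreover obtain u where u: "0 \<le> u" "u \<le> 1" "m = (1 - u) *\<^sub>R of_real (r/2) + u *\<^sub>R x"
      using m by (auto simp: closed_segment_def)
    have "m \<notin> \<real>\<^sub>\<le>\<^sub>0"
    proof (cases "u = 0 \<or> Im x \<noteq> 0")
      case True then show ?thesis using u \<open>r > 0\<close> by (auto simp: complex_nonpos_Reals_iff)
    next
      case False
      then have "0 < Re x" "u > 0" using x u by (auto simp: complex_nonpos_Reals_iff)
      then have "0 < (1 - u) * (r/2) + u * Re x"
        using u \<open>r > 0\<close> by (intro add_nonneg_pos mult_nonneg_nonneg mult_pos_pos) auto
      then show ?thesis using u by (auto simp: complex_nonpos_Reals_iff)
    qed
    ultimately show "m \<in> ball 0 r - \<real>\<^sub>\<le>\<^sub>0" by auto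
  qed (use True in \<open>auto simp: complex_nonpos_Reals_iff\<close>)
  then show ?thesis by (rule starlike_imp_connected)
qed (simp add: ball_empty)

text \<open>The Wronskian of the two periods is given by Legendre's relation.\<close>

lemma period_ratio_has_derivative:
  assumes w: "w \<in> cut_plane" and nz: "ell_K w \<noteq> 0"
  shows "((\<lambda>w. ell_K (1 - w) / ell_K w) has_field_derivative
           - of_real pi / (4 * w * (1 - w) * (ell_K w)\<^sup>2)) (at w)"
proof -
  define K E K' E' where defs: "K = ell_K w" "E = ell_E w" "K' = ell_K (1 - w)" "E' = ell_E (1 - w)"
  have n: "w \<noteq> 0" "1 - w \<noteq> 0" "K \<noteq> 0" using cut_planeD[OF w] nz by (auto simp: defs)
  have leg: "E * K' + E' * K - K * K' = of_real pi / 2"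
    using legendre_relation[OF w] by (simp add: defs)
  have "((\<lambda>w. ell_K (1 - w) / ell_K w) has_field_derivative
     (- (E' - w * K') / (2 * w * (1 - w)) * K - K' * ((E - (1 - w) * K) / (2 * w * (1 - w)))) / (K * K)) (at w)"
    unfolding defs
    by (intro DERIV_divide ell_K_has_derivative ell_K'_has_derivative w nz) (use cut_planeD[OF w] in auto)
  moreover have "(- (E' - w * K') / (2 * w * (1 - w)) * K - K' * ((E - (1 - w) * K) / (2 * w * (1 - w)))) / (K * K)
      = - (E * K' + E' * K - K * K') / (2 * w * (1 - w) * K\<^sup>2)"
    using n by (simp add: divide_simps power2_eq_square) (simp add: algebra_simps)
  moreover have "- (of_real pi / 2) / (2 * w * (1 - w) * K\<^sup>2) = - of_real pi / (4 * w * (1 - w) * K\<^sup>2)"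
    by (simp add: mult.assoc)
  ultimately show ?thesis
    unfolding leg by (simp only: defs)
qed

text \<open>Reduction of order instead of a Frobenius expansion: the derivative of \<open>K(1 - w) / K(w)\<close> is the sum of
  \<open>- 1 / (\<pi> w)\<close> and a function holomorphic at \<open>0\<close>, because \<open>K(0) = \<pi> / 2\<close>. Integrating gives the logarithm
  and a holomorphic remainder \<open>R\<close>.\<close>

lemma ell_K_near_1:
  obtains r R where "0 < r" "r \<le> 1" "R holomorphic_on ball 0 r"
    "\<And>w. w \<in> ball 0 r \<Longrightarrow> ell_K w \<noteq> 0"
    "\<And>w. w \<in> ball 0 r - \<real>\<^sub>\<le>\<^sub>0 \<Longrightarrow> ell_K (1 - w) = ell_K w * (R w - Ln w / of_real pi)"
proof -
  have zero: "0 \<in> slit_plane" using ball_01_slit[of 0] by simp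
  have "isCont ell_K 0"
    using holomorphic_on_imp_continuous_on[OF holomorphic_ell_K] open_slit_plane zero
    by (simp add: continuous_on_eq_continuous_at)
  then obtain d where d: "d > 0" "\<And>w. dist 0 w < d \<Longrightarrow> ell_K w \<noteq> 0"
    using continuous_at_avoid[of 0 ell_K 0] by auto
  define r where "r = min d 1"
  have r: "0 < r" "r \<le> 1" and nz: "\<And>w. w \<in> ball 0 r \<Longrightarrow> ell_K w \<noteq> 0"
    using d by (auto simp: r_def)
  have sub: "w \<in> slit_plane" if "w \<in> ball 0 r" for w
    using ball_01_slit[of w] r that by auto
  have w1: "w \<noteq> 1" if "w \<in> ball 0 r" for w :: complex
    using sub[OF that] by (auto simp: slit_plane_def)
  define g where "g = (\<lambda>w. - of_real pi / (4 * (1 - w) * (ell_K w)\<^sup>2))"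
  \<comment> \<open>the derivative of the ratio of the periods is \<open>g w / w\<close>; its regular part at \<open>0\<close> is \<open>q\<close>\<close>
  define q where "q = (\<lambda>w. if w = 0 then deriv g 0 else (g w - g 0) / (w - 0))"
  have "g holomorphic_on ball 0 r"
    unfolding g_def
    by (intro holomorphic_intros holomorphic_on_subset[OF holomorphic_ell_K]) (use sub nz w1 in auto)
  then have "q holomorphic_on ball 0 r"
    unfolding q_def by (rule pole_lemma) (use r in auto)
  then obtain Q where Q: "\<And>w. w \<in> ball 0 r \<Longrightarrow> (Q has_field_derivative q w) (at w within ball 0 r)"
    using holomorphic_convex_primitive'[OF convex_ball open_ball] by blast
  have g0: "g 0 = - 1 / of_real pi"
    by (simp add: g_def power2_eq_square)
  define f where "f = (\<lambda>w. ell_K (1 - w) / ell_K w + Ln w / of_real pi - Q w)"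
  have "(f has_field_derivative 0) (at w)" if w: "w \<in> ball 0 r - \<real>\<^sub>\<le>\<^sub>0" for w
  proof -
    have wc: "w \<in> cut_plane" using w r by (intro ball_01_cut) auto
    have "(f has_field_derivative (- of_real pi / (4 * w * (1 - w) * (ell_K w)\<^sup>2)
        + inverse w / of_real pi - q w)) (at w)"
      unfolding f_def
      by (intro DERIV_diff DERIV_add DERIV_cdivide has_field_derivative_Ln period_ratio_has_derivative wc nz)
         (use w Q[of w] at_within_open[of w "ball 0 r"] in auto)
    moreover have "- of_real pi / (4 * w * (1 - w) * (ell_K w)\<^sup>2) = g w / w"
      by (simp add: g_def)
    moreover have "q w = (g w + 1 / of_real pi) / w"
      using cut_planeD(4)[OF wc] by (simp add: q_def g0)
    moreover have "g w / w + inverse w / of_real pi - (g w + 1 / of_real pi) / w = 0"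
      using cut_planeD(4)[OF wc] by (simp add: divide_simps)
    ultimately show ?thesis by (simp only:)
  qed
  then obtain c where c: "\<And>w. w \<in> ball 0 r - \<real>\<^sub>\<le>\<^sub>0 \<Longrightarrow> f w = c"
    using has_field_derivative_0_imp_constant_on[OF _ connected_slit_ball[of r], of f]
    unfolding constant_on_def
    by (metis Diff_eq closed_nonpos_Reals_complex open_Compl open_Int open_ball)
  show ?thesis
  proof (rule that[OF r(1,2), of "\<lambda>w. Q w + c"])
    have "Q holomorphic_on ball 0 r"
      using Q by (meson field_differentiable_def holomorphic_onI)
    then show "(\<lambda>w. Q w + c) holomorphic_on ball 0 r"
      by (intro holomorphic_intros)
    show "ell_K (1 - w) = ell_K w * (Q w + c - Ln w / of_real pi)" if w: "w \<in> ball 0 r - \<real>\<^sub>\<le>\<^sub>0" for w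
    proof -
      have "ell_K (1 - w) / ell_K w = Q w + c - Ln w / of_real pi"
        using c[OF w] by (simp add: f_def algebra_simps)
      then show ?thesis using nz[of w] w by (simp add: divide_simps mult_ac)
    qed
  qed (use nz in auto)
qed


section \<open>Monodromy and algebraic independence\<close>

lemma complex_polynomial_holomorphic:
  fixes f :: "complex \<Rightarrow> complex^'n"
  assumes "complex_polynomial H" "\<And>i. (\<lambda>s. f s $ i) holomorphic_on S"
  shows "(\<lambda>s. H (f s)) holomorphic_on S"
  using assms(1) by induction (auto intro!: holomorphic_intros assms(2))

lemma complex_polynomial_compose:
  fixes f :: "complex^'m \<Rightarrow> complex^'n"
  assumes "complex_polynomial H" "\<And>i. complex_polynomial (\<lambda>p. f p $ i)"
  shows "complex_polynomial (\<lambda>p. H (f p))"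
  using assms(1) by induction (auto intro: complex_polynomial.intros assms(2))

lemma complex_polynomial_univariate:
  fixes f :: "complex \<Rightarrow> complex^'n"
  assumes "complex_polynomial H" "\<And>i. \<exists>q. \<forall>t. f t $ i = poly q t"
  shows "\<exists>q. \<forall>t. H (f t) = poly q t"
  using assms(1)
proof induction
  case (const c) show ?case by (rule exI[of _ "[:c:]"]) simp
next
  case (coord i) show ?case by (rule assms(2))
next
  case (add P Q) then show ?case by (metis poly_add)
next
  case (mult P Q) then show ?case by (metis poly_mult)
qed

text \<open>With \<open>a = (u - 2 y\<^sup>2 + z\<^sup>2) / y\<close>, \<open>b = 3 y\<close> and \<open>m = (z / y)\<^sup>2\<close>, the integrals are
  \<open>J\<^sub>1 = a K + b E\<close> and \<open>J\<^sub>2 = (a + b) K' - b E'\<close>. Solving these equations for \<open>(a, b)\<close>, with determinant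
  given by Legendre's relation, yields the pair below, where \<open>j1\<close> and \<open>j2\<close> are \<open>2 / \<pi>\<close> times the values of
  the two integrals.\<close>

definition sol_a :: "complex \<Rightarrow> complex \<Rightarrow> complex \<Rightarrow> complex" where
  "sol_a j1 j2 m = j2 * ell_E m + j1 * (ell_E (1 - m) - ell_K (1 - m))"

definition sol_b :: "complex \<Rightarrow> complex \<Rightarrow> complex \<Rightarrow> complex" where
  "sol_b j1 j2 m = j1 * ell_K (1 - m) - j2 * ell_K m"

text \<open>The two square roots are included because \<open>z / y\<close> is a square root of \<open>m\<close>, and \<open>x\<close> is proportional to
  \<open>b \<surd>(1 - m)\<close> on a level set of the rational integral.\<close>

definition sol_point :: "complex \<Rightarrow> complex \<Rightarrow> complex \<Rightarrow> complex^4" where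
  "sol_point j1 j2 m = vector [csqrt m, csqrt (1 - m), sol_a j1 j2 m, sol_b j1 j2 m]"

lemma coords_4 [simp]:
  fixes a b c d :: complex
  shows "(vector [a, b, c, d] :: complex^4) $ 1 = a" "(vector [a, b, c, d] :: complex^4) $ 2 = b"
    "(vector [a, b, c, d] :: complex^4) $ 3 = c" "(vector [a, b, c, d] :: complex^4) $ 4 = d"
  by (simp_all add: vector_def)

lemma holomorphic_ell_compose [holomorphic_intros]:
  assumes "f holomorphic_on S" "\<And>w. w \<in> S \<Longrightarrow> f w \<in> slit_plane"
  shows "(\<lambda>w. ell_K (f w)) holomorphic_on S" "(\<lambda>w. ell_E (f w)) holomorphic_on S"
  using holomorphic_on_compose_gen[OF assms(1) holomorphic_ell_K]
        holomorphic_on_compose_gen[OF assms(1) holomorphic_ell_E] assms(2)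
  by (auto simp: o_def)

lemma holomorphic_sol_point: "(\<lambda>m. sol_point j1 j2 m $ i) holomorphic_on cut_plane"
  using exhaust_4[of i] unfolding sol_point_def sol_a_def sol_b_def
  by (auto intro!: holomorphic_intros simp: cut_planeD)

lemma sol_point_identity:
  assumes H: "complex_polynomial H" and S: "open S" "S \<noteq> {}" "S \<subseteq> cut_plane"
    and 0: "\<And>m. m \<in> S \<Longrightarrow> H (sol_point j1 j2 m) = 0" and m: "m \<in> cut_plane"
  shows "H (sol_point j1 j2 m) = 0"
  using analytic_continuation_open[OF S(1) open_cut_plane S(2) connected_cut_plane S(3),
      of "\<lambda>m. H (sol_point j1 j2 m)" "\<lambda>m. 0" m]
    complex_polynomial_holomorphic[OF H holomorphic_sol_point] 0 m by auto

text \<open>Continuation around \<open>m = 0\<close>. In the variable \<open>s = log m\<close> the solution extends to a half-plane, and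
  \<open>s \<mapsto> s + 4 \<pi> i n\<close> restores \<open>\<surd>m\<close>, \<open>K\<close> and \<open>E\<close>, but adds a multiple of \<open>n K\<close> to \<open>K'\<close>; this replaces
  \<open>j2\<close> by \<open>j2 + 4 i n j1\<close>. A polynomial in the shift of the logarithm that vanishes at all these values
  vanishes identically, so every complex shear is allowed.\<close>

lemma vanishing_shear:
  assumes H: "complex_polynomial H"
    and 0: "\<And>m. m \<in> cut_plane \<Longrightarrow> H (sol_point j1 j2 m) = 0"
    and m: "m \<in> cut_plane"
  shows "H (sol_point j1 (j2 + t * j1) m) = 0"
proof -
  obtain r R where r: "0 < r" "r \<le> 1" and R: "R holomorphic_on ball 0 r"
    and nz: "\<And>w. w \<in> ball 0 r \<Longrightarrow> ell_K w \<noteq> 0"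
    and K': "\<And>w. w \<in> ball 0 r - \<real>\<^sub>\<le>\<^sub>0 \<Longrightarrow> ell_K (1 - w) = ell_K w * (R w - Ln w / of_real pi)"
    using ell_K_near_1 by metis
  define S where "S = {s::complex. Re s < ln r}"
  define \<kappa> where "\<kappa> = (\<lambda>s l. ell_K (exp s) * (R (exp s) - l / of_real pi))"
  define \<eta> where "\<eta> = (\<lambda>s l. \<kappa> s l * ell_E (exp s) / ell_K (exp s) - of_real (pi/2) / ell_K (exp s))"
  \<comment> \<open>the solution as a function of \<open>s = log m\<close>, with the logarithm also as an independent argument \<open>l\<close>;
    \<open>\<kappa>\<close> and \<open>\<eta>\<close> continue \<open>K'\<close> and \<open>K' - E'\<close>\<close>
  define V :: "complex \<Rightarrow> complex \<Rightarrow> complex^4" where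
    "V = (\<lambda>s l. vector [exp (s/2), csqrt (1 - exp s), j2 * ell_E (exp s) - j1 * \<eta> s l, j1 * \<kappa> s l - j2 * ell_K (exp s)])"
  have expS: "exp s \<in> ball 0 r" "exp s \<in> slit_plane" "1 - exp s \<notin> \<real>\<^sub>\<le>\<^sub>0" if "s \<in> S" for s
  proof -
    have "exp (Re s) < exp (ln r)" using that by (simp add: S_def)
    then show b: "exp s \<in> ball 0 r" using r by simp
    show "exp s \<in> slit_plane" by (rule ball_01_slit[OF subsetD[OF subset_ball[OF r(2)] b]])
    then show "1 - exp s \<notin> \<real>\<^sub>\<le>\<^sub>0" by (simp add: slit_plane_def)
  qed
  have V: "V s (s + l) = sol_point j1 (j2 + l / of_real pi * j1) (exp s)" and cut: "exp s \<in> cut_plane"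
    if s: "s \<in> S" "\<bar>Im s\<bar> < pi" for s l
  proof -
    have Ln: "Ln (exp s) = s" using s by (intro Ln_exp) auto
    have "exp s \<notin> \<real>\<^sub>\<le>\<^sub>0"
    proof
      assume "exp s \<in> \<real>\<^sub>\<le>\<^sub>0"
      moreover have "exp s \<noteq> 0" by simp
      ultimately have "Re (exp s) < 0 \<and> Im (exp s) = 0"
        by (metis complex_eq_iff complex_nonpos_Reals_iff less_le zero_complex.simps)
      then have "Im (Ln (exp s)) = pi" using Im_Ln_eq_pi[of "exp s"] by simp
      then show False using s by (simp add: Ln)
    qed
    then show cut: "exp s \<in> cut_plane"
      using expS[OF s(1)] by (simp add: cut_plane_def slit_plane_def)
    have kappa: "\<kappa> s (s + l) = ell_K (1 - exp s) - l / of_real pi * ell_K (exp s)"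
      using K'[of "exp s"] expS[OF s(1)] \<open>exp s \<notin> \<real>\<^sub>\<le>\<^sub>0\<close>
      by (simp add: \<kappa>_def Ln algebra_simps add_divide_distrib)
    have leg: "ell_E (exp s) * ell_K (1 - exp s) - of_real (pi/2) = (ell_K (1 - exp s) - ell_E (1 - exp s)) * ell_K (exp s)"
      unfolding legendre_relation[OF cut, symmetric] by (simp add: algebra_simps)
    have "\<eta> s (s + l) = (ell_E (exp s) * ell_K (1 - exp s) - of_real (pi/2)) / ell_K (exp s) - l / of_real pi * ell_E (exp s)"
      unfolding \<eta>_def kappa using nz[OF expS(1)[OF s(1)]] by (simp add: diff_divide_distrib algebra_simps)
    then have eta: "\<eta> s (s + l) = ell_K (1 - exp s) - ell_E (1 - exp s) - l / of_real pi * ell_E (exp s)"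
      unfolding leg using nz[OF expS(1)[OF s(1)]] by simp
    have "csqrt (exp s) = exp (s / 2)" using csqrt_exp_Ln[of "exp s"] by (simp add: Ln)
    then show "V s (s + l) = sol_point j1 (j2 + l / of_real pi * j1) (exp s)"
      unfolding V_def sol_point_def sol_a_def sol_b_def kappa eta by (simp add: algebra_simps)
  qed
  have holo: "(\<lambda>s. H (V s s)) holomorphic_on S"
  proof (rule complex_polynomial_holomorphic[OF H])
    have RS: "(\<lambda>s. R (exp s)) holomorphic_on S"
      using holomorphic_on_compose_gen[OF holomorphic_on_exp R image_subsetI[OF expS(1)]] by (simp add: o_def)
    have k: "(\<lambda>s. \<kappa> s s) holomorphic_on S"
      unfolding \<kappa>_def by (intro holomorphic_intros RS) (use expS in auto)
    have e: "(\<lambda>s. \<eta> s s) holomorphic_on S"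
      unfolding \<eta>_def by (intro holomorphic_intros k) (use expS nz[OF expS(1)] in auto)
    have "(\<lambda>s. V s s $ 1) holomorphic_on S" "(\<lambda>s. V s s $ 2) holomorphic_on S"
      "(\<lambda>s. V s s $ 3) holomorphic_on S" "(\<lambda>s. V s s $ 4) holomorphic_on S"
      unfolding V_def coords_4 by (intro holomorphic_intros k e; use expS in auto)+
    then show "(\<lambda>s. V s s $ i) holomorphic_on S" for i
      using exhaust_4[of i] by metis
  qed
  have opS: "open S" "connected S"
    unfolding S_def by (auto simp: open_halfspace_Re_lt convex_halfspace_Re_lt intro!: convex_connected)
  define T where "T = S \<inter> {s. \<bar>Im s\<bar> < pi}"
  have opT: "open T"
    unfolding T_def using opS by (intro open_Int open_Collect_less continuous_intros) auto
  have T0: "of_real (ln r - 1) \<in> T" by (simp add: T_def S_def)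
  have zero: "H (V s s) = 0" if "s \<in> S" for s
  proof (rule analytic_continuation_open[of T S "\<lambda>s. H (V s s)" "\<lambda>s. 0"])
    show "H (V s s) = 0" if "s \<in> T" for s
      using V[of s 0] cut[of s] 0[of "exp s"] that by (simp add: T_def)
  qed (use opT T0 opS holo that in \<open>auto simp: T_def\<close>)
  have all: "H (V s (s + l)) = 0" if s: "s \<in> S" for s l
  proof -
    have per: "H (V s (s + 4 * of_real pi * \<i> * of_nat n)) = 0" for n
    proof -
      let ?s = "s + 4 * of_real pi * \<i> * of_nat n"
      have e1: "exp ?s = exp s"
        using exp_integer_2pi[of "of_nat (2 * n)"] by (simp add: exp_add mult_ac)
      have e2: "exp (?s / 2) = exp (s / 2)"
        using exp_integer_2pi[of "of_nat n"] by (simp add: exp_add mult_ac add_divide_distrib)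
      have "V ?s ?s = V s ?s"
        unfolding V_def \<eta>_def \<kappa>_def e1 e2 by simp
      then show ?thesis using zero[of ?s] s by (simp add: S_def)
    qed
    have "\<exists>q. \<forall>l. H (V s (s + l)) = poly q l"
    proof (rule complex_polynomial_univariate[OF H])
      have k: "\<kappa> s (s + l) = poly [:\<kappa> s s, - ell_K (exp s) / of_real pi:] l" for l
        by (simp add: \<kappa>_def algebra_simps add_divide_distrib)
      have e: "\<eta> s (s + l) = poly [:\<eta> s s, - ell_E (exp s) / of_real pi:] l" for l
        unfolding \<eta>_def k using nz[OF expS(1)[OF s]] by (simp add: algebra_simps add_divide_distrib diff_divide_distrib)
      have "V s (s + l) $ 1 = poly [:exp (s/2):] l" "V s (s + l) $ 2 = poly [:csqrt (1 - exp s):] l"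
        "V s (s + l) $ 3 = poly ([:j2 * ell_E (exp s):] - smult j1 [:\<eta> s s, - ell_E (exp s) / of_real pi:]) l"
        "V s (s + l) $ 4 = poly (smult j1 [:\<kappa> s s, - ell_K (exp s) / of_real pi:] - [:j2 * ell_K (exp s):]) l" for l
        unfolding poly_diff poly_smult e[symmetric] k[symmetric] by (simp_all add: V_def)
      then show "\<exists>q. \<forall>l. V s (s + l) $ i = poly q l" for i
        using exhaust_4[of i] by blast
    qed
    then obtain q where q: "\<And>l. H (V s (s + l)) = poly q l" by blast
    have "range (\<lambda>n. 4 * of_real pi * \<i> * of_nat n) \<subseteq> {l. poly q l = 0}"
      using per by (auto simp: q[symmetric])
    moreover have "infinite (range (\<lambda>n::nat. 4 * complex_of_real pi * \<i> * of_nat n))"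
      by (intro range_inj_infinite injI) simp
    ultimately have "q = 0" using poly_roots_finite[of q] finite_subset by blast
    then show ?thesis using q by simp
  qed
  show ?thesis
  proof (rule sol_point_identity[OF H _ _ _ _ m, of "ball 0 r - \<real>\<^sub>\<le>\<^sub>0"])
    show "open (ball 0 r - \<real>\<^sub>\<le>\<^sub>0 :: complex set)"
      by (metis Diff_eq closed_nonpos_Reals_complex open_Compl open_Int open_ball)
    have "of_real (r/2) \<in> ball (0::complex) r - \<real>\<^sub>\<le>\<^sub>0" using r by (auto simp: complex_nonpos_Reals_iff)
    then show "ball (0::complex) r - \<real>\<^sub>\<le>\<^sub>0 \<noteq> {}" by blast
    show "ball 0 r - \<real>\<^sub>\<le>\<^sub>0 \<subseteq> cut_plane" using r by (auto intro!: ball_01_cut)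
    fix w :: complex assume w: "w \<in> ball 0 r - \<real>\<^sub>\<le>\<^sub>0"
    then have w0: "w \<noteq> 0" by auto
    have "ln (norm w) < ln r" using w w0 r by auto
    then have s: "Ln w \<in> S" "\<bar>Im (Ln w)\<bar> < pi"
      using w0 w Im_Ln_less_pi[of w] mpi_less_Im_Ln[OF w0] Im_Ln_le_pi[OF w0] Im_Ln_eq_pi[OF w0]
      by (auto simp: S_def complex_nonpos_Reals_iff less_le)
    show "H (sol_point j1 (j2 + t * j1) w) = 0"
      using all[OF s(1), of "of_real pi * t"] V[OF s, of "of_real pi * t"] w0 by simp
  qed
qed

text \<open>The symmetry \<open>m \<mapsto> 1 - m\<close> exchanges the two periods and the two singular points, so continuation around
  \<open>m = 1\<close> gives the opposite shears.\<close>

lemma vanishing_shear':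
  assumes H: "complex_polynomial H"
    and 0: "\<And>m. m \<in> cut_plane \<Longrightarrow> H (sol_point j1 j2 m) = 0"
    and m: "m \<in> cut_plane"
  shows "H (sol_point (j1 + t * j2) j2 m) = 0"
proof -
  \<comment> \<open>under \<open>m \<mapsto> 1 - m\<close> the pair \<open>(a, b)\<close> of a solution becomes \<open>(- (a + b), b)\<close>\<close>
  define \<sigma> :: "complex^4 \<Rightarrow> complex^4" where "\<sigma> = (\<lambda>p. vector [p$2, p$1, - 1 * (p$3 + p$4), p$4])"
  have \<sigma>: "\<sigma> (sol_point (- i2) (- i1) m) = sol_point i1 i2 (1 - m)" for i1 i2 m
    by (simp add: \<sigma>_def sol_point_def sol_a_def sol_b_def algebra_simps)
  have H': "complex_polynomial (\<lambda>p. H (\<sigma> p))"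
  proof (rule complex_polynomial_compose[OF H])
    have "complex_polynomial (\<lambda>p. \<sigma> p $ 1)" "complex_polynomial (\<lambda>p. \<sigma> p $ 2)"
      "complex_polynomial (\<lambda>p. \<sigma> p $ 3)" "complex_polynomial (\<lambda>p. \<sigma> p $ 4)"
      unfolding \<sigma>_def coords_4 by (intro complex_polynomial.intros)+
    then show "complex_polynomial (\<lambda>p. \<sigma> p $ i)" for i using exhaust_4[of i] by metis
  qed
  have "H (\<sigma> (sol_point (- j2) (- j1 + t * - j2) (1 - m))) = 0"
    by (rule vanishing_shear[OF H']) (use 0 \<sigma> m cut_planeD in auto)
  then show ?thesis using \<sigma>[of j2 "j1 + t * j2" "1 - m"] by (simp add: algebra_simps)
qed

text \<open>The two families of shears generate \<open>SL\<^sub>2\<close>, which acts transitively on nonzero vectors.\<close>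

lemma shears_transitive:
  fixes P :: "complex \<Rightarrow> complex \<Rightarrow> bool"
  assumes P: "P j1 j2" and j: "j1 \<noteq> 0 \<or> j2 \<noteq> 0" and i: "i1 \<noteq> 0 \<or> i2 \<noteq> 0"
    and sh: "\<And>j1 j2 t. P j1 j2 \<Longrightarrow> P j1 (j2 + t * j1)" "\<And>j1 j2 t. P j1 j2 \<Longrightarrow> P (j1 + t * j2) j2"
  shows "P i1 i2"
proof -
  have to2: "P j1 y" if "P j1 j2" "j1 \<noteq> 0" for j1 j2 y
    using sh(1)[OF that(1), of "(y - j2) / j1"] that by simp
  have to1: "P x j2" if "P j1 j2" "j2 \<noteq> 0" for j1 j2 x
    using sh(2)[OF that(1), of "(x - j1) / j2"] that by simp
  obtain k1 k2 where k: "P k1 k2" "k1 \<noteq> 0"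
  proof (cases "j1 = 0")
    case True then show ?thesis using to1[OF P, of 1] j that[of 1 j2] by auto
  qed (use P that in auto)
  show ?thesis
  proof (cases "i2 = 0")
    case True
    have "P i1 1" using to1[OF to2[OF k, of 1]] by simp
    then show ?thesis using to2[of i1 1 i2] i True by simp
  next
    case False
    then show ?thesis using to1[OF to2[OF k, of i2]] by simp
  qed
qed

text \<open>Legendre's relation is the determinant of the linear system, so every pair of values at \<open>m\<close> is taken by
  some solution.\<close>

lemma sol_surjective:
  assumes m: "m \<in> cut_plane"
  defines "i1 \<equiv> \<lambda>a b. 2 / of_real pi * (a * ell_K m + b * ell_E m)"
    and "i2 \<equiv> \<lambda>a b. 2 / of_real pi * ((a + b) * ell_K (1 - m) - b * ell_E (1 - m))"
  shows "sol_a (i1 a b) (i2 a b) m = a" "sol_b (i1 a b) (i2 a b) m = b"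
proof -
  define c where "c = 2 / complex_of_real pi"
  have leg: "ell_E m * ell_K (1 - m) + ell_E (1 - m) * ell_K m - ell_K m * ell_K (1 - m) = of_real pi / 2"
    using legendre_relation[OF m] by simp
  have "sol_a (i1 a b) (i2 a b) m = c * a * (ell_E m * ell_K (1 - m) + ell_E (1 - m) * ell_K m - ell_K m * ell_K (1 - m))"
    unfolding i1_def i2_def c_def[symmetric] by (simp add: sol_a_def algebra_simps)
  then show "sol_a (i1 a b) (i2 a b) m = a" unfolding leg by (simp add: c_def)
  have "sol_b (i1 a b) (i2 a b) m = c * b * (ell_E m * ell_K (1 - m) + ell_E (1 - m) * ell_K m - ell_K m * ell_K (1 - m))"
    unfolding i1_def i2_def c_def[symmetric] by (simp add: sol_b_def algebra_simps)
  then show "sol_b (i1 a b) (i2 a b) m = b" unfolding leg by (simp add: c_def)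
qed

text \<open>A single nonzero solution satisfies no algebraic relation with \<open>\<surd>m\<close> and \<open>\<surd>(1 - m)\<close> beyond the one between
  the roots themselves: a relation propagates to all solutions by continuation, and these fill the whole plane over
  each \<open>m\<close>.\<close>

theorem solution_algebraically_independent:
  assumes H: "complex_polynomial H" and j: "j1 \<noteq> 0 \<or> j2 \<noteq> 0"
    and S: "open S" "S \<noteq> {}" "S \<subseteq> cut_plane"
    and 0: "\<And>m. m \<in> S \<Longrightarrow> H (sol_point j1 j2 m) = 0"
    and m: "m \<in> cut_plane" and ab: "a \<noteq> 0 \<or> b \<noteq> 0"
  shows "H (vector [csqrt m, csqrt (1 - m), a, b]) = 0"
proof -
  let ?P = "\<lambda>j1 j2. \<forall>m\<in>cut_plane. H (sol_point j1 j2 m) = 0"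
  have start: "?P j1 j2" using sol_point_identity[OF H S 0] by blast
  have any: "?P i1 i2" if "i1 \<noteq> 0 \<or> i2 \<noteq> 0" for i1 i2
    by (rule shears_transitive[of ?P, OF start j that])
       (use vanishing_shear[OF H] vanishing_shear'[OF H] in blast)+
  define i1 where "i1 = 2 / of_real pi * (a * ell_K m + b * ell_E m)"
  define i2 where "i2 = 2 / of_real pi * ((a + b) * ell_K (1 - m) - b * ell_E (1 - m))"
  have a: "sol_a i1 i2 m = a" and b: "sol_b i1 i2 m = b"
    unfolding i1_def i2_def by (rule sol_surjective[OF m])+
  have "i1 \<noteq> 0 \<or> i2 \<noteq> 0" using a b ab by (auto simp: sol_a_def sol_b_def)
  from any[OF this] m have "H (sol_point i1 i2 m) = 0" by blast
  then show ?thesis by (simp add: sol_point_def a b)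
qed


section \<open>Trajectories of the system\<close>

text \<open>The linear system for \<open>(a, b)\<close> is adjoint to the one for the periods.\<close>

lemma sol_a_has_derivative:
  assumes m: "m \<in> cut_plane"
  shows "(sol_a j1 j2 has_field_derivative (sol_a j1 j2 m + sol_b j1 j2 m) / (2 * m)) (at m)"
proof -
  define K E K' E' where defs: "K = ell_K m" "E = ell_E m" "K' = ell_K (1 - m)" "E' = ell_E (1 - m)"
  have n: "m \<noteq> 0" "1 - m \<noteq> 0" using cut_planeD[OF m] by auto
  have "(sol_a j1 j2 has_field_derivative
      j2 * ((E - K) / (2 * m)) + j1 * (- (E' - K') / (2 * (1 - m)) - - (E' - m * K') / (2 * m * (1 - m)))) (at m)"
    unfolding sol_a_def[abs_def] defs
    by (intro DERIV_add DERIV_diff DERIV_cmult ell_E_has_derivative ell_K'_has_derivative ell_E'_has_derivative m)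
       (use cut_planeD[OF m] in auto)
  moreover have "j2 * ((E - K) / (2 * m)) + j1 * (- (E' - K') / (2 * (1 - m)) - - (E' - m * K') / (2 * m * (1 - m)))
     = (sol_a j1 j2 m + sol_b j1 j2 m) / (2 * m)"
    unfolding sol_a_def sol_b_def defs[symmetric] using n
    by (simp add: divide_simps) (simp add: algebra_simps)
  ultimately show ?thesis by simp
qed

lemma sol_b_has_derivative:
  assumes m: "m \<in> cut_plane"
  shows "(sol_b j1 j2 has_field_derivative
           - (sol_a j1 j2 m + (1 - m) * sol_b j1 j2 m) / (2 * m * (1 - m))) (at m)"
proof -
  define K E K' E' where defs: "K = ell_K m" "E = ell_E m" "K' = ell_K (1 - m)" "E' = ell_E (1 - m)"
  have n: "m \<noteq> 0" "1 - m \<noteq> 0" using cut_planeD[OF m] by auto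
  have "(sol_b j1 j2 has_field_derivative
      j1 * (- (E' - m * K') / (2 * m * (1 - m))) - j2 * ((E - (1 - m) * K) / (2 * m * (1 - m)))) (at m)"
    unfolding sol_b_def[abs_def] defs
    by (intro DERIV_diff DERIV_cmult ell_K_has_derivative ell_K'_has_derivative m)
       (use cut_planeD[OF m] in auto)
  moreover have "j1 * (- (E' - m * K') / (2 * m * (1 - m))) - j2 * ((E - (1 - m) * K) / (2 * m * (1 - m)))
     = - (sol_a j1 j2 m + (1 - m) * sol_b j1 j2 m) / (2 * m * (1 - m))"
    unfolding sol_a_def sol_b_def defs[symmetric] using n
    by (simp add: divide_simps) (simp add: algebra_simps)
  ultimately show ?thesis by simp
qed

text \<open>The phase point with data \<open>q = (\<surd>m, \<surd>(1 - m), a, b)\<close>. The sign \<open>\<epsilon>\<close> selects the square root of \<open>m\<close> that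
  equals \<open>z / y\<close>, and \<open>\<xi>\<close> parametrizes the levels of the rational integral, whose value here is
  \<open>1 / (9 \<xi>\<^sup>2)\<close>.\<close>

definition lift :: "complex \<Rightarrow> complex \<Rightarrow> complex^4 \<Rightarrow> complex^4" where
  "lift \<xi> \<epsilon> q = vector [\<xi> * q$4 * q$2, 1/3 * q$4, 1/3 * \<epsilon> * q$1 * q$4,
     1/3 * q$3 * q$4 + 2/9 * q$4 * q$4 + (-1/9) * (q$1 * q$1 * q$4 * q$4)]"

lemma complex_polynomial_lift: "complex_polynomial (\<lambda>q. lift \<xi> \<epsilon> q $ i)"
proof -
  have "complex_polynomial (\<lambda>q. lift \<xi> \<epsilon> q $ 1)" "complex_polynomial (\<lambda>q. lift \<xi> \<epsilon> q $ 2)"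
    "complex_polynomial (\<lambda>q. lift \<xi> \<epsilon> q $ 3)" "complex_polynomial (\<lambda>q. lift \<xi> \<epsilon> q $ 4)"
    unfolding lift_def coords_4 by (intro complex_polynomial.intros)+
  then show ?thesis using exhaust_4[of i] by metis
qed

definition trajectory :: "complex \<Rightarrow> complex \<Rightarrow> complex \<Rightarrow> complex \<Rightarrow> complex \<Rightarrow> complex^4" where
  "trajectory \<xi> \<epsilon> j1 j2 m = lift \<xi> \<epsilon> (sol_point j1 j2 m)"

text \<open>The derivative of \<open>m = (z / y)\<^sup>2\<close> with respect to time, namely \<open>- 6 y\<^sup>2 m (1 - m)\<close>.\<close>

definition speed :: "complex \<Rightarrow> complex \<Rightarrow> complex \<Rightarrow> complex" where
  "speed j1 j2 m = - (2/3) * (sol_b j1 j2 m)\<^sup>2 * m * (1 - m)"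

lemma trajectory_has_derivative:
  assumes m: "m \<in> cut_plane" and e: "\<epsilon>\<^sup>2 = 1" and b: "sol_b j1 j2 m \<noteq> 0"
  shows "((\<lambda>m. trajectory \<xi> \<epsilon> j1 j2 m $ i) has_field_derivative
           vfield (trajectory \<xi> \<epsilon> j1 j2 m) $ i / speed j1 j2 m) (at m)"
proof -
  let ?P = "trajectory \<xi> \<epsilon> j1 j2"
  define A B s t where defs: "A = sol_a j1 j2 m" "B = sol_b j1 j2 m" "s = csqrt m" "t = csqrt (1 - m)"
  note cut = cut_planeD[OF m]
  have s2: "s\<^sup>2 = m" and t2: "t\<^sup>2 = 1 - m" by (simp_all add: defs)
  have n: "s \<noteq> 0" "t \<noteq> 0" "m \<noteq> 0" "1 - m \<noteq> 0" "B \<noteq> 0" using cut b by (auto simp: defs)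
  define A1 B1 where AB: "A1 = (A + B) / (2 * m)" "B1 = - (A + (1 - m) * B) / (2 * m * (1 - m))"
  have dA: "(sol_a j1 j2 has_field_derivative A1) (at m)"
    unfolding AB defs by (rule sol_a_has_derivative[OF m])
  have dB: "(sol_b j1 j2 has_field_derivative B1) (at m)"
    unfolding AB defs by (rule sol_b_has_derivative[OF m])
  have ds: "(csqrt has_field_derivative 1 / (2 * s)) (at m)"
    using has_field_derivative_csqrt[OF cut(6)] by (simp add: defs field_simps)
  have dt: "((\<lambda>m. csqrt (1 - m)) has_field_derivative - 1 / (2 * t)) (at m)"
    using cut(7) by (auto intro!: derivative_eq_intros simp: defs)
  have sp: "speed j1 j2 m = - (2/3) * B\<^sup>2 * m * (1 - m)" by (simp add: speed_def defs)
  define y z u where yzu: "y = B / 3" "z = \<epsilon> * s * B / 3" "u = A * B / 3 + 2 * B\<^sup>2 / 9 - m * B\<^sup>2 / 9"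
  have z2: "z\<^sup>2 = m * B\<^sup>2 / 9" and y2: "y\<^sup>2 = B\<^sup>2 / 9"
    unfolding yzu using e s2 by (simp_all add: power_mult_distrib power_divide)
  have traj: "?P m = vector [\<xi> * B * t, y, z, u]"
    using s2 by (simp add: trajectory_def lift_def sol_point_def defs yzu power2_eq_square mult_ac)
  have u1: "u + y\<^sup>2 + z\<^sup>2 = B * (A + B) / 3" and u2: "u + y\<^sup>2 - 2 * z\<^sup>2 = B * (A + (1 - m) * B) / 3"
    and u3: "u - 2 * y\<^sup>2 + z\<^sup>2 = A * B / 3"
    unfolding z2 y2 by (simp_all add: yzu field_simps power2_eq_square)
  have u4: "u\<^sup>2 - y^4 + y\<^sup>2 * z\<^sup>2 - z^4 = (A * B / 3 + 2 * B\<^sup>2 / 9 - m * B\<^sup>2 / 9)\<^sup>2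
      - (1 - m + m\<^sup>2) * (B\<^sup>2)\<^sup>2 / 81"
  proof -
    have yz4: "y^4 = (B\<^sup>2 / 9)\<^sup>2" "z^4 = (m * B\<^sup>2 / 9)\<^sup>2" unfolding y2[symmetric] z2[symmetric] by simp_all
    show ?thesis unfolding yz4 z2 y2 yzu(3) by (simp add: field_simps power2_eq_square)
  qed
  have vf: "vfield (?P m) $ 1 = B * (A + B) / 3 * (\<xi> * B * t)"
    "vfield (?P m) $ 2 = B * (A + (1 - m) * B) / 3 * y"
    "vfield (?P m) $ 3 = A * B / 3 * z"
    "vfield (?P m) $ 4
      = (A * B / 3 + 2 * B\<^sup>2 / 9 - m * B\<^sup>2 / 9)\<^sup>2 - (1 - m + m\<^sup>2) * (B\<^sup>2)\<^sup>2 / 81"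
    unfolding traj vfield_def Let_def coords_4 u1 u2 u3 u4 by (rule refl)+
  have "((\<lambda>m. ?P m $ 1) has_field_derivative vfield (?P m) $ 1 / speed j1 j2 m) (at m)"
  proof -
    have "((\<lambda>m. ?P m $ 1) has_field_derivative
        (\<xi> * B1) * t + (- 1 / (2 * t)) * (\<xi> * B)) (at m)"
      unfolding trajectory_def lift_def sol_point_def coords_4
      using DERIV_mult[OF DERIV_cmult[OF dB, of \<xi>] dt] by (simp add: defs)
    moreover have "(\<xi> * B1) * t + (- 1 / (2 * t)) * (\<xi> * B) = \<xi> * (B1 * t\<^sup>2 - B / 2) / t"
      using n by (simp add: field_simps power2_eq_square)
    moreover have "\<dots> = (B * (A + B) / 3 * (\<xi> * B * t)) / speed j1 j2 m"
    proof -
      have "B1 * t\<^sup>2 - B / 2 = - (A + B) / (2 * m)"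
        unfolding t2 AB using n by (simp add: divide_simps) (simp add: algebra_simps)
      moreover have "\<xi> * (- (A + B) / (2 * m)) / t = (B * (A + B) / 3 * (\<xi> * B * t)) / (- (2/3) * B\<^sup>2 * m * t\<^sup>2)"
        using n by (simp add: divide_simps power2_eq_square) (simp add: algebra_simps)
      ultimately show ?thesis unfolding sp t2[symmetric] by simp
    qed
    ultimately show ?thesis unfolding vf by (simp only:)
  qed
  moreover have "((\<lambda>m. ?P m $ 2) has_field_derivative vfield (?P m) $ 2 / speed j1 j2 m) (at m)"
  proof -
    have "((\<lambda>m. ?P m $ 2) has_field_derivative 1/3 * B1) (at m)"
      unfolding trajectory_def lift_def sol_point_def coords_4 by (rule DERIV_cmult[OF dB])
    moreover have "1/3 * B1 = (B * (A + (1 - m) * B) / 3 * y) / speed j1 j2 m"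
      unfolding sp AB yzu using n by (simp add: divide_simps power2_eq_square)
    ultimately show ?thesis unfolding vf by (simp only:)
  qed
  moreover have "((\<lambda>m. ?P m $ 3) has_field_derivative vfield (?P m) $ 3 / speed j1 j2 m) (at m)"
  proof -
    have "((\<lambda>m. ?P m $ 3) has_field_derivative
        (1/3 * \<epsilon> * (1 / (2 * s))) * B + B1 * (1/3 * \<epsilon> * s)) (at m)"
      unfolding trajectory_def lift_def sol_point_def coords_4 defs(2,3)
      by (intro DERIV_mult DERIV_cmult dB[unfolded defs] ds[unfolded defs])
    moreover have "(1/3 * \<epsilon> * (1 / (2 * s))) * B + B1 * (1/3 * \<epsilon> * s) = (1/3 * \<epsilon>) * (B / 2 + B1 * s\<^sup>2) / s"
      using n by (simp add: field_simps power2_eq_square)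
    moreover have "\<dots> = (A * B / 3 * z) / speed j1 j2 m"
    proof -
      have "B / 2 + B1 * s\<^sup>2 = - A / (2 * (1 - m))"
        unfolding s2 AB using n by (simp add: divide_simps) (simp add: algebra_simps)
      moreover have "(1/3 * \<epsilon>) * (- A / (2 * (1 - m))) / s = (A * B / 3 * (\<epsilon> * s * B / 3)) / (- (2/3) * B\<^sup>2 * s\<^sup>2 * (1 - m))"
        using n by (simp add: divide_simps power2_eq_square)
      ultimately show ?thesis unfolding sp yzu s2 by simp
    qed
    ultimately show ?thesis unfolding vf by (simp only:)
  qed
  moreover have "((\<lambda>m. ?P m $ 4) has_field_derivative vfield (?P m) $ 4 / speed j1 j2 m) (at m)"
  proof -
    let ?D = "1/3 * A1 * B + B1 * (1/3 * A) + (2/9 * B1 * B + B1 * (2/9 * B))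
        - (1/9) * (1 * (B * B) + (B1 * B + B1 * B) * m)"
    have eq: "(\<lambda>m. ?P m $ 4) = (\<lambda>m. 1/3 * sol_a j1 j2 m * sol_b j1 j2 m
        + 2/9 * sol_b j1 j2 m * sol_b j1 j2 m - (1/9) * (m * (sol_b j1 j2 m * sol_b j1 j2 m)))"
    proof
      fix m
      have "csqrt m * csqrt m = m" by (simp flip: power2_eq_square)
      then show "?P m $ 4 = 1/3 * sol_a j1 j2 m * sol_b j1 j2 m
        + 2/9 * sol_b j1 j2 m * sol_b j1 j2 m - (1/9) * (m * (sol_b j1 j2 m * sol_b j1 j2 m))"
        unfolding trajectory_def lift_def sol_point_def coords_4 by (simp add: mult.assoc)
    qed
    have "((\<lambda>m. ?P m $ 4) has_field_derivative ?D) (at m)"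
      unfolding eq unfolding defs
      by (intro DERIV_diff DERIV_add DERIV_mult DERIV_cmult dA dB DERIV_ident)
    moreover have "?D = ((A * B / 3 + 2 * B\<^sup>2 / 9 - m * B\<^sup>2 / 9)\<^sup>2 - (1 - m + m\<^sup>2) * (B\<^sup>2)\<^sup>2 / 81) / speed j1 j2 m"
      unfolding sp AB using n by (simp add: divide_simps) (simp add: algebra_simps power2_eq_square power4_eq_xxxx)
    ultimately show ?thesis unfolding vf by (simp only:)
  qed
  ultimately show ?thesis using exhaust_4[of i] by metis
qed

lemma has_derivative_vec_componentwise:
  fixes f :: "'a::real_normed_vector \<Rightarrow> complex^'n"
  assumes "\<And>i. ((\<lambda>x. f x $ i) has_derivative (\<lambda>h. f' h $ i)) (at x within A)"
  shows "(f has_derivative f') (at x within A)"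
  unfolding has_derivative_componentwise_within[of f f']
proof
  fix b :: "complex^'n" assume "b \<in> Basis"
  then obtain i c where b: "b = axis i c" by (auto simp: Basis_vec_def)
  show "((\<lambda>x. f x \<bullet> b) has_derivative (\<lambda>h. f' h \<bullet> b)) (at x within A)"
    unfolding b inner_axis by (intro derivative_intros assms)
qed

lemma continuous_on_vec_componentwise:
  fixes f :: "'a::topological_space \<Rightarrow> complex^'n"
  assumes "\<And>i. continuous_on A (\<lambda>x. f x $ i)"
  shows "continuous_on A f"
  using continuous_on_vec_lambda[of A "\<lambda>i x. f x $ i"] assms by simp

lemma continuous_on_vector_4:
  fixes f1 f2 f3 f4 :: "'a::topological_space \<Rightarrow> complex"
  assumes "continuous_on A f1" "continuous_on A f2" "continuous_on A f3" "continuous_on A f4"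
  shows "continuous_on A (\<lambda>x. vector [f1 x, f2 x, f3 x, f4 x] :: complex^4)"
proof (rule continuous_on_vec_componentwise)
  show "continuous_on A (\<lambda>x. (vector [f1 x, f2 x, f3 x, f4 x] :: complex^4) $ i)" for i
    using exhaust_4[of i] assms by auto
qed

text \<open>A scalar autonomous equation \<open>d\<mu>/d\<tau> = v(\<mu>)\<close> is solved near a point where \<open>v\<close> does not vanish by locally
  inverting a primitive of \<open>1 / v\<close>. Here it supplies the time parametrization of a known trajectory.\<close>

lemma local_inverse_flow:
  assumes G: "open G" "m0 \<in> G" and v: "v holomorphic_on G" "v m0 \<noteq> 0"
  obtains N T \<mu> where "open N" "m0 \<in> N" "N \<subseteq> G" "open T" "connected T"
    "\<mu> ` T = N" "\<And>\<tau>. \<tau> \<in> T \<Longrightarrow> (\<mu> has_field_derivative v (\<mu> \<tau>)) (at \<tau>)"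
    "\<And>m. m \<in> N \<Longrightarrow> v m \<noteq> 0"
proof -
  obtain e1 where e1: "e1 > 0" "ball m0 e1 \<subseteq> G" using G open_contains_ball by blast
  have "isCont v m0"
    using holomorphic_on_imp_continuous_on[OF v(1)] G by (simp add: continuous_on_eq_continuous_at)
  then obtain e2 where e2: "e2 > 0" "\<And>m. dist m0 m < e2 \<Longrightarrow> v m \<noteq> 0"
    using continuous_at_avoid[of m0 v 0] v(2) by auto
  define B where "B = ball m0 (min e1 e2)"
  have B: "m0 \<in> B" "open B" "convex B" "B \<subseteq> G" "\<And>m. m \<in> B \<Longrightarrow> v m \<noteq> 0"
    using e1 e2 by (auto simp: B_def)
  have "(\<lambda>m. 1 / v m) holomorphic_on B"
    by (intro holomorphic_intros holomorphic_on_subset[OF v(1)]) (use B in auto)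
  then obtain g where g: "\<And>m. m \<in> B \<Longrightarrow> (g has_field_derivative 1 / v m) (at m within B)"
    using holomorphic_convex_primitive'[OF B(3,2)] by blast
  have g': "(g has_field_derivative 1 / v m) (at m)" if "m \<in> B" for m
    using g[OF that] at_within_open[OF that B(2)] by simp
  have holg: "g holomorphic_on B"
    using g by (meson field_differentiable_def holomorphic_onI)
  have "deriv g m0 \<noteq> 0" using DERIV_imp_deriv[OF g'[OF B(1)]] v(2) by simp
  then obtain r where r: "r > 0" "ball m0 r \<subseteq> B" "inj_on g (ball m0 r)"
    using has_complex_derivative_locally_injective[OF holg B(1,2)] by blast
  have holr: "g holomorphic_on ball m0 r" using holg r(2) holomorphic_on_subset by blast
  obtain \<mu> where \<mu>: "\<mu> holomorphic_on g ` ball m0 r"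
      "\<And>z. z \<in> ball m0 r \<Longrightarrow> deriv g z * deriv \<mu> (g z) = 1" "\<And>z. z \<in> ball m0 r \<Longrightarrow> \<mu> (g z) = z"
    using holomorphic_has_inverse[OF holr open_ball r(3)] by blast
  have opT: "open (g ` ball m0 r)" by (rule open_mapping_thm3[OF holr open_ball r(3)])
  show ?thesis
  proof (rule that[of "ball m0 r" "g ` ball m0 r" \<mu>])
    show "connected (g ` ball m0 r)"
      by (intro connected_continuous_image holomorphic_on_imp_continuous_on holr) simp
    show "\<mu> ` g ` ball m0 r = ball m0 r" using \<mu>(3) by (force simp: image_image)
    show "(\<mu> has_field_derivative v (\<mu> \<tau>)) (at \<tau>)" if \<tau>: "\<tau> \<in> g ` ball m0 r" for \<tau>
    proof -
      from \<tau> obtain z where z: "\<tau> = g z" "z \<in> ball m0 r" by (rule imageE)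
      have zB: "z \<in> B" using z(2) r(2) by (rule subsetD[rotated])
      have "1 / v z * deriv \<mu> \<tau> = 1"
        using \<mu>(2)[OF z(2)] unfolding DERIV_imp_deriv[OF g'[OF zB]] z(1) .
      then have "deriv \<mu> \<tau> = v z" using B(5)[OF zB] by (simp add: field_simps)
      then show ?thesis
        using holomorphic_derivI[OF \<mu>(1) opT \<tau>] \<mu>(3)[OF z(2)] z(1) by simp
    qed
  qed (use r B opT in auto)
qed

lemma holomorphic_trajectory: "(\<lambda>m. trajectory \<xi> \<epsilon> j1 j2 m $ i) holomorphic_on cut_plane"
  unfolding trajectory_def
  by (rule complex_polynomial_holomorphic[OF complex_polynomial_lift holomorphic_sol_point])

lemma continuous_trajectory: "continuous_on cut_plane (trajectory \<xi> \<epsilon> j1 j2)"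
  by (intro continuous_on_vec_componentwise holomorphic_on_imp_continuous_on holomorphic_trajectory)

lemma sol_b_holomorphic: "sol_b j1 j2 holomorphic_on cut_plane"
  using holomorphic_sol_point[of j1 j2 4] by (simp add: sol_point_def)

text \<open>Reparametrizing by time turns the curve with parameter \<open>m\<close> into a solution of the system.\<close>

lemma first_integral_along_trajectory:
  assumes S: "open S" and F: "first_integral_on S F" and e: "\<epsilon>\<^sup>2 = 1"
    and m0: "m0 \<in> cut_plane" "sol_b j1 j2 m0 \<noteq> 0" "trajectory \<xi> \<epsilon> j1 j2 m0 \<in> S"
  obtains N where "open N" "m0 \<in> N" "N \<subseteq> cut_plane"
    "\<And>m. m \<in> N \<Longrightarrow> trajectory \<xi> \<epsilon> j1 j2 m \<in> S"
    "\<And>m. m \<in> N \<Longrightarrow> F (trajectory \<xi> \<epsilon> j1 j2 m) = F (trajectory \<xi> \<epsilon> j1 j2 m0)"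
proof -
  let ?P = "trajectory \<xi> \<epsilon> j1 j2"
  define G where "G = cut_plane \<inter> ?P -` S"
  have G: "open G" "m0 \<in> G" "G \<subseteq> cut_plane"
    using continuous_open_preimage[OF continuous_trajectory open_cut_plane S] m0 by (auto simp: G_def)
  have "speed j1 j2 holomorphic_on G"
    unfolding speed_def[abs_def]
    by (intro holomorphic_intros holomorphic_on_subset[OF sol_b_holomorphic G(3)])
  moreover have "speed j1 j2 m0 \<noteq> 0"
    using m0 cut_planeD[OF m0(1)] by (simp add: speed_def)
  ultimately obtain N T \<mu> where N: "open N" "m0 \<in> N" "N \<subseteq> G" "open T" "connected T"
    "\<mu> ` T = N" "\<And>\<tau>. \<tau> \<in> T \<Longrightarrow> (\<mu> has_field_derivative speed j1 j2 (\<mu> \<tau>)) (at \<tau>)"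
    "\<And>m. m \<in> N \<Longrightarrow> speed j1 j2 m \<noteq> 0"
    using local_inverse_flow[OF G(1,2)] by metis
  have "solution_on T (\<lambda>\<tau>. ?P (\<mu> \<tau>))"
    unfolding solution_on_def
  proof (intro ballI allI)
    fix \<tau> i assume \<tau>: "\<tau> \<in> T"
    then have m: "\<mu> \<tau> \<in> N" using N by auto
    then have c: "\<mu> \<tau> \<in> cut_plane" and b: "sol_b j1 j2 (\<mu> \<tau>) \<noteq> 0"
      using N(3,8) G by (auto simp: speed_def)
    have "((\<lambda>s. ?P (\<mu> s) $ i) has_field_derivative
        vfield (?P (\<mu> \<tau>)) $ i / speed j1 j2 (\<mu> \<tau>) * speed j1 j2 (\<mu> \<tau>)) (at \<tau>)"
      by (rule DERIV_chain2[OF trajectory_has_derivative[OF c e b] N(7)[OF \<tau>]])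
    then show "((\<lambda>s. ?P (\<mu> s) $ i) has_field_derivative vfield (?P (\<mu> \<tau>)) $ i) (at \<tau>)"
      using N(8)[OF m] by simp
  qed
  moreover have "(\<lambda>\<tau>. ?P (\<mu> \<tau>)) ` T \<subseteq> S" using N by (auto simp: G_def)
  ultimately have "(\<lambda>\<tau>. F (?P (\<mu> \<tau>))) constant_on T"
    using F[unfolded first_integral_on_def, rule_format, of T "\<lambda>\<tau>. ?P (\<mu> \<tau>)"] N(4,5) by blast
  then obtain c where c: "\<And>\<tau>. \<tau> \<in> T \<Longrightarrow> F (?P (\<mu> \<tau>)) = c" unfolding constant_on_def by blast
  have "F (?P m) = c" if "m \<in> N" for m using that c N(6) by auto
  then have eq: "F (?P m) = F (?P m0)" if "m \<in> N" for m using that N(2) by simp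
  have mem: "?P m \<in> S" if "m \<in> N" for m
    using subsetD[OF N(3) that] by (simp add: G_def)
  show ?thesis
    by (rule that[OF N(1,2) subset_trans[OF N(3) G(3)] mem eq])
qed


section \<open>Algebraic integrals depend on the rational one only\<close>

lemma complex_polynomial_sum:
  assumes "\<And>i. i \<le> (n::nat) \<Longrightarrow> complex_polynomial (f i)"
  shows "complex_polynomial (\<lambda>p. \<Sum>i\<le>n. f i p)"
  using assms
proof (induction n)
  case (Suc n)
  then show ?case using complex_polynomial.add[of "\<lambda>p. \<Sum>i\<le>n. f i p" "f (Suc n)"] by simp
qed simp

text \<open>Restrict to the line that joins \<open>p\<close> to a point of the open set.\<close>

lemma complex_polynomial_eq_0:
  fixes P :: "complex^'n \<Rightarrow> complex"
  assumes P: "complex_polynomial P" and G: "open G" "q \<in> G" and 0: "\<And>p. p \<in> G \<Longrightarrow> P p = 0"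
  shows "P p = 0"
proof -
  define f where "f = (\<lambda>t. \<chi> i. q $ i + t * (p $ i - q $ i))"
  have "\<exists>r. \<forall>t. P (f t) = poly r t"
  proof (rule complex_polynomial_univariate[OF P])
    show "\<exists>r. \<forall>t. f t $ i = poly r t" for i
      by (rule exI[of _ "[:q $ i, p $ i - q $ i:]"]) (simp add: f_def)
  qed
  then obtain r where r: "\<And>t. P (f t) = poly r t" by blast
  have f0: "f 0 = q" and f1: "f 1 = p" by (simp_all add: f_def vec_eq_iff)
  have "continuous_on UNIV f"
    unfolding f_def by (intro continuous_intros)
  then have op: "open (f -` G)" using G(1) continuous_on_open_vimage[of UNIV f] by auto
  have "infinite (f -` G)"
    using op f0 G(2) finite_imp_not_open[of "f -` G"] by auto
  moreover have "poly r t = 0" if "t \<in> f -` G" for t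
    using 0[of "f t"] r[of t] that by simp
  then have "f -` G \<subseteq> {t. poly r t = 0}" by blast
  ultimately have "r = 0" using poly_roots_finite[of r] finite_subset by blast
  then show ?thesis using r[of 1] f1 by simp
qed

text \<open>The factor between \<open>x\<close> and \<open>\<xi>\<close>, that is \<open>b \<surd>(1 - m)\<close> in the original coordinates; its square is
  \<open>9 (y\<^sup>2 - z\<^sup>2)\<close>.\<close>

definition height :: "complex \<Rightarrow> complex \<Rightarrow> complex" where
  "height y z = 3 * y * csqrt (1 - (z / y)\<^sup>2)"

lemma cut_plane_coordinates:
  assumes y: "y \<noteq> 0" and m: "(z / y)\<^sup>2 \<in> cut_plane" and e: "z / y = \<epsilon> * csqrt ((z / y)\<^sup>2)"
  shows "lift \<xi> \<epsilon> (vector [csqrt ((z / y)\<^sup>2), csqrt (1 - (z / y)\<^sup>2), (u - 2 * y\<^sup>2 + z\<^sup>2) / y, 3 * y])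
     = vector [\<xi> * height y z, y, z, u]"
proof -
  define s where "s = csqrt ((z / y)\<^sup>2)"
  have z: "\<epsilon> * s * y = z" using e y by (simp add: s_def field_simps)
  have "s * s = (z / y)\<^sup>2" by (simp add: s_def flip: power2_eq_square)
  then have s2: "s * s * y * y = z\<^sup>2" using y by (simp add: power2_eq_square)
  have a: "(u - 2 * y\<^sup>2 + z\<^sup>2) / y * y = u - 2 * y\<^sup>2 + z\<^sup>2" using y by simp
  have "1/3 * ((u - 2 * y\<^sup>2 + z\<^sup>2) / y) * (3 * y) + 2/9 * (3 * y) * (3 * y) + (-1/9) * (s * s * (3 * y) * (3 * y))
     = (u - 2 * y\<^sup>2 + z\<^sup>2) / y * y + 2 * y\<^sup>2 - s * s * y * y"
    by (simp add: power2_eq_square)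
  also have "\<dots> = u" unfolding a s2 by simp
  finally have u: "1/3 * ((u - 2 * y\<^sup>2 + z\<^sup>2) / y) * (3 * y) + 2/9 * (3 * y) * (3 * y) + (-1/9) * (s * s * (3 * y) * (3 * y)) = u" .
  have z': "1/3 * \<epsilon> * s * (3 * y) = z" unfolding z[symmetric] by simp
  show ?thesis
    unfolding vec_eq_iff forall_4 lift_def coords_4 height_def s_def[symmetric] u z' by simp
qed

text \<open>The step that transports information between trajectories. The value \<open>w\<close> of \<open>F\<close> at one point is constant along
  its trajectory, so the polynomial relation for \<open>F\<close>, with \<open>w\<close> inserted, vanishes there. By algebraic independence it
  vanishes at every point with the same \<open>\<xi>\<close> and \<open>\<epsilon>\<close>, whatever the remaining coordinates are. Hence all values
  of \<open>F\<close> on a level set are roots of one and the same polynomial.\<close>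

lemma integral_value_is_root:
  assumes S: "open S" and F: "first_integral_on S F"
    and cp: "\<And>i. i \<le> n \<Longrightarrow> complex_polynomial (c i)"
    and root: "\<And>p. p \<in> S \<Longrightarrow> (\<Sum>i\<le>n. c i p * F p ^ i) = 0"
    and e: "\<epsilon>\<^sup>2 = 1"
    and y: "y \<noteq> 0" "(z / y)\<^sup>2 \<in> cut_plane" "z / y = \<epsilon> * csqrt ((z / y)\<^sup>2)"
    and p: "vector [\<xi> * height y z, y, z, u] \<in> S"
    and y': "y' \<noteq> 0" "(z' / y')\<^sup>2 \<in> cut_plane" "z' / y' = \<epsilon> * csqrt ((z' / y')\<^sup>2)"
  shows "(\<Sum>i\<le>n. c i (vector [\<xi> * height y' z', y', z', u']) * F (vector [\<xi> * height y z, y, z, u]) ^ i) = 0"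
proof -
  define m where "m = (z / y)\<^sup>2"
  define a where "a = (u - 2 * y\<^sup>2 + z\<^sup>2) / y"
  define j1 where "j1 = 2 / of_real pi * (a * ell_K m + (3 * y) * ell_E m)"
  define j2 where "j2 = 2 / of_real pi * ((a + 3 * y) * ell_K (1 - m) - (3 * y) * ell_E (1 - m))"
  have m: "m \<in> cut_plane" using y by (simp add: m_def)
  have sa: "sol_a j1 j2 m = a" and sb: "sol_b j1 j2 m = 3 * y"
    unfolding j1_def j2_def by (rule sol_surjective[OF m])+
  have P: "trajectory \<xi> \<epsilon> j1 j2 m = vector [\<xi> * height y z, y, z, u]"
    unfolding trajectory_def sol_point_def sa sb unfolding m_def a_def
    by (rule cut_plane_coordinates[OF y])
  have b: "sol_b j1 j2 m \<noteq> 0" unfolding sb using y(1) by simp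
  have pS: "trajectory \<xi> \<epsilon> j1 j2 m \<in> S" unfolding P by (rule p)
  define w where "w = F (vector [\<xi> * height y z, y, z, u])"
  obtain N where N: "open N" "m \<in> N" "N \<subseteq> cut_plane"
    "\<And>m. m \<in> N \<Longrightarrow> trajectory \<xi> \<epsilon> j1 j2 m \<in> S"
    "\<And>m. m \<in> N \<Longrightarrow> F (trajectory \<xi> \<epsilon> j1 j2 m) = w"
    using first_integral_along_trajectory[OF S F e m b pS] unfolding P w_def by blast
  define H where "H = (\<lambda>q. \<Sum>i\<le>n. c i (lift \<xi> \<epsilon> q) * w ^ i)"
  have H: "complex_polynomial H"
    unfolding H_def
    by (intro complex_polynomial_sum complex_polynomial.mult complex_polynomial.const
        complex_polynomial_compose[OF cp complex_polynomial_lift])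
  have "H (vector [csqrt ((z' / y')\<^sup>2), csqrt (1 - (z' / y')\<^sup>2), (u' - 2 * y'\<^sup>2 + z'\<^sup>2) / y', 3 * y']) = 0"
  proof (rule solution_algebraically_independent[OF H _ N(1) _ N(3)])
    show "j1 \<noteq> 0 \<or> j2 \<noteq> 0" using sb y(1) by (auto simp: sol_b_def)
    show "H (sol_point j1 j2 m) = 0" if "m \<in> N" for m
      using root[OF N(4)[OF that]] N(5)[OF that] by (simp add: H_def trajectory_def)
  qed (use N y' in auto)
  then show ?thesis
    unfolding H_def cut_plane_coordinates[OF y'] w_def .
qed

text \<open>Here \<open>(z / y)\<^sup>2\<close> avoids the cuts, and the rational integral is finite and nonzero.\<close>

definition generic_points :: "(complex^4) set" where
  "generic_points = {p. p $ 1 \<noteq> 0 \<and> p $ 2 \<noteq> 0 \<and> Im ((p $ 3 / p $ 2)\<^sup>2) \<noteq> 0}"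

lemma open_Im_neq_0: "open {w. Im w \<noteq> 0}"
  by (intro open_Collect_neq continuous_intros)

lemma open_Re_pos: "open {w. 0 < Re w}"
  by (intro open_Collect_less continuous_intros)

lemma open_generic_points: "open generic_points"
proof -
  have o: "open {p :: complex^4. p $ 1 \<noteq> 0 \<and> p $ 2 \<noteq> 0}"
    by (intro open_Collect_conj open_Collect_neq continuous_intros)
  have "continuous_on {p :: complex^4. p $ 1 \<noteq> 0 \<and> p $ 2 \<noteq> 0} (\<lambda>p. (p $ 3 / p $ 2)\<^sup>2)"
    by (intro continuous_intros) auto
  from continuous_open_preimage[OF this o open_Im_neq_0]
  have "open ({p :: complex^4. p $ 1 \<noteq> 0 \<and> p $ 2 \<noteq> 0} \<inter> (\<lambda>p. (p $ 3 / p $ 2)\<^sup>2) -` {w. Im w \<noteq> 0})" .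
  also have "{p :: complex^4. p $ 1 \<noteq> 0 \<and> p $ 2 \<noteq> 0} \<inter> (\<lambda>p. (p $ 3 / p $ 2)\<^sup>2) -` {w. Im w \<noteq> 0} = generic_points"
    by (auto simp: generic_points_def)
  finally show ?thesis .
qed

lemma dense_generic_points:
  assumes S: "open S" shows "S \<subseteq> closure (S \<inter> generic_points)"
proof
  fix p assume p: "p \<in> S"
  show "p \<in> closure (S \<inter> generic_points)"
  proof (rule ccontr)
    assume "p \<notin> closure (S \<inter> generic_points)"
    define G where "G = - closure (S \<inter> generic_points)"
    have G: "G \<inter> (S \<inter> generic_points) = {}"
      using closure_subset[of "S \<inter> generic_points"] unfolding G_def by blast
    have "open (G \<inter> S)"
      unfolding G_def by (intro open_Int open_Compl closed_closure S)
    moreover have "p \<in> G \<inter> S"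
      using p \<open>p \<notin> closure (S \<inter> generic_points)\<close> by (simp add: G_def)
    ultimately obtain e where e: "e > 0" "ball p e \<subseteq> G \<inter> S" using open_contains_ball by blast
    have ex: "\<exists>x'. x' \<noteq> 0 \<and> cmod (x' - x) < e/4" for x
    proof (cases "x = 0")
      case True
      then show ?thesis by (intro exI[of _ "of_real (e/8)"]) (use e in auto)
    next
      case False
      then show ?thesis by (intro exI[of _ x]) (use e in auto)
    qed
    obtain x where x: "x \<noteq> 0" "cmod (x - p $ 1) < e/4" using ex by blast
    obtain y where y: "y \<noteq> 0" "cmod (y - p $ 2) < e/4" using ex by blast
    define v where "v = p $ 3 / y"
    have "infinite ({0<..<e / (8 * cmod y)} - {- Re v, - Im v})"
      by (rule Diff_infinite_finite) (use e y in \<open>auto intro!: infinite_Ioo\<close>)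
    then have "{0<..<e / (8 * cmod y)} - {- Re v, - Im v} \<noteq> {}"
      by (rule infinite_imp_nonempty)
    then obtain t where "t \<in> {0<..<e / (8 * cmod y)} - {- Re v, - Im v}"
      by blast
    then have t: "0 < t" "t < e / (8 * cmod y)" "t \<noteq> - Re v" "t \<noteq> - Im v"
      by simp_all
    \<comment> \<open>a small diagonal shift makes both the real and the imaginary part of \<open>z / y\<close> nonzero\<close>
    define z where "z = y * (v + of_real t * (1 + \<i>))"
    have "Im ((z / y)\<^sup>2) = 2 * (Re v + t) * (Im v + t)"
      using y by (simp add: z_def power2_eq_square)
    moreover have "Re v + t \<noteq> 0" "Im v + t \<noteq> 0" using t by linarith+
    ultimately have zi: "Im ((z / y)\<^sup>2) \<noteq> 0" by simp
    have "z - p $ 3 = y * of_real t * (1 + \<i>)" using y by (simp add: z_def v_def algebra_simps)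
    then have "cmod (z - p $ 3) = cmod y * t * cmod (1 + \<i>)" using t by (simp add: norm_mult)
    also have "\<dots> \<le> cmod y * t * 2"
    proof (rule mult_left_mono)
      show "cmod (1 + \<i>) \<le> 2" using norm_triangle_ineq[of 1 \<i>] by simp
      show "0 \<le> cmod y * t" using t by simp
    qed
    also have "\<dots> < e/4"
    proof -
      have "t * (8 * cmod y) < e" using t(2) pos_less_divide_eq[of "8 * cmod y" t e] y by fastforce
      moreover have "cmod y * t * 2 = t * (8 * cmod y) / 4" by simp
      ultimately show ?thesis by linarith
    qed
    finally have z: "cmod (z - p $ 3) < e/4" .
    define q :: "complex^4" where "q = vector [x, y, z, p $ 4]"
    have "norm (q - p) \<le> (\<Sum>i\<in>UNIV. cmod ((q - p) $ i))"
      unfolding norm_vec_def by (rule L2_set_le_sum) auto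
    also have "\<dots> < e" using x y z e(1) by (simp add: sum_4 q_def)
    finally have "q \<in> G \<inter> S" using e by (auto simp: dist_norm norm_minus_commute)
    moreover have "q \<in> generic_points" using x y zi by (simp add: generic_points_def q_def)
    ultimately show False using G by auto
  qed
qed

definition chart :: "complex \<times> complex \<times> complex \<times> complex \<Rightarrow> complex^4" where
  "chart q = vector [fst q * height (fst (snd q)) (fst (snd (snd q))),
     fst (snd q), fst (snd (snd q)), snd (snd (snd q))]"

lemma chart_simp: "chart (\<xi>, y, z, u) = vector [\<xi> * height y z, y, z, u]"
  by (simp add: chart_def)

lemma height_square: "y \<noteq> 0 \<Longrightarrow> (height y z)\<^sup>2 = 9 * (y\<^sup>2 - z\<^sup>2)"
  by (simp add: height_def power_mult_distrib field_simps)

lemma height_nonzero: "y \<noteq> 0 \<Longrightarrow> Im ((z / y)\<^sup>2) \<noteq> 0 \<Longrightarrow> height y z \<noteq> 0"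
  using cut_planeD(5)[of "(z / y)\<^sup>2"] by (simp add: height_def cut_plane_iff)

lemma sign_csqrt:
  assumes e: "\<epsilon> = 1 \<or> \<epsilon> = -1" and "0 < Re (\<epsilon> * v)"
  shows "v = \<epsilon> * csqrt (v\<^sup>2)"
  using e csqrt_square[of "\<epsilon> * v"] assms(2) by (auto simp: power_mult_distrib)

text \<open>The reference point at which the roots are computed must carry the prescribed sign \<open>\<epsilon>\<close>.\<close>

lemma polynomial_nonzero_in_sector:
  assumes P: "complex_polynomial (P :: complex^4 \<Rightarrow> complex)" "P p \<noteq> 0" and e: "\<epsilon> = 1 \<or> \<epsilon> = -1"
  obtains q :: "complex^4" where "P q \<noteq> 0" "q $ 2 \<noteq> 0" "Im ((q $ 3 / q $ 2)\<^sup>2) \<noteq> 0" "0 < Re (\<epsilon> * (q $ 3 / q $ 2))"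
proof -
  let ?D = "{p :: complex^4. p $ 2 \<noteq> 0}"
  define G where "G = (?D \<inter> (\<lambda>p. (p $ 3 / p $ 2)\<^sup>2) -` {w. Im w \<noteq> 0})
      \<inter> (?D \<inter> (\<lambda>p. \<epsilon> * (p $ 3 / p $ 2)) -` {w. 0 < Re w})"
  have D: "open ?D" by (intro open_Collect_neq continuous_intros)
  have "open G"
    unfolding G_def
    by (intro open_Int continuous_open_preimage[OF _ D] continuous_intros open_Im_neq_0 open_Re_pos) auto
  moreover have "vector [0, 1, \<epsilon> * (1 + \<i>), 0] \<in> G"
    using e by (auto simp: G_def power2_eq_square)
  ultimately obtain q where "q \<in> G" "P q \<noteq> 0"
    using complex_polynomial_eq_0[OF P(1)] P(2) by blast
  then show ?thesis using that[of q] by (auto simp: G_def)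
qed

lemma holomorphic_several_continuous:
  assumes "holomorphic_several_on S F" shows "continuous_on S F"
  using assms unfolding holomorphic_several_on_def
  by (meson continuous_at_imp_continuous_on has_derivative_continuous)

text \<open>For fixed \<open>\<xi>\<close> the values of \<open>F\<close> are roots of a fixed polynomial, which is nonzero for all but finitely many
  \<open>\<xi>\<close>. A continuous function with finitely many values on a connected set is constant; the exceptional
  \<open>\<xi>\<close> follow by continuity.\<close>

lemma algebraic_integral_constant_on_fibres:
  assumes S: "open S" and F: "first_integral_on S F" and cont: "continuous_on S F"
    and alg: "algebraic_on S F" and e: "\<epsilon> = 1 \<or> \<epsilon> = -1"
    and A: "open A" and B: "connected B"
    and AB: "\<And>\<xi> y z u. \<xi> \<in> A \<Longrightarrow> (y, z, u) \<in> B \<Longrightarrow>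
        y \<noteq> 0 \<and> Im ((z / y)\<^sup>2) \<noteq> 0 \<and> 0 < Re (\<epsilon> * (z / y)) \<and> chart (\<xi>, y, z, u) \<in> S"
    and contF: "continuous_on (A \<times> B) (\<lambda>q. F (chart q))"
    and \<xi>: "\<xi> \<in> A" and bb: "b \<in> B" "b' \<in> B"
  shows "F (chart (\<xi>, b)) = F (chart (\<xi>, b'))"
proof -
  obtain n c i0 p0 where cp: "\<And>i. i \<le> (n::nat) \<Longrightarrow> complex_polynomial (c i)"
    and i0: "i0 \<le> n" "c i0 p0 \<noteq> 0"
    and root: "\<And>p. p \<in> S \<Longrightarrow> (\<Sum>i\<le>n. c i p * F p ^ i) = 0"
    using alg unfolding algebraic_on_def by blast
  obtain q :: "complex^4" where q: "c i0 q \<noteq> 0" "q $ 2 \<noteq> 0" "Im ((q $ 3 / q $ 2)\<^sup>2) \<noteq> 0" "0 < Re (\<epsilon> * (q $ 3 / q $ 2))"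
    using polynomial_nonzero_in_sector[OF cp[OF i0(1)] i0(2) e] by blast
  define h where "h = height (q $ 2) (q $ 3)"
  have h: "h \<noteq> 0" unfolding h_def by (rule height_nonzero[OF q(2,3)])
  \<comment> \<open>the reference point on the level \<open>\<xi>\<close>; the exceptional levels are the roots of \<open>r\<close>\<close>
  define Q :: "complex \<Rightarrow> complex^4" where "Q = (\<lambda>\<xi>. vector [\<xi> * h, q $ 2, q $ 3, q $ 4])"
  have "\<exists>r. \<forall>\<xi>. c i0 (Q \<xi>) = poly r \<xi>"
  proof (rule complex_polynomial_univariate[OF cp[OF i0(1)]])
    have "\<forall>\<xi>. Q \<xi> $ 1 = poly [:0, h:] \<xi>" "\<forall>\<xi>. Q \<xi> $ 2 = poly [:q $ 2:] \<xi>"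
      "\<forall>\<xi>. Q \<xi> $ 3 = poly [:q $ 3:] \<xi>" "\<forall>\<xi>. Q \<xi> $ 4 = poly [:q $ 4:] \<xi>"
      by (simp_all add: Q_def)
    then show "\<exists>r. \<forall>\<xi>. Q \<xi> $ i = poly r \<xi>" for i
      using exhaust_4[of i] by blast
  qed
  then obtain r where r: "\<And>\<xi>. c i0 (Q \<xi>) = poly r \<xi>" by blast
  have "Q (q $ 1 / h) = q" using h by (simp add: Q_def vec_eq_iff forall_4)
  then have "r \<noteq> 0" using r[of "q $ 1 / h"] q(1) by auto
  then have bad: "finite {\<xi>. poly r \<xi> = 0}" by (rule poly_roots_finite)
  have good: "F (chart (\<xi>, b)) = F (chart (\<xi>, b'))" if \<xi>: "\<xi> \<in> A" "poly r \<xi> \<noteq> 0" for \<xi>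
  proof -
    define P where "P = (\<Sum>i\<le>n. monom (c i (Q \<xi>)) i)"
    have "coeff P i0 = c i0 (Q \<xi>)" using i0 by (simp add: P_def coeff_sum)
    then have "P \<noteq> 0" using \<xi> r by auto
    have "poly P (F (chart (\<xi>, b))) = 0" if b: "b \<in> B" for b
    proof -
      obtain y z u where yzu: "b = (y, z, u)" by (cases b)
      note g = AB[OF \<xi>(1) b[unfolded yzu]]
      have "(\<Sum>i\<le>n. c i (vector [\<xi> * height (q$2) (q$3), q$2, q$3, q$4])
            * F (vector [\<xi> * height y z, y, z, u]) ^ i) = 0"
        by (rule integral_value_is_root[OF S F cp root])
           (use g e q sign_csqrt[OF e] in \<open>auto simp: chart_simp cut_plane_iff\<close>)
      then show ?thesis
        by (simp add: P_def poly_sum poly_monom yzu chart_simp Q_def h_def)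
    qed
    then have "(\<lambda>b. F (chart (\<xi>, b))) ` B \<subseteq> {w. poly P w = 0}" by auto
    then have "finite ((\<lambda>b. F (chart (\<xi>, b))) ` B)"
      using poly_roots_finite[OF \<open>P \<noteq> 0\<close>] finite_subset by blast
    moreover have "continuous_on B (\<lambda>b. F (chart (\<xi>, b)))"
      by (rule continuous_on_compose2[OF contF]) (use \<xi> in \<open>auto intro!: continuous_intros\<close>)
    ultimately have "(\<lambda>b. F (chart (\<xi>, b))) constant_on B"
      using continuous_finite_range_constant[OF B] by blast
    then show ?thesis using bb unfolding constant_on_def by metis
  qed
  define d where "d = (\<lambda>\<xi>. F (chart (\<xi>, b)) - F (chart (\<xi>, b')))"
  have "continuous_on A d"
    unfolding d_def
    by (intro continuous_on_diff continuous_on_compose2[OF contF]) (use bb in \<open>auto intro!: continuous_intros\<close>)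
  then have lim: "(d \<longlongrightarrow> d \<xi>) (at \<xi>)"
    using A \<xi> by (simp add: continuous_on_eq_continuous_at isCont_def)
  have "eventually (\<lambda>x. x \<in> A) (at \<xi>)" using A \<xi> eventually_at_in_open' by blast
  moreover have "eventually (\<lambda>x. x \<notin> {\<xi>. poly r \<xi> = 0}) (at \<xi>)"
    using islimpt_finite[OF bad, of \<xi>] by (simp add: islimpt_iff_eventually)
  ultimately have "eventually (\<lambda>x. d x = 0) (at \<xi>)"
    by eventually_elim (use good in \<open>auto simp: d_def\<close>)
  then have "(d \<longlongrightarrow> 0) (at \<xi>)" by (simp add: tendsto_eventually)
  then have "d \<xi> = 0" using tendsto_unique[OF _ lim] by simp
  then show ?thesis by (simp add: d_def)
qed

text \<open>Only the first coordinate moves with \<open>\<xi>\<close>, and it does so linearly.\<close>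

lemma F_chart_holomorphic:
  assumes F: "holomorphic_several_on S F" and A: "\<And>\<xi>. \<xi> \<in> A \<Longrightarrow> chart (\<xi>, b) \<in> S"
  shows "(\<lambda>\<xi>. F (chart (\<xi>, b))) holomorphic_on A"
proof (rule holomorphic_onI)
  fix \<xi> assume "\<xi> \<in> A"
  then obtain g :: "complex^4" where g: "(F has_derivative (\<lambda>h. \<Sum>i\<in>UNIV. g $ i * h $ i)) (at (chart (\<xi>, b)))"
    using F A unfolding holomorphic_several_on_def by blast
  define h where "h = height (fst b) (fst (snd b))"
  define e :: "complex \<Rightarrow> complex^4" where "e = (\<lambda>t. vector [t * h, 0, 0, 0])"
  have "((\<lambda>\<xi>. chart (\<xi>, b)) has_derivative e) (at \<xi> within A)"
  proof (rule has_derivative_vec_componentwise)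
    have "((\<lambda>\<xi>. chart (\<xi>, b) $ 1) has_derivative (\<lambda>t. e t $ 1)) (at \<xi> within A)"
      "((\<lambda>\<xi>. chart (\<xi>, b) $ 2) has_derivative (\<lambda>t. e t $ 2)) (at \<xi> within A)"
      "((\<lambda>\<xi>. chart (\<xi>, b) $ 3) has_derivative (\<lambda>t. e t $ 3)) (at \<xi> within A)"
      "((\<lambda>\<xi>. chart (\<xi>, b) $ 4) has_derivative (\<lambda>t. e t $ 4)) (at \<xi> within A)"
      unfolding chart_def e_def coords_4 h_def by (auto intro!: derivative_eq_intros)
    then show "((\<lambda>\<xi>. chart (\<xi>, b) $ i) has_derivative (\<lambda>t. e t $ i)) (at \<xi> within A)" for i
      using exhaust_4[of i] by metis
  qed
  from has_derivative_compose[OF this g]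
  have "((\<lambda>\<xi>. F (chart (\<xi>, b))) has_derivative (\<lambda>t. g $ 1 * h * t)) (at \<xi> within A)"
    by (simp add: sum_4 e_def mult_ac)
  then show "(\<lambda>\<xi>. F (chart (\<xi>, b))) field_differentiable at \<xi> within A"
    unfolding field_differentiable_def has_field_derivative_def by blast
qed

definition coordinates :: "complex^4 \<Rightarrow> complex \<times> complex \<times> complex \<times> complex" where
  "coordinates p = (p $ 1 / height (p $ 2) (p $ 3), p $ 2, p $ 3, p $ 4)"

lemma chart_coordinates:
  assumes "p \<in> generic_points" shows "chart (coordinates p) = p"
  using height_nonzero[of "p $ 2" "p $ 3"] assms
  by (auto simp: coordinates_def chart_def vec_eq_iff forall_4 generic_points_def)

lemma continuous_height:
  fixes f g :: "'a::topological_space \<Rightarrow> complex"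
  assumes "continuous_on S f" "continuous_on S g"
    and "\<And>x. x \<in> S \<Longrightarrow> f x \<noteq> 0" "\<And>x. x \<in> S \<Longrightarrow> Im ((g x / f x)\<^sup>2) \<noteq> 0"
  shows "continuous_on S (\<lambda>x. height (f x) (g x))"
proof -
  have "continuous_on S (\<lambda>x. csqrt (1 - (g x / f x)\<^sup>2))"
    by (rule continuous_on_compose2[OF continuous_on_csqrt])
       (use assms in \<open>auto intro!: continuous_intros simp: complex_nonpos_Reals_iff\<close>)
  then show ?thesis unfolding height_def by (intro continuous_intros assms)
qed

lemma continuous_coordinates: "continuous_on generic_points coordinates"
  unfolding coordinates_def[abs_def]
  by (intro continuous_intros continuous_height) (auto simp: generic_points_def height_nonzero)

lemma pi_I_squared_coordinates:
  assumes p: "p \<in> generic_points"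
  shows "fst (coordinates p) \<noteq> 0" "pi_I_squared p = 1 / (9 * (fst (coordinates p))\<^sup>2)"
proof -
  let ?h = "height (p $ 2) (p $ 3)"
  have h: "?h \<noteq> 0" and x: "p $ 1 \<noteq> 0" and y: "p $ 2 \<noteq> 0"
    using height_nonzero[of "p $ 2" "p $ 3"] p by (auto simp: generic_points_def)
  show "fst (coordinates p) \<noteq> 0" using h x by (simp add: coordinates_def)
  have "?h\<^sup>2 / 9 = (p $ 2)\<^sup>2 - (p $ 3)\<^sup>2"
    using height_square[OF y, of "p $ 3"] by simp
  then have "pi_I_squared p = (?h\<^sup>2 / 9) / (p $ 1)\<^sup>2"
    unfolding pi_I_squared_def Let_def by (simp only:)
  then show "pi_I_squared p = 1 / (9 * (fst (coordinates p))\<^sup>2)"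
    using h x by (simp add: coordinates_def field_simps)
qed

text \<open>The condition on \<open>\<xi>0 / \<xi>\<close> makes \<open>\<xi>\<close> a single-valued function of \<open>1 / \<xi>\<^sup>2\<close> through the principal square
  root.\<close>

definition good_region :: "complex \<Rightarrow> complex \<Rightarrow> (complex^4) set \<Rightarrow> (complex \<times> complex \<times> complex \<times> complex) set" where
  "good_region \<epsilon> \<xi>0 S = {(\<xi>, y, z, u). \<xi> \<noteq> 0 \<and> y \<noteq> 0 \<and> Im ((z / y)\<^sup>2) \<noteq> 0 \<and> 0 < Re (\<epsilon> * (z / y))
     \<and> 0 < Re (\<xi>0 / \<xi>) \<and> chart (\<xi>, y, z, u) \<in> S}"

lemma good_region_conv:
  fixes \<epsilon> \<zeta> :: complex and S :: "(complex^4) set"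
  defines "R \<equiv> {q :: complex \<times> complex \<times> complex \<times> complex. fst q \<noteq> 0 \<and> fst (snd q) \<noteq> 0}"
  defines "R' \<equiv> (R \<inter> (\<lambda>q. (fst (snd (snd q)) / fst (snd q))\<^sup>2) -` {w. Im w \<noteq> 0})
      \<inter> ((R \<inter> (\<lambda>q. \<epsilon> * (fst (snd (snd q)) / fst (snd q))) -` {w. 0 < Re w})
        \<inter> (R \<inter> (\<lambda>q. \<zeta> / fst q) -` {w. 0 < Re w}))"
  shows "open R'" "good_region \<epsilon> \<zeta> S = R' \<inter> chart -` S" "continuous_on R' chart"
proof -
  have R: "open R"
    unfolding R_def by (intro open_Collect_conj open_Collect_neq continuous_intros)
  show "open R'"
    unfolding R'_def
    by (intro open_Int continuous_open_preimage[OF _ R] continuous_intros open_Im_neq_0 open_Re_pos)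
       (auto simp: R_def)
  show "good_region \<epsilon> \<zeta> S = R' \<inter> chart -` S"
    by (auto simp: good_region_def R_def R'_def)
  show "continuous_on R' chart"
    unfolding chart_def[abs_def]
    by (intro continuous_on_vector_4 continuous_intros continuous_height) (auto simp: R_def R'_def)
qed

lemma good_region_subset: "q \<in> good_region \<epsilon> \<xi>0 S \<Longrightarrow> chart q \<in> S"
  by (auto simp: good_region_def)

text \<open>In the coordinates \<open>(\<xi>, y, z, u)\<close> the function \<open>F\<close> depends on \<open>\<xi>\<close> only, and \<open>\<xi>\<close> is locally a
  holomorphic function of the rational integral.\<close>

theorem algebraic_integral_dependent:
  assumes S: "open S" and F: "holomorphic_several_on S F" "algebraic_on S F" "first_integral_on S F"
  shows "functionally_dependent_on S F pi_I_squared"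
  unfolding functionally_dependent_on_def
proof (rule exI[of _ "S \<inter> generic_points"], intro conjI)
  show "open (S \<inter> generic_points)" using S open_generic_points by (rule open_Int)
  show "S \<subseteq> closure (S \<inter> generic_points)" by (rule dense_generic_points[OF S])
  show "S \<inter> generic_points \<subseteq> S" by (rule Int_lower1)
  show "\<forall>p\<in>S \<inter> generic_points. \<exists>V W \<phi>. open V \<and> p \<in> V \<and> V \<subseteq> S \<inter> generic_points \<and> open W \<and>
      \<phi> holomorphic_on W \<and> (\<forall>q\<in>V. pi_I_squared q \<in> W \<and> F q = \<phi> (pi_I_squared q))"
  proof
    fix p0 assume p0: "p0 \<in> S \<inter> generic_points"
    then have g0: "p0 \<in> generic_points" by simp
    define \<xi>0 where "\<xi>0 = fst (coordinates p0)"
    define b0 where "b0 = snd (coordinates p0)"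
    have \<xi>0: "\<xi>0 \<noteq> 0" unfolding \<xi>0_def by (rule pi_I_squared_coordinates(1)[OF g0])
    define \<epsilon> :: complex where "\<epsilon> = (if 0 < Re (p0 $ 3 / p0 $ 2) then 1 else -1)"
    have e: "\<epsilon> = 1 \<or> \<epsilon> = -1" by (simp add: \<epsilon>_def)
    have "Im ((p0 $ 3 / p0 $ 2)\<^sup>2) \<noteq> 0" using g0 by (simp add: generic_points_def)
    then have "Re (p0 $ 3 / p0 $ 2) \<noteq> 0" unfolding Im_power2 by simp
    then have eps: "0 < Re (\<epsilon> * (p0 $ 3 / p0 $ 2))" by (auto simp: \<epsilon>_def)
    define G where "G = good_region \<epsilon> \<xi>0 S"
    note conv = good_region_conv(1)[where \<epsilon> = \<epsilon> and \<zeta> = \<xi>0]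
      good_region_conv(2)[where \<epsilon> = \<epsilon> and \<zeta> = \<xi>0 and S = S, folded G_def]
      good_region_conv(3)[where \<epsilon> = \<epsilon> and \<zeta> = \<xi>0]
    have opG: "open G"
      unfolding conv(2) by (rule continuous_open_preimage[OF conv(3,1) S])
    have contF: "continuous_on G (\<lambda>q. F (chart q))"
    proof (rule continuous_on_compose2[OF holomorphic_several_continuous[OF F(1)]])
      show "continuous_on G chart"
        by (rule continuous_on_subset[OF conv(3)]) (use conv(2) in blast)
    qed (auto simp: G_def good_region_subset)
    have "(\<xi>0, b0) \<in> G"
      using g0 p0 eps \<xi>0 chart_coordinates[OF g0]
      unfolding G_def good_region_def \<xi>0_def b0_def by (auto simp: coordinates_def generic_points_def)
    then obtain A B1 where AB: "open A" "open B1" "(\<xi>0, b0) \<in> A \<times> B1" "A \<times> B1 \<subseteq> G"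
      using open_prod_elim[OF opG] by metis
    then obtain \<delta> where \<delta>: "\<delta> > 0" "ball b0 \<delta> \<subseteq> B1"
      using open_contains_ball by (metis mem_Sigma_iff)
    define B where "B = ball b0 \<delta>"
    have B: "connected B" "open B" "b0 \<in> B" and ABG: "A \<times> B \<subseteq> G"
      using \<delta> AB by (auto simp: B_def)
    have A0: "\<xi>0 \<in> A" using AB by simp
    have fibre: "F (chart (\<xi>, b)) = F (chart (\<xi>, b0))" if "\<xi> \<in> A" "b \<in> B" for \<xi> b
    proof (rule algebraic_integral_constant_on_fibres[OF S F(3) holomorphic_several_continuous[OF F(1)] F(2) e AB(1) B(1) _ _ that B(3)])
      show "continuous_on (A \<times> B) (\<lambda>q. F (chart q))" by (rule continuous_on_subset[OF contF ABG])
      show "y \<noteq> 0 \<and> Im ((z / y)\<^sup>2) \<noteq> 0 \<and> 0 < Re (\<epsilon> * (z / y)) \<and> chart (\<xi>, y, z, u) \<in> S"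
        if "\<xi> \<in> A" "(y, z, u) \<in> B" for \<xi> y z u
      proof -
        have "(\<xi>, y, z, u) \<in> G" using ABG that by blast
        then show ?thesis by (simp add: G_def good_region_def)
      qed
    qed
    define V where "V = generic_points \<inter> coordinates -` (A \<times> B)"
    \<comment> \<open>recovers \<open>\<xi>\<close> from the value \<open>c = 1 / (9 \<xi>\<^sup>2)\<close> of the rational integral\<close>
    define \<psi> where "\<psi> = (\<lambda>c. \<xi>0 / csqrt (9 * \<xi>0\<^sup>2 * c))"
    define D where "D = (\<lambda>c. 9 * \<xi>0\<^sup>2 * c) -` (- \<real>\<^sub>\<le>\<^sub>0)"
    define W where "W = D \<inter> \<psi> -` A"
    have opD: "open D"
      unfolding D_def by (intro continuous_open_vimage continuous_intros open_Compl closed_nonpos_Reals_complex)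
    have hol\<psi>: "\<psi> holomorphic_on D"
      unfolding \<psi>_def by (intro holomorphic_intros) (auto simp: D_def)
    have opW: "open W"
      unfolding W_def by (rule continuous_open_preimage[OF holomorphic_on_imp_continuous_on[OF hol\<psi>] opD AB(1)])
    have inv: "9 * \<xi>0\<^sup>2 * pi_I_squared q \<notin> \<real>\<^sub>\<le>\<^sub>0" "\<psi> (pi_I_squared q) = fst (coordinates q)"
      if q: "q \<in> V" for q
    proof -
      let ?\<xi> = "fst (coordinates q)"
      have qg: "q \<in> generic_points" and "coordinates q \<in> G" using q ABG by (auto simp: V_def)
      then have r: "0 < Re (\<xi>0 / ?\<xi>)" by (auto simp: G_def good_region_def)
      have eq: "9 * \<xi>0\<^sup>2 * pi_I_squared q = (\<xi>0 / ?\<xi>)\<^sup>2"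
        unfolding pi_I_squared_coordinates(2)[OF qg] by (simp add: power_divide)
      show "9 * \<xi>0\<^sup>2 * pi_I_squared q \<notin> \<real>\<^sub>\<le>\<^sub>0"
      proof
        assume "9 * \<xi>0\<^sup>2 * pi_I_squared q \<in> \<real>\<^sub>\<le>\<^sub>0"
        then have "Re ((\<xi>0 / ?\<xi>)\<^sup>2) \<le> 0" "Im ((\<xi>0 / ?\<xi>)\<^sup>2) = 0"
          unfolding eq complex_nonpos_Reals_iff by auto
        then show False using r unfolding Re_power2 Im_power2 by auto
      qed
      have "csqrt ((\<xi>0 / ?\<xi>)\<^sup>2) = \<xi>0 / ?\<xi>" using r by (intro csqrt_square) auto
      then show "\<psi> (pi_I_squared q) = ?\<xi>" using \<xi>0 unfolding \<psi>_def eq by simp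
    qed
    show "\<exists>V W \<phi>. open V \<and> p0 \<in> V \<and> V \<subseteq> S \<inter> generic_points \<and> open W \<and> \<phi> holomorphic_on W \<and>
        (\<forall>q\<in>V. pi_I_squared q \<in> W \<and> F q = \<phi> (pi_I_squared q))"
    proof (intro exI conjI ballI)
      show "open V"
        unfolding V_def using AB(1) B(2)
        by (intro continuous_open_preimage[OF continuous_coordinates open_generic_points] open_Times)
      show "p0 \<in> V" using g0 A0 B(3) unfolding V_def \<xi>0_def b0_def by (simp add: mem_Times_iff)
      have ch: "chart (fst (coordinates q), snd (coordinates q)) = q" if "q \<in> V" for q
        using chart_coordinates that by (simp add: V_def)
      show "V \<subseteq> S \<inter> generic_points"
      proof
        fix q assume q: "q \<in> V"
        then have "coordinates q \<in> G" "q \<in> generic_points" using ABG by (auto simp: V_def)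
        then show "q \<in> S \<inter> generic_points"
          using good_region_subset[of "coordinates q" \<epsilon> \<xi>0 S] chart_coordinates[of q] by (simp add: G_def)
      qed
      show "open W" by (rule opW)
      show "(\<lambda>c. F (chart (\<psi> c, b0))) holomorphic_on W"
      proof (rule holomorphic_on_compose_gen[of \<psi> W "\<lambda>\<xi>. F (chart (\<xi>, b0))" A, unfolded o_def])
        show "\<psi> holomorphic_on W" using hol\<psi> by (rule holomorphic_on_subset) (auto simp: W_def)
        show "(\<lambda>\<xi>. F (chart (\<xi>, b0))) holomorphic_on A"
        proof (rule F_chart_holomorphic[OF F(1)])
          show "chart (\<xi>, b0) \<in> S" if "\<xi> \<in> A" for \<xi>
            by (rule good_region_subset) (use ABG B(3) that in \<open>unfold G_def, blast\<close>)
        qed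
      qed (auto simp: W_def)
      fix q assume q: "q \<in> V"
      then have qA: "fst (coordinates q) \<in> A" "snd (coordinates q) \<in> B" by (auto simp: V_def)
      show "pi_I_squared q \<in> W" using inv[OF q] qA by (simp add: W_def D_def)
      show "F q = F (chart (\<psi> (pi_I_squared q), b0))"
        unfolding inv(2)[OF q] fibre[OF qA, symmetric] ch[OF q] ..
    qed
  qed
qed


section \<open>Relations between branches\<close>

lemma branch_domain:
  assumes "branch fs D gs"
  shows "open D" "connected D" "D \<noteq> {}" "length gs = length fs" "\<forall>g\<in>set gs. g holomorphic_on D"
proof -
  have "open D \<and> connected D \<and> D \<noteq> {} \<and> length gs = length fs \<and> (\<forall>g\<in>set gs. g holomorphic_on D)"
    using assms
  proof induction
    case (start D c r gs)
    then show ?case by (auto dest: list_all2_lengthD simp: convex_connected simp del: ball_eq_empty)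
  next
    case (step D gs D' c r hs)
    have "D' \<noteq> {}" using step.hyps(3) by blast
    then show ?case using step by (auto dest: list_all2_lengthD simp: convex_connected simp del: ball_eq_empty)
  qed
  then show "open D" "connected D" "D \<noteq> {}" "length gs = length fs" "\<forall>g\<in>set gs. g holomorphic_on D"
    by auto
qed

text \<open>The principal branches, as functions of the modulus \<open>k\<close>, are defined here. The set has two components,
  interchanged by \<open>k \<mapsto> -k\<close>.\<close>

definition moduli :: "complex set" where
  "moduli = {k. k\<^sup>2 \<in> cut_plane}"

lemma open_moduli: "open moduli"
proof -
  have "moduli = (\<lambda>k. k\<^sup>2) -` cut_plane" by (auto simp: moduli_def)
  then show ?thesis using continuous_open_vimage[OF open_cut_plane, of "\<lambda>k. k\<^sup>2"] by (auto intro: continuous_intros)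
qed

lemma of_real_moduli: "k \<in> {0<..<1} \<Longrightarrow> complex_of_real k \<in> moduli"
  using real_modulus_square[of k] by (simp add: moduli_def cut_plane_iff flip: of_real_power)

lemma of_real_islimpt:
  assumes "open G" "complex_of_real k \<in> G" "k \<in> {0<..<1}"
  shows "complex_of_real k islimpt (complex_of_real ` {0<..<1} \<inter> G)"
  unfolding islimpt_approachable
proof (intro allI impI)
  fix e :: real assume "e > 0"
  obtain d where d: "d > 0" "ball (complex_of_real k) d \<subseteq> G" using assms open_contains_ball by blast
  define m where "m = min (min e d) (1 - k)"
  have m: "0 < m" "m \<le> e" "m \<le> d" "m \<le> 1 - k"
    using \<open>e > 0\<close> d(1) assms(3) by (auto simp: m_def)
  define t where "t = k + m / 2"
  have t: "t \<noteq> k" "t \<in> {0<..<1}" "\<bar>t - k\<bar> < e" "\<bar>t - k\<bar> < d"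
    using m assms(3) by (auto simp: t_def)
  have dist: "dist (complex_of_real t) (of_real k) = \<bar>t - k\<bar>"
    by (simp add: dist_of_real dist_real_def)
  then have "complex_of_real t \<in> ball (of_real k) d" using t by (simp add: dist_commute)
  then show "\<exists>x'\<in>complex_of_real ` {0<..<1} \<inter> G. x' \<noteq> complex_of_real k \<and> dist x' (complex_of_real k) < e"
    using t d(2) dist by (intro bexI[of _ "complex_of_real t"]) auto
qed

text \<open>The permanence principle: a relation between the principal branches, formed by a holomorphic and local operation
  \<open>P\<close> (such as a differential operator), persists under continuation along a chain of discs, by the identity
  theorem on each disc.\<close>

lemma branch_relation:
  assumes br: "branch fs D gs"
    and Fs: "list_all2 (\<lambda>f G. G holomorphic_on moduli \<and> (\<forall>k\<in>{0<..<1}. G (of_real k) = of_real (f k))) fs Gs"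
    and hol: "\<And>gs D. length gs = length fs \<Longrightarrow> open D \<Longrightarrow> \<forall>g\<in>set gs. g holomorphic_on D \<Longrightarrow> P gs holomorphic_on D"
    and loc: "\<And>gs hs D w. length gs = length fs \<Longrightarrow> open D \<Longrightarrow> list_all2 (\<lambda>g h. \<forall>w\<in>D. g w = h w) gs hs \<Longrightarrow> w \<in> D \<Longrightarrow> P gs w = P hs w"
    and zero: "\<And>w. w \<in> moduli \<Longrightarrow> P Gs w = 0"
    and w: "w \<in> D"
  shows "P gs w = 0"
  using br w
proof (induction arbitrary: w)
  case (start D c r gs)
  then obtain k where k: "k \<in> {0<..<1}" "of_real k \<in> D" by blast
  have opD: "open D" "connected D" using start by (auto simp: convex_connected)
  have len: "length gs = length fs" using start(4) by (auto dest: list_all2_lengthD)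
  obtain d where d: "d > 0" "ball (complex_of_real k) d \<subseteq> D \<inter> moduli"
    using open_Int[OF opD(1) open_moduli] k of_real_moduli[OF k(1)] open_contains_ball by blast
  define B where "B = ball (complex_of_real k) d"
  have B: "open B" "connected B" "of_real k \<in> B" "B \<subseteq> D" "B \<subseteq> moduli"
    using d by (auto simp: B_def convex_connected)
  have agree: "list_all2 (\<lambda>g h. \<forall>w\<in>B. g w = h w) gs Gs"
  proof (rule list_all2I)
    show "length gs = length Gs" using len Fs by (auto dest: list_all2_lengthD)
    show "\<forall>x\<in>set (zip gs Gs). case x of (g, h) \<Rightarrow> \<forall>w\<in>B. g w = h w"
    proof (intro ballI, clarify)
      fix g h w assume gh: "(g, h) \<in> set (zip gs Gs)" and w: "w \<in> B"
      then obtain i where i: "i < length gs" "g = gs ! i" "h = Gs ! i"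
        by (auto simp: set_zip)
      have g: "g holomorphic_on D" "\<forall>k\<in>{0<..<1}. complex_of_real k \<in> D \<longrightarrow> g (of_real k) = of_real ((fs ! i) k)"
        using start(3,4) i len by (auto simp: list_all2_conv_all_nth)
      have h: "h holomorphic_on moduli" "\<forall>k\<in>{0<..<1}. h (of_real k) = of_real ((fs ! i) k)"
        using Fs i len by (auto simp: list_all2_conv_all_nth)
      have "g w - h w = 0"
      proof (rule analytic_continuation[of "\<lambda>w. g w - h w" B "complex_of_real ` {0<..<1} \<inter> B" "of_real k"])
        show "(\<lambda>w. g w - h w) holomorphic_on B"
          using holomorphic_on_subset[OF g(1) B(4)] holomorphic_on_subset[OF h(1) B(5)]
          by (intro holomorphic_intros)
        show "g w - h w = 0" if "w \<in> complex_of_real ` {0<..<1} \<inter> B" for w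
          using that g(2) h(2) B(4) by auto
      qed (use B w k of_real_islimpt[OF B(1,3) k(1)] in auto)
      then show "g w = h w" by simp
    qed
  qed
  have eq: "P gs w = 0" if "w \<in> B" for w
    using loc[OF len B(1) agree that] zero[OF subsetD[OF B(5) that]] by simp
  show ?case
    using analytic_continuation_open[OF B(1) opD(1) _ opD(2) B(4) hol[OF len opD(1) start(3)], of "\<lambda>_. 0" w]
      eq B(3) start(5) by auto
next
  case (step D gs D' c r hs)
  note b = branch_domain[OF step(1)]
  have len: "length hs = length fs" using step(5) b(4) by (auto dest: list_all2_lengthD)
  have op: "open D'" "connected D'" using step(2) by (auto simp: convex_connected)
  have oi: "open (D \<inter> D')" using op b(1) by auto
  have "P hs w = 0" if "w \<in> D \<inter> D'" for w
    using loc[OF b(4) oi step(5) that] step.IH[of w] that by auto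
  then show ?case
    using analytic_continuation_open[OF oi op(1) step(3) op(2) _ hol[OF len op(1) step(4)], of "\<lambda>_. 0" w]
      step.prems by auto
qed

text \<open>If a branch vanished on a disc, so would all its predecessors in the chain, back to the real function.\<close>

lemma branch_leading_nonzero:
  assumes "branch fs D gs" and fs: "fs \<noteq> []" "\<And>k. k \<in> {0<..<1} \<Longrightarrow> (fs ! 0) k \<noteq> 0"
  shows "\<exists>w\<in>D. (gs ! 0) w \<noteq> 0"
  using assms(1)
proof induction
  case (start D c r gs)
  then obtain k where k: "k \<in> {0<..<1}" "of_real k \<in> D" by blast
  then have "(gs ! 0) (of_real k) = of_real ((fs ! 0) k)"
    using start(4) fs(1) by (auto simp: list_all2_conv_all_nth)
  then show ?case using k fs(2)[OF k(1)] by (intro bexI[of _ "of_real k"]) auto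
next
  case (step D gs D' c r hs)
  note b = branch_domain[OF step(1)]
  have g: "gs ! 0 holomorphic_on D"
    using b(4,5) fs(1) by (metis length_greater_0_conv nth_mem)
  have gh: "\<And>w. w \<in> D \<inter> D' \<Longrightarrow> (gs ! 0) w = (hs ! 0) w"
    using b(4) fs(1) step(5) by (auto simp: list_all2_conv_all_nth)
  have oi: "open (D \<inter> D')" using step(2) b(1) by auto
  show ?case
  proof (rule ccontr)
    assume "\<not> (\<exists>w\<in>D'. (hs ! 0) w \<noteq> 0)"
    then have z: "(gs ! 0) w = 0" if "w \<in> D \<inter> D'" for w using gh that by auto
    have "(gs ! 0) w = 0" if "w \<in> D" for w
      by (rule analytic_continuation_open[OF oi b(1) step(3) b(2) _ g holomorphic_on_const])
         (use z that in auto)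
    then show False using step.IH by auto
  qed
qed

lemma deriv_cong_open:
  assumes "open D" "w \<in> D" "\<And>w. w \<in> D \<Longrightarrow> f w = g w"
  shows "deriv f w = deriv g w"
  by (rule deriv_cong_ev[OF eventually_mono[OF eventually_nhds_in_open[OF assms(1,2)] assms(3)] refl])

lemma moduli_slit:
  "k \<in> moduli \<Longrightarrow> k\<^sup>2 \<in> slit_plane" "k \<in> moduli \<Longrightarrow> 1 - k\<^sup>2 \<in> slit_plane"
  by (auto simp: moduli_def cut_planeD)

lemma principal_branches:
  "(\<lambda>k. ell_K (k\<^sup>2)) holomorphic_on moduli" "(\<lambda>k. ell_E (k\<^sup>2)) holomorphic_on moduli"
  "(\<lambda>k. ell_K (1 - k\<^sup>2)) holomorphic_on moduli" "(\<lambda>k. ell_E (1 - k\<^sup>2)) holomorphic_on moduli"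
  by (intro holomorphic_intros moduli_slit; assumption)+

lemma deriv_compose_square:
  assumes f: "f holomorphic_on slit_plane" and k: "k \<in> moduli"
  shows "deriv (\<lambda>k. f (k\<^sup>2)) k = 2 * k * deriv f (k\<^sup>2)" "deriv (\<lambda>k. f (1 - k\<^sup>2)) k = - 2 * k * deriv f (1 - k\<^sup>2)"
proof -
  have d: "((\<lambda>k. k\<^sup>2) has_field_derivative 2 * k) (at k)" "((\<lambda>k. 1 - k\<^sup>2) has_field_derivative - 2 * k) (at k)"
    by (auto intro!: derivative_eq_intros)
  note df = holomorphic_derivI[OF f open_slit_plane]
  show "deriv (\<lambda>k. f (k\<^sup>2)) k = 2 * k * deriv f (k\<^sup>2)" "deriv (\<lambda>k. f (1 - k\<^sup>2)) k = - 2 * k * deriv f (1 - k\<^sup>2)"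
    using DERIV_imp_deriv[OF DERIV_chain2[OF df[OF moduli_slit(1)[OF k]] d(1)]]
      DERIV_imp_deriv[OF DERIV_chain2[OF df[OF moduli_slit(2)[OF k]] d(2)]]
    by (simp_all only: mult_ac)
qed

text \<open>Clearing denominators makes the coefficients entire; a disc reached by continuation may well contain a singular
  point of the equations, such as \<open>k = 0\<close>.\<close>

lemma branch_linear_ode:
  assumes br: "branch [f, g] D [A, B]" and FG: "F holomorphic_on moduli" "G holomorphic_on moduli"
    and val: "\<And>k. k \<in> {0<..<1} \<Longrightarrow> F (of_real k) = of_real (f k)"
      "\<And>k. k \<in> {0<..<1} \<Longrightarrow> G (of_real k) = of_real (g k)"
    and coeffs: "a holomorphic_on UNIV" "b holomorphic_on UNIV" "c holomorphic_on UNIV" "d holomorphic_on UNIV"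
    and ode: "\<And>w. w \<in> moduli \<Longrightarrow> a w * deriv F w + b w * deriv G w = c w * F w + d w * G w"
    and w: "w \<in> D"
  shows "a w * deriv A w + b w * deriv B w = c w * A w + d w * B w"
proof -
  let ?P = "\<lambda>gs w. a w * deriv (gs ! 0) w + b w * deriv (gs ! 1) w - (c w * (gs ! 0) w + d w * (gs ! 1) w)"
  have FGs: "list_all2 (\<lambda>f G. G holomorphic_on moduli \<and> (\<forall>k\<in>{0<..<1}. G (of_real k) = of_real (f k))) [f, g] [F, G]"
    using FG val by simp
  have "?P [A, B] w = 0"
  proof (rule branch_relation[OF br FGs _ _ _ w, where P = ?P])
    fix gs :: "(complex \<Rightarrow> complex) list" and D
    assume gs: "length gs = length [f, g]" "open D" "\<forall>g\<in>set gs. g holomorphic_on D"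
    have "h holomorphic_on UNIV \<Longrightarrow> h holomorphic_on D" for h :: "complex \<Rightarrow> complex"
      by (rule holomorphic_on_subset) auto
    then show "?P gs holomorphic_on D"
      using gs coeffs by (intro holomorphic_intros holomorphic_deriv) auto
  next
    fix gs hs :: "(complex \<Rightarrow> complex) list" and D w
    assume "length gs = length [f, g]" "open D" "list_all2 (\<lambda>g h. \<forall>w\<in>D. g w = h w) gs hs" "w \<in> D"
    then show "?P gs w = ?P hs w"
      using deriv_cong_open[of D w "gs ! 0" "hs ! 0"] deriv_cong_open[of D w "gs ! 1" "hs ! 1"]
      by (auto simp: list_all2_conv_all_nth)
  qed (use ode in simp)
  then show ?thesis by simp
qed

lemma branch_KE_ode:
  assumes br: "branch [legendre_K, legendre_E] D [A, B]" and w: "w \<in> D"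
  shows "w * (1 - w\<^sup>2) * deriv A w = B w - (1 - w\<^sup>2) * A w" "w * deriv B w = B w - A w"
proof -
  note linear = branch_linear_ode[OF br principal_branches(1,2) legendre_K_eq[symmetric] legendre_E_eq[symmetric] _ _ _ _ _ w]
  have "w * (1 - w\<^sup>2) * deriv A w + 0 * deriv B w = - (1 - w\<^sup>2) * A w + 1 * B w"
  proof (rule linear)
    fix w assume w: "w \<in> moduli"
    have "w * (1 - w\<^sup>2) * (2 * w * deriv ell_K (w\<^sup>2)) = 2 * w\<^sup>2 * (1 - w\<^sup>2) * deriv ell_K (w\<^sup>2)"
      by (simp add: power2_eq_square)
    also have "\<dots> = - (1 - w\<^sup>2) * ell_K (w\<^sup>2) + 1 * ell_E (w\<^sup>2)"
      unfolding ell_K_ode[OF moduli_slit(1)[OF w]] by (simp add: algebra_simps)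
    finally show "w * (1 - w\<^sup>2) * deriv (\<lambda>k. ell_K (k\<^sup>2)) w + 0 * deriv (\<lambda>k. ell_E (k\<^sup>2)) w
        = - (1 - w\<^sup>2) * ell_K (w\<^sup>2) + 1 * ell_E (w\<^sup>2)"
      unfolding deriv_compose_square(1)[OF holomorphic_ell_K w] by simp
  qed (auto intro!: holomorphic_intros)
  moreover have "- (1 - w\<^sup>2) * A w + 1 * B w = B w - (1 - w\<^sup>2) * A w" by (simp add: algebra_simps)
  ultimately show "w * (1 - w\<^sup>2) * deriv A w = B w - (1 - w\<^sup>2) * A w" by simp
  have "0 * deriv A w + w * deriv B w = (-1) * A w + 1 * B w"
  proof (rule linear)
    fix w assume w: "w \<in> moduli"
    have "w * (2 * w * deriv ell_E (w\<^sup>2)) = 2 * w\<^sup>2 * deriv ell_E (w\<^sup>2)"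
      by (simp add: power2_eq_square)
    then show "0 * deriv (\<lambda>k. ell_K (k\<^sup>2)) w + w * deriv (\<lambda>k. ell_E (k\<^sup>2)) w = (-1) * ell_K (w\<^sup>2) + 1 * ell_E (w\<^sup>2)"
      using ell_E_ode[OF moduli_slit(1)[OF w]] deriv_compose_square(1)[OF holomorphic_ell_E w] by simp
  qed (auto intro!: holomorphic_intros)
  then show "w * deriv B w = B w - A w" by simp
qed

lemma branch_K'E'_ode:
  assumes br: "branch [legendre_K', legendre_E'] D [A, B]" and w: "w \<in> D"
  shows "w * (1 - w\<^sup>2) * deriv A w = w\<^sup>2 * A w - B w" "(1 - w\<^sup>2) * deriv B w = w * (A w - B w)"
proof -
  note linear = branch_linear_ode[OF br principal_branches(3,4) legendre_K'_eq[symmetric] legendre_E'_eq[symmetric] _ _ _ _ _ w]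
  have "w * (1 - w\<^sup>2) * deriv A w + 0 * deriv B w = w\<^sup>2 * A w + (-1) * B w"
  proof (rule linear)
    fix w assume w: "w \<in> moduli"
    have "w * (1 - w\<^sup>2) * (- 2 * w * deriv ell_K (1 - w\<^sup>2)) = - (2 * (1 - w\<^sup>2) * (1 - (1 - w\<^sup>2)) * deriv ell_K (1 - w\<^sup>2))"
      by (simp add: power2_eq_square)
    then show "w * (1 - w\<^sup>2) * deriv (\<lambda>k. ell_K (1 - k\<^sup>2)) w + 0 * deriv (\<lambda>k. ell_E (1 - k\<^sup>2)) w
        = w\<^sup>2 * ell_K (1 - w\<^sup>2) + (-1) * ell_E (1 - w\<^sup>2)"
      unfolding ell_K_ode[OF moduli_slit(2)[OF w]] using deriv_compose_square(2)[OF holomorphic_ell_K w] by simp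
  qed (auto intro!: holomorphic_intros)
  then show "w * (1 - w\<^sup>2) * deriv A w = w\<^sup>2 * A w - B w" by simp
  have "0 * deriv A w + (1 - w\<^sup>2) * deriv B w = w * A w + (- w) * B w"
  proof (rule linear)
    fix w assume w: "w \<in> moduli"
    have "(1 - w\<^sup>2) * (- 2 * w * deriv ell_E (1 - w\<^sup>2)) = - w * (2 * (1 - w\<^sup>2) * deriv ell_E (1 - w\<^sup>2))"
      by simp
    then show "0 * deriv (\<lambda>k. ell_K (1 - k\<^sup>2)) w + (1 - w\<^sup>2) * deriv (\<lambda>k. ell_E (1 - k\<^sup>2)) w
        = w * ell_K (1 - w\<^sup>2) + (- w) * ell_E (1 - w\<^sup>2)"
      unfolding ell_E_ode[OF moduli_slit(2)[OF w]] using deriv_compose_square(2)[OF holomorphic_ell_E w] by (simp add: algebra_simps)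
  qed (auto intro!: holomorphic_intros)
  then show "(1 - w\<^sup>2) * deriv B w = w * (A w - B w)" by (simp add: algebra_simps)
qed

lemma branch_legendre_relation:
  assumes br: "branch [legendre_K, legendre_K', legendre_E, legendre_E'] D [K, K', E, E']" and w: "w \<in> D"
  shows "E w * K' w + E' w * K w - K w * K' w = of_real (pi / 2)"
proof -
  let ?Gs = "[\<lambda>k. ell_K (k\<^sup>2), \<lambda>k. ell_K (1 - k\<^sup>2), \<lambda>k. ell_E (k\<^sup>2), \<lambda>k. ell_E (1 - k\<^sup>2)]"
  let ?P = "\<lambda>gs w. (gs ! 2) w * (gs ! 1) w + (gs ! 3) w * (gs ! 0) w - (gs ! 0) w * (gs ! 1) w - complex_of_real (pi / 2)"
  have Fs: "list_all2 (\<lambda>f G. G holomorphic_on moduli \<and> (\<forall>k\<in>{0<..<1}. G (of_real k) = of_real (f k)))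
     [legendre_K, legendre_K', legendre_E, legendre_E'] ?Gs"
    using principal_branches by (simp add: legendre_K_eq legendre_E_eq legendre_K'_eq legendre_E'_eq)
  have "?P [K, K', E, E'] w = 0"
  proof (rule branch_relation[OF br Fs _ _ _ w, where P = ?P])
    fix gs :: "(complex \<Rightarrow> complex) list" and D
    assume "length gs = length [legendre_K, legendre_K', legendre_E, legendre_E']" "\<forall>g\<in>set gs. g holomorphic_on D"
    then show "?P gs holomorphic_on D" by (intro holomorphic_intros) auto
  next
    fix w assume "w \<in> moduli"
    then show "?P ?Gs w = 0" using legendre_relation[of "w\<^sup>2"] by (simp add: moduli_def)
  qed (auto simp: list_all2_conv_all_nth)
  then show ?thesis by simp
qed


section \<open>The integrals\<close>

lemma pi_I_squared_rational: "rational_on {p. p $ 1 \<noteq> 0} pi_I_squared"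
  unfolding rational_on_def
proof (intro exI conjI ballI)
  show "complex_polynomial (\<lambda>p :: complex^4. p $ 2 * p $ 2 + (-1) * (p $ 3 * p $ 3))"
    "complex_polynomial (\<lambda>p :: complex^4. p $ 1 * p $ 1)"
    by (intro complex_polynomial.intros)+
qed (auto simp: pi_I_squared_def power2_eq_square Let_def)

lemma pi_I_squared_not_constant: "\<not> pi_I_squared constant_on {p. p $ 1 \<noteq> 0}"
proof
  assume "pi_I_squared constant_on {p. p $ 1 \<noteq> 0}"
  then have "pi_I_squared (vector [1, 0, 0, 0]) = pi_I_squared (vector [1, 1, 0, 0])"
    unfolding constant_on_def by (metis (mono_tags, lifting) coords_4(1) mem_Collect_eq zero_neq_one)
  then show False by (simp add: pi_I_squared_def)
qed

lemma first_integralI: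
  assumes "\<And>T p \<tau>. open T \<Longrightarrow> solution_on T p \<Longrightarrow> p ` T \<subseteq> S \<Longrightarrow> \<tau> \<in> T \<Longrightarrow>
      ((\<lambda>\<tau>. F (p \<tau>)) has_field_derivative 0) (at \<tau>)"
  shows "first_integral_on S F"
  unfolding first_integral_on_def
  using assms by (blast intro: has_field_derivative_0_imp_constant_on)

lemma solutionD:
  fixes p :: "complex \<Rightarrow> complex^4"
  assumes "solution_on T p" "\<tau> \<in> T"
  shows
   "((\<lambda>s. p s $ 1) has_field_derivative (p \<tau> $ 4 + (p \<tau> $ 2)\<^sup>2 + (p \<tau> $ 3)\<^sup>2) * p \<tau> $ 1) (at \<tau>)"
   "((\<lambda>s. p s $ 2) has_field_derivative (p \<tau> $ 4 + (p \<tau> $ 2)\<^sup>2 - 2 * (p \<tau> $ 3)\<^sup>2) * p \<tau> $ 2) (at \<tau>)"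
   "((\<lambda>s. p s $ 3) has_field_derivative (p \<tau> $ 4 - 2 * (p \<tau> $ 2)\<^sup>2 + (p \<tau> $ 3)\<^sup>2) * p \<tau> $ 3) (at \<tau>)"
   "((\<lambda>s. p s $ 4) has_field_derivative (p \<tau> $ 4)\<^sup>2 - (p \<tau> $ 2)^4 + (p \<tau> $ 2)\<^sup>2 * (p \<tau> $ 3)\<^sup>2 - (p \<tau> $ 3)^4) (at \<tau>)"
  using assms(1)[unfolded solution_on_def, rule_format, OF assms(2), of 1]
    assms(1)[unfolded solution_on_def, rule_format, OF assms(2), of 2]
    assms(1)[unfolded solution_on_def, rule_format, OF assms(2), of 3]
    assms(1)[unfolded solution_on_def, rule_format, OF assms(2), of 4]
  unfolding vfield_def Let_def coords_4 by blast+

lemma pi_I_squared_first_integral: "first_integral_on {p. p $ 1 \<noteq> 0} pi_I_squared"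
proof (rule first_integralI)
  fix T :: "complex set" and p :: "complex \<Rightarrow> complex^4" and \<tau> assume s: "solution_on T p" "p ` T \<subseteq> {p. p $ 1 \<noteq> 0}" "\<tau> \<in> T"
  define x y z u where defs: "x = p \<tau> $ 1" "y = p \<tau> $ 2" "z = p \<tau> $ 3" "u = p \<tau> $ 4"
  note d = solutionD[OF s(1,3), folded defs]
  have x: "x \<noteq> 0" using s unfolding defs by auto
  have sq: "((\<lambda>s. (p s $ i)\<^sup>2) has_field_derivative 2 * p \<tau> $ i * d) (at \<tau>)"
    if "((\<lambda>s. p s $ i) has_field_derivative d) (at \<tau>)" for i d
    using that by (auto intro!: derivative_eq_intros)
  have "((\<lambda>s. ((p s $ 2)\<^sup>2 - (p s $ 3)\<^sup>2) / (p s $ 1)\<^sup>2) has_field_derivative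
     ((2 * y * ((u + y\<^sup>2 - 2 * z\<^sup>2) * y) - 2 * z * ((u - 2 * y\<^sup>2 + z\<^sup>2) * z)) * x\<^sup>2
       - (y\<^sup>2 - z\<^sup>2) * (2 * x * ((u + y\<^sup>2 + z\<^sup>2) * x))) / (x\<^sup>2 * x\<^sup>2)) (at \<tau>)"
    unfolding defs
    by (intro DERIV_divide DERIV_diff sq d[unfolded defs]) (use x defs in auto)
  moreover have "(2 * y * ((u + y\<^sup>2 - 2 * z\<^sup>2) * y) - 2 * z * ((u - 2 * y\<^sup>2 + z\<^sup>2) * z)) * x\<^sup>2
       - (y\<^sup>2 - z\<^sup>2) * (2 * x * ((u + y\<^sup>2 + z\<^sup>2) * x)) = 0"
    by (simp add: algebra_simps power2_eq_square)
  ultimately show "((\<lambda>\<tau>. pi_I_squared (p \<tau>)) has_field_derivative 0) (at \<tau>)"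
    by (simp add: pi_I_squared_def Let_def)
qed

text \<open>The speed of the modulus \<open>k = z / y\<close> contains the factor \<open>k (1 - k\<^sup>2)\<close>, which cancels the denominators in the
  differential equations of the elliptic integrals.\<close>

lemma modulus_has_derivative:
  fixes p :: "complex \<Rightarrow> complex^4"
  assumes s: "solution_on T p" "\<tau> \<in> T" and y: "p \<tau> $ 2 \<noteq> 0"
  shows "((\<lambda>s. p s $ 3 / p s $ 2) has_field_derivative
           - 3 * (p \<tau> $ 2)\<^sup>2 * ((p \<tau> $ 3 / p \<tau> $ 2) * (1 - (p \<tau> $ 3 / p \<tau> $ 2)\<^sup>2))) (at \<tau>)"
proof -
  define y z u where defs: "y = p \<tau> $ 2" "z = p \<tau> $ 3" "u = p \<tau> $ 4"
  note d = solutionD[OF s, folded defs]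
  have "((\<lambda>s. p s $ 3 / p s $ 2) has_field_derivative
     ((u - 2 * y\<^sup>2 + z\<^sup>2) * z * y - z * ((u + y\<^sup>2 - 2 * z\<^sup>2) * y)) / (y * y)) (at \<tau>)"
    unfolding defs by (intro DERIV_divide d[unfolded defs] y)
  moreover have "((u - 2 * y\<^sup>2 + z\<^sup>2) * z * y - z * ((u + y\<^sup>2 - 2 * z\<^sup>2) * y)) / (y * y)
     = - 3 * y\<^sup>2 * ((z / y) * (1 - (z / y)\<^sup>2))"
    using y by (simp add: defs[symmetric] divide_simps power2_eq_square) (simp add: algebra_simps)
  ultimately show ?thesis by (simp only: defs)
qed

text \<open>The numerator, for the denominator \<open>y\<^sup>2\<close>, of the time derivative of
  \<open>(u + r y\<^sup>2 + z\<^sup>2) A / y + t y B\<close>, the common shape of both transcendental integrals. Here \<open>A0\<close>, \<open>B0\<close> are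
  the values and \<open>A1\<close>, \<open>B1\<close> the time derivatives of \<open>A\<close>, \<open>B\<close>.\<close>

definition J_rate :: "complex \<Rightarrow> complex \<Rightarrow> complex \<Rightarrow> complex \<Rightarrow> complex \<Rightarrow> complex \<Rightarrow> complex \<Rightarrow> complex \<Rightarrow> complex \<Rightarrow> complex" where
  "J_rate r t y z u A0 B0 A1 B1 =
     ((u\<^sup>2 - y^4 + y\<^sup>2 * z\<^sup>2 - z^4 + r * (2 * y * ((u + y\<^sup>2 - 2 * z\<^sup>2) * y)) + 2 * z * ((u - 2 * y\<^sup>2 + z\<^sup>2) * z)) * A0
        + A1 * (u + r * y\<^sup>2 + z\<^sup>2)) * y - (u + r * y\<^sup>2 + z\<^sup>2) * A0 * ((u + y\<^sup>2 - 2 * z\<^sup>2) * y)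
        + (t * ((u + y\<^sup>2 - 2 * z\<^sup>2) * y) * B0 + B1 * (t * y)) * (y * y)"

lemma transcendental_first_integral:
  assumes D: "open D" and hol: "A holomorphic_on D" "B holomorphic_on D"
    and zero: "\<And>y z u A0 B0 A1 B1. y \<noteq> 0 \<Longrightarrow> z / y \<in> D \<Longrightarrow> A0 = A (z / y) \<Longrightarrow> B0 = B (z / y) \<Longrightarrow>
      A1 = deriv A (z / y) * (- 3 * y\<^sup>2 * ((z / y) * (1 - (z / y)\<^sup>2))) \<Longrightarrow>
      B1 = deriv B (z / y) * (- 3 * y\<^sup>2 * ((z / y) * (1 - (z / y)\<^sup>2))) \<Longrightarrow>
      J_rate r t y z u A0 B0 A1 B1 = 0"
  shows "first_integral_on (over D)
     (\<lambda>p. (p $ 4 + r * (p $ 2)\<^sup>2 + (p $ 3)\<^sup>2) * A (p $ 3 / p $ 2) / p $ 2 + t * p $ 2 * B (p $ 3 / p $ 2))"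
proof (rule first_integralI)
  fix T :: "complex set" and p :: "complex \<Rightarrow> complex^4" and \<tau> assume s: "solution_on T p" "p ` T \<subseteq> over D" "\<tau> \<in> T"
  define y z u where defs: "y = p \<tau> $ 2" "z = p \<tau> $ 3" "u = p \<tau> $ 4"
  note d = solutionD[OF s(1,3), folded defs]
  have y: "y \<noteq> 0" and k: "z / y \<in> D" using s unfolding defs by (auto simp: over_def)
  have yp: "p \<tau> $ 2 \<noteq> 0" using y by (simp add: defs)
  note dk = modulus_has_derivative[OF s(1,3) yp, folded defs]
  define A0 B0 A1 B1 where AB: "A0 = A (z / y)" "B0 = B (z / y)"
    "A1 = deriv A (z / y) * (- 3 * y\<^sup>2 * ((z / y) * (1 - (z / y)\<^sup>2)))"
    "B1 = deriv B (z / y) * (- 3 * y\<^sup>2 * ((z / y) * (1 - (z / y)\<^sup>2)))"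
  have dA: "((\<lambda>s. A (p s $ 3 / p s $ 2)) has_field_derivative A1) (at \<tau>)"
    unfolding AB
    by (rule DERIV_chain2[OF _ dk]) (use holomorphic_derivI[OF hol(1) D k] in \<open>simp add: defs\<close>)
  have dB: "((\<lambda>s. B (p s $ 3 / p s $ 2)) has_field_derivative B1) (at \<tau>)"
    unfolding AB
    by (rule DERIV_chain2[OF _ dk]) (use holomorphic_derivI[OF hol(2) D k] in \<open>simp add: defs\<close>)
  have sq: "((\<lambda>s. (p s $ i)\<^sup>2) has_field_derivative 2 * p \<tau> $ i * d) (at \<tau>)"
    if "((\<lambda>s. p s $ i) has_field_derivative d) (at \<tau>)" for i d
    using that by (auto intro!: derivative_eq_intros)
  let ?u' = "u\<^sup>2 - y^4 + y\<^sup>2 * z\<^sup>2 - z^4" and ?y' = "(u + y\<^sup>2 - 2 * z\<^sup>2) * y" and ?z' = "(u - 2 * y\<^sup>2 + z\<^sup>2) * z"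
  have "((\<lambda>s. (p s $ 4 + r * (p s $ 2)\<^sup>2 + (p s $ 3)\<^sup>2) * A (p s $ 3 / p s $ 2) / p s $ 2
        + t * p s $ 2 * B (p s $ 3 / p s $ 2)) has_field_derivative
     (((?u' + r * (2 * y * ?y') + 2 * z * ?z') * A0 + A1 * (u + r * y\<^sup>2 + z\<^sup>2)) * y
        - (u + r * y\<^sup>2 + z\<^sup>2) * A0 * ?y') / (y * y) + (t * ?y' * B0 + B1 * (t * y))) (at \<tau>)"
    unfolding AB(1,2) defs
    by (intro DERIV_add DERIV_divide DERIV_mult DERIV_cmult sq d[unfolded defs] dA dB yp)
  moreover have "(((?u' + r * (2 * y * ?y') + 2 * z * ?z') * A0 + A1 * (u + r * y\<^sup>2 + z\<^sup>2)) * y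
        - (u + r * y\<^sup>2 + z\<^sup>2) * A0 * ?y') / (y * y) + (t * ?y' * B0 + B1 * (t * y)) = 0"
  proof -
    have *: "X / (y * y) + Z = (X + Z * (y * y)) / (y * y)" for X Z using y by (simp add: field_simps)
    show ?thesis unfolding * zero[OF y k AB, unfolded J_rate_def] by simp
  qed
  ultimately show "((\<lambda>\<tau>. (p \<tau> $ 4 + r * (p \<tau> $ 2)\<^sup>2 + (p \<tau> $ 3)\<^sup>2) * A (p \<tau> $ 3 / p \<tau> $ 2) / p \<tau> $ 2
        + t * p \<tau> $ 2 * B (p \<tau> $ 3 / p \<tau> $ 2)) has_field_derivative 0) (at \<tau>)"
    by (simp only:)
qed

definition J_form :: "complex \<Rightarrow> complex \<Rightarrow> (complex \<Rightarrow> complex) \<Rightarrow> (complex \<Rightarrow> complex) \<Rightarrow> complex^4 \<Rightarrow> complex" where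
  "J_form r t A B p = (p $ 4 + r * (p $ 2)\<^sup>2 + (p $ 3)\<^sup>2) * A (p $ 3 / p $ 2) / p $ 2 + t * p $ 2 * B (p $ 3 / p $ 2)"

lemma J1_eq: "J1 K E = J_form (-2) 3 K E"
  by (rule ext) (simp add: J1_def J_form_def Let_def)

lemma J2_eq: "J2 K' E' = J_form 1 (-3) K' E'"
  by (rule ext) (simp add: J2_def J_form_def Let_def)

lemma J1_first_integral:
  assumes br: "branch [legendre_K, legendre_E] D [K, E]"
  shows "first_integral_on (over D) (J1 K E)"
  unfolding J1_eq J_form_def[abs_def]
proof (rule transcendental_first_integral)
  show "open D" "K holomorphic_on D" "E holomorphic_on D" using branch_domain[OF br] by auto
  fix y z u A0 B0 A1 B1 :: complex
  define k where "k = z / y"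
  assume y: "y \<noteq> 0" and kD: "z / y \<in> D" and AB: "A0 = K (z / y)" "B0 = E (z / y)"
    and A1: "A1 = deriv K (z / y) * (- 3 * y\<^sup>2 * ((z / y) * (1 - (z / y)\<^sup>2)))"
    and B1: "B1 = deriv E (z / y) * (- 3 * y\<^sup>2 * ((z / y) * (1 - (z / y)\<^sup>2)))"
  note ode = branch_KE_ode[OF br kD, folded k_def]
  have z: "z = k * y" using y by (simp add: k_def)
  have "A1 = - 3 * y\<^sup>2 * (k * (1 - k\<^sup>2) * deriv K k)" unfolding A1 k_def[symmetric] by (simp add: mult_ac)
  then have A1': "A1 = - 3 * y\<^sup>2 * (B0 - (1 - k\<^sup>2) * A0)" unfolding ode AB k_def[symmetric] .
  have "B1 = - 3 * y\<^sup>2 * ((1 - k\<^sup>2) * (k * deriv E k))" unfolding B1 k_def[symmetric] by (simp add: mult_ac)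
  then have B1': "B1 = - 3 * y\<^sup>2 * ((1 - k\<^sup>2) * (B0 - A0))" unfolding ode AB k_def[symmetric] .
  show "J_rate (-2) 3 y z u A0 B0 A1 B1 = 0"
    unfolding J_rate_def A1' B1' z by (simp add: algebra_simps power2_eq_square power4_eq_xxxx)
qed

lemma J2_first_integral:
  assumes br: "branch [legendre_K', legendre_E'] D [K', E']"
  shows "first_integral_on (over D) (J2 K' E')"
  unfolding J2_eq J_form_def[abs_def]
proof (rule transcendental_first_integral)
  show "open D" "K' holomorphic_on D" "E' holomorphic_on D" using branch_domain[OF br] by auto
  fix y z u A0 B0 A1 B1 :: complex
  define k where "k = z / y"
  assume y: "y \<noteq> 0" and kD: "z / y \<in> D" and AB: "A0 = K' (z / y)" "B0 = E' (z / y)"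
    and A1: "A1 = deriv K' (z / y) * (- 3 * y\<^sup>2 * ((z / y) * (1 - (z / y)\<^sup>2)))"
    and B1: "B1 = deriv E' (z / y) * (- 3 * y\<^sup>2 * ((z / y) * (1 - (z / y)\<^sup>2)))"
  note ode = branch_K'E'_ode[OF br kD, folded k_def]
  have z: "z = k * y" using y by (simp add: k_def)
  have "A1 = - 3 * y\<^sup>2 * (k * (1 - k\<^sup>2) * deriv K' k)" unfolding A1 k_def[symmetric] by (simp add: mult_ac)
  then have A1': "A1 = - 3 * y\<^sup>2 * (k\<^sup>2 * A0 - B0)" unfolding ode AB k_def[symmetric] .
  have "B1 = - 3 * y\<^sup>2 * (k * ((1 - k\<^sup>2) * deriv E' k))" unfolding B1 k_def[symmetric] by (simp add: mult_ac)
  then have B1': "B1 = - 3 * y\<^sup>2 * (k * (k * (A0 - B0)))" unfolding ode AB k_def[symmetric] .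
  show "J_rate 1 (-3) y z u A0 B0 A1 B1 = 0"
    unfolding J_rate_def A1' B1' z by (simp add: algebra_simps power2_eq_square power4_eq_xxxx)
qed

lemma holomorphic_several_const: "holomorphic_several_on S (\<lambda>p. c)"
  unfolding holomorphic_several_on_def
  by (intro ballI exI[of _ 0]) simp

lemma holomorphic_several_coord:
  fixes i :: "'n::finite" and S :: "(complex^'n) set"
  shows "holomorphic_several_on S (\<lambda>p. p $ i)"
  unfolding holomorphic_several_on_def
proof (intro ballI exI[of _ "axis i 1"])
  fix p :: "complex^'n"
  have "(\<Sum>j\<in>UNIV. (axis i 1 :: complex^'n) $ j * h $ j) = h $ i" for h :: "complex^'n"
    by (simp add: axis_def if_distrib[where f = "\<lambda>x. x * _"] cong: if_cong)
  then show "((\<lambda>p. p $ i) has_derivative (\<lambda>h. \<Sum>j\<in>UNIV. (axis i 1 :: complex^'n) $ j * h $ j)) (at p)"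
    by (simp add: bounded_linear_imp_has_derivative bounded_linear_vec_nth)
qed

lemma holomorphic_several_add:
  assumes "holomorphic_several_on S F" "holomorphic_several_on S G"
  shows "holomorphic_several_on S (\<lambda>p. F p + G p)"
  unfolding holomorphic_several_on_def
proof
  fix p assume "p \<in> S"
  then obtain f g :: "complex^'a" where fg: "(F has_derivative (\<lambda>h. \<Sum>i\<in>UNIV. f $ i * h $ i)) (at p)"
    "(G has_derivative (\<lambda>h. \<Sum>i\<in>UNIV. g $ i * h $ i)) (at p)"
    using assms unfolding holomorphic_several_on_def by blast
  show "\<exists>g :: complex^'a. ((\<lambda>p. F p + G p) has_derivative (\<lambda>h. \<Sum>i\<in>UNIV. g $ i * h $ i)) (at p)"
    using has_derivative_add[OF fg]
    by (intro exI[of _ "f + g"]) (simp add: algebra_simps sum.distrib)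
qed

lemma holomorphic_several_mult:
  assumes "holomorphic_several_on S F" "holomorphic_several_on S G"
  shows "holomorphic_several_on S (\<lambda>p. F p * G p)"
  unfolding holomorphic_several_on_def
proof
  fix p assume "p \<in> S"
  then obtain f g :: "complex^'a" where fg: "(F has_derivative (\<lambda>h. \<Sum>i\<in>UNIV. f $ i * h $ i)) (at p)"
    "(G has_derivative (\<lambda>h. \<Sum>i\<in>UNIV. g $ i * h $ i)) (at p)"
    using assms unfolding holomorphic_several_on_def by blast
  have "F p * (\<Sum>i\<in>UNIV. g $ i * h $ i) + (\<Sum>i\<in>UNIV. f $ i * h $ i) * G p
      = (\<Sum>i\<in>UNIV. (\<chi> i. F p * g $ i + f $ i * G p) $ i * h $ i)" for h :: "complex^'a"
    unfolding sum_distrib_left sum_distrib_right sum.distrib[symmetric]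
    by (intro sum.cong) (simp_all add: algebra_simps)
  then show "\<exists>g :: complex^'a. ((\<lambda>p. F p * G p) has_derivative (\<lambda>h. \<Sum>i\<in>UNIV. g $ i * h $ i)) (at p)"
    using has_derivative_mult[OF fg] by (intro exI[of _ "\<chi> i. F p * g $ i + f $ i * G p"]) simp
qed

lemma holomorphic_several_compose:
  assumes F: "holomorphic_several_on S F" and A: "A holomorphic_on D" "open D" "\<And>p. p \<in> S \<Longrightarrow> F p \<in> D"
  shows "holomorphic_several_on S (\<lambda>p. A (F p))"
  unfolding holomorphic_several_on_def
proof
  fix p assume p: "p \<in> S"
  then obtain f :: "complex^'a" where f: "(F has_derivative (\<lambda>h. \<Sum>i\<in>UNIV. f $ i * h $ i)) (at p)"
    using F unfolding holomorphic_several_on_def by blast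
  have "(A has_derivative (\<lambda>t. deriv A (F p) * t)) (at (F p))"
    using holomorphic_derivI[OF A(1,2) A(3)[OF p]] unfolding has_field_derivative_def by blast
  from has_derivative_compose[OF f this]
  show "\<exists>g :: complex^'a. ((\<lambda>p. A (F p)) has_derivative (\<lambda>h. \<Sum>i\<in>UNIV. g $ i * h $ i)) (at p)"
    by (intro exI[of _ "\<chi> i. deriv A (F p) * f $ i"]) (simp add: sum_distrib_left mult_ac)
qed

lemma J_form_holomorphic:
  assumes "open D" "A holomorphic_on D" "B holomorphic_on D"
  shows "holomorphic_several_on (over D) (J_form r t A B)"
proof -
  note h = holomorphic_several_add holomorphic_several_mult holomorphic_several_const holomorphic_several_coord
  have inv: "holomorphic_several_on (over D) (\<lambda>p. inverse (p $ 2))"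
    by (rule holomorphic_several_compose[OF holomorphic_several_coord, of inverse "- {0}"])
       (auto simp: over_def intro!: holomorphic_intros)
  have k: "holomorphic_several_on (over D) (\<lambda>p. p $ 3 * inverse (p $ 2))"
    by (intro h inv)
  have AB: "holomorphic_several_on (over D) (\<lambda>p. A (p $ 3 * inverse (p $ 2)))"
    "holomorphic_several_on (over D) (\<lambda>p. B (p $ 3 * inverse (p $ 2)))"
    by (rule holomorphic_several_compose[OF k _ assms(1)]; use assms in \<open>auto simp: over_def field_simps\<close>)+
  have "holomorphic_several_on (over D) (\<lambda>p. (p $ 4 + r * (p $ 2 * p $ 2) + p $ 3 * p $ 3)
      * A (p $ 3 * inverse (p $ 2)) * inverse (p $ 2) + t * p $ 2 * B (p $ 3 * inverse (p $ 2)))"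
    by (intro h inv AB)
  then show ?thesis unfolding J_form_def[abs_def] by (simp add: divide_inverse power2_eq_square)
qed

text \<open>An algebraic first integral would be a function of the rational integral, which does not involve \<open>u\<close>. But this one
  is affine in \<open>u\<close> with leading coefficient \<open>A(z / y) / y\<close>, so \<open>A\<close> would vanish on an open set.\<close>

lemma J_form_not_algebraic:
  assumes D: "open D" "connected D" "D \<noteq> {}" and AB: "A holomorphic_on D" "B holomorphic_on D"
    and nz: "\<exists>w\<in>D. A w \<noteq> 0" and int: "first_integral_on (over D) (J_form r t A B)"
  shows "\<not> algebraic_on (over D) (J_form r t A B)"
proof
  assume alg: "algebraic_on (over D) (J_form r t A B)"
  let ?U = "{p :: complex^4. p $ 2 \<noteq> 0}"
  have U: "open ?U" by (intro open_Collect_neq continuous_intros)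
  have "over D = ?U \<inter> (\<lambda>p. p $ 3 / p $ 2) -` D" by (auto simp: over_def)
  moreover have "open (?U \<inter> (\<lambda>p. p $ 3 / p $ 2) -` D)"
    by (rule continuous_open_preimage[OF _ U D(1)]) (intro continuous_intros, auto)
  ultimately have "open (over D)" by simp
  from algebraic_integral_dependent[OF this J_form_holomorphic[OF D(1) AB] alg int]
  obtain S' where S': "S' \<subseteq> over D" "over D \<subseteq> closure S'"
    and loc: "\<And>p. p \<in> S' \<Longrightarrow> \<exists>V W \<phi>. open V \<and> p \<in> V \<and> V \<subseteq> S' \<and> open W \<and> \<phi> holomorphic_on W \<and>
        (\<forall>q\<in>V. pi_I_squared q \<in> W \<and> J_form r t A B q = \<phi> (pi_I_squared q))"
    unfolding functionally_dependent_on_def by blast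
  obtain k where "k \<in> D" using D by blast
  then have "vector [0, 1, k, 0] \<in> over D" by (simp add: over_def)
  then have "S' \<noteq> {}" using S'(2) by (metis closure_empty empty_iff subsetD)
  then obtain p where "p \<in> S'" by blast
  then obtain V W \<phi> where V: "open V" "p \<in> V" "V \<subseteq> S'"
    and dep: "\<And>q. q \<in> V \<Longrightarrow> J_form r t A B q = \<phi> (pi_I_squared q)"
    using loc by meson
  have A0: "A (q $ 3 / q $ 2) = 0" if q: "q \<in> V" for q :: "complex^4"
  proof -
    define f :: "complex \<Rightarrow> complex^4" where "f = (\<lambda>s. vector [q $ 1, q $ 2, q $ 3, q $ 4 + s])"
    have "continuous_on UNIV f"
      unfolding f_def by (intro continuous_on_vector_4 continuous_intros)
    then have "open (f -` V)" by (rule open_vimage[OF V(1)])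
    moreover have f0: "f 0 = q" by (simp add: f_def vec_eq_iff forall_4)
    ultimately have "0 islimpt (f -` V)"
      using q by (intro open_imp_islimpt) auto
    then obtain s where s: "s \<noteq> 0" "f s \<in> V"
      unfolding islimpt_approachable by (metis vimageE zero_less_one)
    have "J_form r t A B (f s) = J_form r t A B q"
      using dep[OF s(2)] dep[OF q] by (simp add: pi_I_squared_def f_def)
    moreover have "q $ 2 \<noteq> 0" using q V(3) S'(1) by (auto simp: over_def)
    ultimately have "s * A (q $ 3 / q $ 2) = 0"
      by (simp add: J_form_def f_def divide_simps) (auto simp: algebra_simps)
    then show ?thesis using s by simp
  qed
  have y: "p $ 2 \<noteq> 0" using V S' by (auto simp: over_def)
  define f :: "complex \<Rightarrow> complex^4" where "f = (\<lambda>w. vector [p $ 1, p $ 2, w * p $ 2, p $ 4])"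
  have "continuous_on UNIV f"
    unfolding f_def by (intro continuous_on_vector_4 continuous_intros)
  then have op: "open (f -` V)" by (rule open_vimage[OF V(1)])
  have "f (p $ 3 / p $ 2) = p" using y by (simp add: f_def vec_eq_iff forall_4)
  then have ne: "f -` V \<noteq> {}" using V(2) by blast
  have fA: "A w = 0" and fD: "w \<in> D" if "w \<in> f -` V" for w
    using A0[of "f w"] that y V(3) S'(1) by (auto simp: f_def over_def)
  obtain w where w: "w \<in> D" "A w \<noteq> 0" using nz by blast
  have "A w = 0"
    by (rule analytic_continuation_open[OF op D(1) ne D(2) _ AB(1) holomorphic_on_const])
       (use fA fD w in auto)
  then show False using w by simp
qed

lemma ell_K_of_real_nonzero:
  assumes m: "0 \<le> m" "m < 1" shows "ell_K (of_real m) \<noteq> 0"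
proof -
  have "pi / 2 = integral {0..pi/2} (\<lambda>\<theta>::real. 1)" by simp
  also have "\<dots> \<le> integral {0..pi/2} (\<lambda>\<theta>. 1 / sqrt (1 - m * (sin \<theta>)\<^sup>2))"
  proof (rule integral_le)
    show "(\<lambda>\<theta>. 1 / sqrt (1 - m * (sin \<theta>)\<^sup>2)) integrable_on {0..pi/2}"
      by (intro integrable_continuous_real continuous_intros) (use m sqrt_radicand_nonzero in auto)
    show "1 \<le> 1 / sqrt (1 - m * (sin \<theta>)\<^sup>2)" for \<theta>
      using real_radicand_pos[OF m(2), of \<theta>] m by (simp add: field_simps)
  qed (auto intro!: integrable_continuous_real continuous_intros)
  finally have "0 < integral {0..pi/2} (\<lambda>\<theta>. 1 / sqrt (1 - m * (sin \<theta>)\<^sup>2))"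
    using pi_gt_zero by linarith
  then show ?thesis unfolding ell_K_of_real[OF m(2)] of_real_eq_0_iff by simp
qed

lemma legendre_K_nonzero: "k \<in> {0<..<1} \<Longrightarrow> legendre_K k \<noteq> 0"
  using legendre_K_eq[of k] ell_K_of_real_nonzero[of "k\<^sup>2"] real_modulus_square[of k]
  by (metis less_imp_le of_real_0 of_real_power)

lemma legendre_K'_nonzero: "k \<in> {0<..<1} \<Longrightarrow> legendre_K' k \<noteq> 0"
  using legendre_K'_eq[of k] ell_K_of_real_nonzero[of "1 - k\<^sup>2"] real_modulus_square[of k]
  by (metis less_imp_le of_real_0 of_real_1 of_real_diff of_real_power)

lemma J1_not_algebraic:
  assumes br: "branch [legendre_K, legendre_E] D [K, E]"
  shows "\<not> algebraic_on (over D) (J1 K E)"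
  using J_form_not_algebraic[of D K E "-2" 3] branch_domain[OF br] J1_first_integral[OF br]
    branch_leading_nonzero[OF br] legendre_K_nonzero
  by (simp add: J1_eq)

lemma J2_not_algebraic:
  assumes br: "branch [legendre_K', legendre_E'] D [K', E']"
  shows "\<not> algebraic_on (over D) (J2 K' E')"
  using J_form_not_algebraic[of D K' E' 1 "-3"] branch_domain[OF br] J2_first_integral[OF br]
    branch_leading_nonzero[OF br] legendre_K'_nonzero
  by (simp add: J2_eq)


section \<open>Multivaluedness\<close>

lemma mem_ball_complex:
  assumes "0 < r"
  shows "z \<in> ball c r \<longleftrightarrow> (Re z - Re c)\<^sup>2 + (Im z - Im c)\<^sup>2 < r\<^sup>2"
proof -
  have "z \<in> ball c r \<longleftrightarrow> cmod (z - c) < r" by (simp add: dist_norm norm_minus_commute)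
  also have "\<dots> \<longleftrightarrow> (cmod (z - c))\<^sup>2 < r\<^sup>2"
    using assms by (metis less_imp_le norm_ge_zero power2_less_imp_less power_strict_mono zero_less_numeral)
  finally show ?thesis by (simp add: cmod_power2)
qed

lemma Ln_upper: "0 < Im w \<Longrightarrow> Ln (- \<i> * w) = Ln w - \<i> * of_real pi / 2"
proof (rule Ln_unique)
  assume w: "0 < Im w"
  then have "w \<noteq> 0" by auto
  then have "exp (Ln w - \<i> * of_real pi / 2) = w * exp (- (\<i> * of_real pi / 2))"
    using exp_add[of "Ln w" "- (\<i> * of_real pi / 2)"] exp_Ln[of w] by simp
  also have "exp (- (\<i> * of_real pi / 2)) = - \<i>"
    using cis_minus_pi_half by (simp add: cis_conv_exp)
  finally show "exp (Ln w - \<i> * of_real pi / 2) = - \<i> * w" by simp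
  have "0 < Im (Ln w) \<and> Im (Ln w) < pi" using Im_Ln_pos_lt[OF \<open>w \<noteq> 0\<close>] w by simp
  then show "- pi < Im (Ln w - \<i> * of_real pi / 2)" "Im (Ln w - \<i> * of_real pi / 2) \<le> pi" by auto
qed

lemma Ln_lower: "Im w < 0 \<Longrightarrow> Ln (\<i> * w) = Ln w + \<i> * of_real pi / 2"
proof (rule Ln_unique)
  assume w: "Im w < 0"
  then have "w \<noteq> 0" by auto
  then have "exp (Ln w + \<i> * of_real pi / 2) = w * exp (\<i> * of_real pi / 2)"
    by (simp add: exp_add)
  also have "exp (\<i> * of_real pi / 2) = \<i>"
    using cis_pi_half by (simp add: cis_conv_exp)
  finally show "exp (Ln w + \<i> * of_real pi / 2) = \<i> * w" by simp
  have "\<not> 0 \<le> Im (Ln w)" using Im_Ln_pos_le[OF \<open>w \<noteq> 0\<close>] w Im_Ln_le_pi[OF \<open>w \<noteq> 0\<close>] by auto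
  moreover have "- pi < Im (Ln w)" by (rule mpi_less_Im_Ln[OF \<open>w \<noteq> 0\<close>])
  ultimately show "- pi < Im (Ln w + \<i> * of_real pi / 2)" "Im (Ln w + \<i> * of_real pi / 2) \<le> pi"
    using pi_gt_zero by auto
qed

text \<open>The continuation of the principal logarithm from the upper (\<open>s = 1\<close>) or lower (\<open>s = -1\<close>) half-plane across
  the negative real axis.\<close>

definition log_branch :: "real \<Rightarrow> complex \<Rightarrow> complex" where
  "log_branch s w = Ln (- of_real s * \<i> * w) + of_real s * \<i> * of_real pi / 2"

lemma log_branch_eq_Ln:
  assumes "s = 1 \<or> s = -1" "0 < s * Im w" shows "log_branch s w = Ln w"
  using assms Ln_upper[of w] Ln_lower[of w] by (auto simp: log_branch_def)

lemma log_branch_jump: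
  assumes "0 < \<rho>"
  shows "log_branch (-1) (- of_real \<rho>) = log_branch 1 (- of_real \<rho>) - 2 * of_real pi * \<i>"
proof -
  have "Ln (\<i> * of_real \<rho>) = of_real (ln \<rho>) + \<i> * of_real pi / 2"
    "Ln (- \<i> * of_real \<rho>) = of_real (ln \<rho>) - \<i> * of_real pi / 2"
    using Ln_times_of_real[OF assms, of \<i>] Ln_times_of_real[OF assms, of "- \<i>"] Ln_of_real[OF assms] by (simp_all add: mult.commute)
  then show ?thesis by (simp add: log_branch_def algebra_simps)
qed

text \<open>A start disc that touches the singular point and lies above (or below) it overlaps a disc beyond the singular
  point. On the latter the continuation uses the corresponding branch of the logarithm, so the two choices of \<open>s\<close>
  produce two branches over the same disc. The isometry \<open>\<iota>\<close> moves the singular point \<open>k = 0\<close> or \<open>k = 1\<close> to the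
  origin.\<close>

lemma branch_across_cut:
  fixes \<iota> :: "complex \<Rightarrow> complex" and F G :: "complex \<Rightarrow> complex \<Rightarrow> complex"
  assumes \<iota>: "\<iota> = (\<lambda>k. k) \<or> \<iota> = (\<lambda>k. 1 - k)" and r: "0 < r" "r \<le> 1"
    and hol: "\<And>L D. L holomorphic_on D \<Longrightarrow> D \<subseteq> ball 0 r \<Longrightarrow> (\<lambda>w. F (L w) w) holomorphic_on D"
      "\<And>L D. L holomorphic_on D \<Longrightarrow> D \<subseteq> ball 0 r \<Longrightarrow> (\<lambda>w. G (L w) w) holomorphic_on D"
    and val: "\<And>k. k \<in> {0<..<1} \<Longrightarrow> \<iota> (of_real k) \<in> ball 0 r \<Longrightarrow> F (Ln (\<iota> (of_real k))) (\<iota> (of_real k)) = of_real (f k)"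
      "\<And>k. k \<in> {0<..<1} \<Longrightarrow> \<iota> (of_real k) \<in> ball 0 r \<Longrightarrow> G (Ln (\<iota> (of_real k))) (\<iota> (of_real k)) = of_real (g k)"
    and s: "s = 1 \<or> s = -1"
  shows "branch [f, g] (ball (\<iota> (- of_real (r/4))) (r/4))
           [\<lambda>k. F (log_branch s (\<iota> k)) (\<iota> k), \<lambda>k. G (log_branch s (\<iota> k)) (\<iota> k)]"
proof -
  define \<rho> where "\<rho> = r / 4"
  have \<rho>: "0 < \<rho>" "4 * \<rho> = r" using r by (auto simp: \<rho>_def)
  have inv: "\<iota> (\<iota> k) = k" and dist: "dist (\<iota> k) (\<iota> k') = dist k k'" for k k'
    using \<iota> by (auto simp: dist_norm norm_minus_commute)
  have mem: "k \<in> ball (\<iota> c) R \<longleftrightarrow> \<iota> k \<in> ball c R" for k c R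
    using dist[of "\<iota> c" k] inv[of c] by simp
  have hol\<iota>: "\<iota> holomorphic_on D" for D using \<iota> by (auto intro!: holomorphic_intros)
  define c where "c = of_real \<rho> + of_real s * \<i> * of_real \<rho>"
  define R where "R = sqrt 2 * \<rho>"
  let ?D0 = "ball (\<iota> c) R" and ?D2 = "ball (\<iota> (- of_real \<rho>)) \<rho>"
  let ?g0 = "[\<lambda>k. F (Ln (\<iota> k)) (\<iota> k), \<lambda>k. G (Ln (\<iota> k)) (\<iota> k)]"
    and ?gs = "[\<lambda>k. F (log_branch s (\<iota> k)) (\<iota> k), \<lambda>k. G (log_branch s (\<iota> k)) (\<iota> k)]"
  have R: "0 < R" "R\<^sup>2 = 2 * \<rho>\<^sup>2" using \<rho> by (auto simp: R_def power_mult_distrib)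
  have s2: "s\<^sup>2 = 1" using s by auto
  have inc: "w \<in> ball c R \<longleftrightarrow> (Re w - \<rho>)\<^sup>2 + (Im w - s * \<rho>)\<^sup>2 < 2 * \<rho>\<^sup>2" for w
    unfolding mem_ball_complex[OF R(1)] R(2) by (simp add: c_def)
  have in2: "w \<in> ball (- of_real \<rho>) \<rho> \<longleftrightarrow> (Re w + \<rho>)\<^sup>2 + (Im w)\<^sup>2 < \<rho>\<^sup>2" for w
    unfolding mem_ball_complex[OF \<rho>(1)] by simp
  have subc: "ball c R \<subseteq> ball 0 r"
  proof -
    have "cmod c \<le> 2 * \<rho>"
      using s norm_triangle_ineq[of "of_real \<rho>" "of_real s * \<i> * of_real \<rho>"] \<rho> by (auto simp: c_def norm_mult)
    moreover have "R \<le> 2 * \<rho>" using \<rho> sqrt2_less_2 by (simp add: R_def)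
    ultimately have "cmod w < r" if "w \<in> ball c R" for w
      using that norm_triangle_ineq[of "w - c" c] \<rho> by (simp add: dist_norm norm_minus_commute)
    then show ?thesis by auto
  qed
  have sub2: "ball (- of_real \<rho>) \<rho> \<subseteq> ball (0::complex) r"
  proof
    fix w :: complex assume "w \<in> ball (- of_real \<rho>) \<rho>"
    then have "cmod (w + of_real \<rho>) < \<rho>" by (simp add: dist_norm norm_minus_commute)
    then have "cmod w < r" using norm_triangle_ineq4[of "w + of_real \<rho>" "of_real \<rho>"] \<rho> by simp
    then show "w \<in> ball 0 r" by simp
  qed
  have slit: "w \<notin> \<real>\<^sub>\<le>\<^sub>0" if w: "w \<in> ball c R" for w
  proof
    assume "w \<in> \<real>\<^sub>\<le>\<^sub>0"
    then have w0: "Im w = 0" "Re w \<le> 0" by (auto simp: complex_nonpos_Reals_iff)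
    have "(Re w - \<rho>)\<^sup>2 + \<rho>\<^sup>2 < 2 * \<rho>\<^sup>2" using w[unfolded inc] w0 s2 by (simp add: power_mult_distrib)
    moreover have "\<rho>\<^sup>2 \<le> (Re w - \<rho>)\<^sup>2" using w0 \<rho> by (simp add: abs_le_square_iff[symmetric])
    ultimately show False by simp
  qed
  have start: "branch [f, g] ?D0 ?g0"
  proof (rule branch.start[OF refl])
    obtain k where k: "k \<in> {0<..<1}" "\<iota> (complex_of_real k) = of_real \<rho>"
      using \<iota> \<rho> r by (elim disjE) (auto intro: that[of \<rho>] that[of "1 - \<rho>"])
    have "of_real \<rho> \<in> ball c R" unfolding inc using \<rho> s2 by (simp add: power_mult_distrib)
    then show "\<exists>k\<in>{0<..<1}. complex_of_real k \<in> ?D0"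
      unfolding mem using k by (intro bexI[of _ k]) (simp_all del: mem_ball)
    have Lnh: "Ln holomorphic_on ball c R" by (intro holomorphic_intros) (use slit in auto)
    have im: "\<iota> ` ?D0 \<subseteq> ball c R" using mem by blast
    show "\<forall>g\<in>set ?g0. g holomorphic_on ?D0"
      using holomorphic_on_compose_gen[OF hol\<iota> hol(1)[OF Lnh subc] im]
        holomorphic_on_compose_gen[OF hol\<iota> hol(2)[OF Lnh subc] im] by (simp add: o_def)
    show "list_all2 (\<lambda>f g. \<forall>k\<in>{0<..<1}. complex_of_real k \<in> ?D0 \<longrightarrow> g (of_real k) = of_real (f k)) [f, g] ?g0"
      using val subc mem by (auto simp del: mem_ball)
  qed
  have "branch [f, g] ?D2 ?gs"
  proof (rule branch.step[OF start refl])
    \<comment> \<open>a point common to both discs\<close>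
    define w where "w = of_real \<rho> * Complex (-1/4) (s/2)"
    have "w \<in> ball c R" unfolding inc using \<rho> s
      by (auto simp: w_def power2_eq_square field_simps)
    moreover have "w \<in> ball (- of_real \<rho>) \<rho>" unfolding in2 using \<rho> s
      by (auto simp: w_def power2_eq_square field_simps)
    ultimately have "\<iota> w \<in> ?D0 \<inter> ?D2"
      unfolding Int_iff mem inv by simp
    then show "?D0 \<inter> ?D2 \<noteq> {}" by blast
    have "- of_real s * \<i> * w \<notin> \<real>\<^sub>\<le>\<^sub>0" if w: "w \<in> ball (- of_real \<rho>) \<rho>" for w
    proof -
      have "(Re w + \<rho>)\<^sup>2 < \<rho>\<^sup>2" using w[unfolded in2] by (smt (verit) zero_le_power2)
      then have "Re w < 0" using \<rho> by (smt (verit) power_mono)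
      then show ?thesis using s by (auto simp: complex_nonpos_Reals_iff)
    qed
    then have Lh: "log_branch s holomorphic_on ball (- of_real \<rho>) \<rho>"
      unfolding log_branch_def[abs_def] by (intro holomorphic_intros) auto
    have im: "\<iota> ` ?D2 \<subseteq> ball (- of_real \<rho>) \<rho>" using mem by blast
    show "\<forall>h\<in>set ?gs.
        h holomorphic_on ?D2"
      using holomorphic_on_compose_gen[OF hol\<iota> hol(1)[OF Lh sub2] im]
        holomorphic_on_compose_gen[OF hol\<iota> hol(2)[OF Lh sub2] im] by (simp add: o_def)
    have "log_branch s w = Ln w" if w: "w \<in> ball c R" "w \<in> ball (- of_real \<rho>) \<rho>" for w
    proof (rule log_branch_eq_Ln[OF s])
      have 1: "(Re w)\<^sup>2 + 2 * \<rho> * Re w + (Im w)\<^sup>2 < 0"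
        using w(2)[unfolded in2] by (simp add: power2_eq_square algebra_simps)
      have 2: "(Re w)\<^sup>2 - 2 * \<rho> * Re w + (Im w)\<^sup>2 - 2 * \<rho> * (s * Im w) < 0"
        using w(1)[unfolded inc] s2 by (simp add: power2_diff power_mult_distrib mult_ac)
      have "0 \<le> (Re w)\<^sup>2 + (Im w)\<^sup>2" by simp
      then have "0 < 2 * \<rho> * (s * Im w)" using 1 2 by linarith
      then show "0 < s * Im w" using \<rho> by (simp add: zero_less_mult_iff)
    qed
    then show "list_all2 (\<lambda>g h. \<forall>w\<in>?D0 \<inter> ?D2. g w = h w) ?g0 ?gs"
      using mem by (simp del: mem_ball)
  qed
  then show ?thesis by (simp add: \<rho>_def)
qed

text \<open>The difference of the two values is affine in \<open>u\<close> with nonzero slope, so it is nonzero at one of two values of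
  \<open>u\<close>.\<close>

lemma multi_valued_J_form:
  assumes br: "branch [f, g] D [A, B]" "branch [f, g] D [A', B']" and w: "w \<in> D" "A w \<noteq> A' w"
  shows "multi_valued (J_form r t) f g"
proof -
  define P :: "complex \<Rightarrow> complex^4" where "P = (\<lambda>u. vector [0, 1, w, u - r - w\<^sup>2])"
  have P: "P u \<in> over D" for u using w by (simp add: P_def over_def)
  have J: "J_form r t A B (P u) = u * A w + t * B w" for A B u
    by (simp add: P_def J_form_def)
  have "J_form r t A B (P 0) \<noteq> J_form r t A' B' (P 0) \<or> J_form r t A B (P 1) \<noteq> J_form r t A' B' (P 1)"
    unfolding J using w by auto
  then show ?thesis unfolding multi_valued_def using br P by blast
qed

text \<open>The complementary integrals near \<open>w = 0\<close>, with the logarithm as an independent first argument.\<close>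

definition logarithmic_pair :: "real \<Rightarrow> (complex \<Rightarrow> complex \<Rightarrow> complex) \<Rightarrow> (complex \<Rightarrow> complex \<Rightarrow> complex) \<Rightarrow> bool" where
  "logarithmic_pair r K' E' \<longleftrightarrow>
    (\<forall>L W D. L holomorphic_on D \<longrightarrow> W holomorphic_on D \<longrightarrow> W ` D \<subseteq> ball 0 r \<longrightarrow>
       (\<lambda>k. K' (L k) (W k)) holomorphic_on D \<and> (\<lambda>k. E' (L k) (W k)) holomorphic_on D) \<and>
    (\<forall>w\<in>ball 0 r - \<real>\<^sub>\<le>\<^sub>0. K' (Ln w) w = ell_K (1 - w) \<and> E' (Ln w) w = ell_E (1 - w)) \<and>
    (\<forall>w\<in>ball 0 r. \<forall>l l'. l \<noteq> l' \<longrightarrow> K' l w \<noteq> K' l' w)"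

lemmas logarithmic_pairD =
  logarithmic_pair_def[THEN iffD1, THEN conjunct1, rule_format, THEN conjunct1]
  logarithmic_pair_def[THEN iffD1, THEN conjunct1, rule_format, THEN conjunct2]
  logarithmic_pair_def[THEN iffD1, THEN conjunct2, THEN conjunct1, rule_format, THEN conjunct1]
  logarithmic_pair_def[THEN iffD1, THEN conjunct2, THEN conjunct1, rule_format, THEN conjunct2]
  logarithmic_pair_def[THEN iffD1, THEN conjunct2, THEN conjunct2, rule_format]

text \<open>Legendre's relation determines the integral of the second kind from the one of the first kind, so both are
  continued consistently.\<close>

lemma logarithmic_continuation:
  obtains r K' E' where "0 < r" "r \<le> 1" "logarithmic_pair r K' E'"
proof -
  obtain r R where r: "0 < r" "r \<le> 1" and R: "R holomorphic_on ball 0 r"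
    and nz: "\<And>w. w \<in> ball 0 r \<Longrightarrow> ell_K w \<noteq> 0"
    and K: "\<And>w. w \<in> ball 0 r - \<real>\<^sub>\<le>\<^sub>0 \<Longrightarrow> ell_K (1 - w) = ell_K w * (R w - Ln w / of_real pi)"
    using ell_K_near_1 by metis
  have slit: "w \<in> slit_plane" if "w \<in> ball 0 r" for w
    by (rule ball_01_slit[OF subsetD[OF subset_ball[OF r(2)] that]])
  define K' where "K' = (\<lambda>l w. ell_K w * (R w - l / of_real pi))"
  define E' where "E' = (\<lambda>l w. of_real (pi / 2) / ell_K w + K' l w * (1 - ell_E w / ell_K w))"
  have hK: "(\<lambda>k. K' (L k) (W k)) holomorphic_on D" and hE: "(\<lambda>k. E' (L k) (W k)) holomorphic_on D"
    if L: "L holomorphic_on D" and W: "W holomorphic_on D" "W ` D \<subseteq> ball 0 r" for L W D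
  proof -
    have RW: "(\<lambda>k. R (W k)) holomorphic_on D"
      using holomorphic_on_compose_gen[OF W(1) R W(2)] by (simp add: o_def)
    have sl: "W k \<in> slit_plane" and n: "ell_K (W k) \<noteq> 0" if "k \<in> D" for k
      using slit nz W(2) that by auto
    show h: "(\<lambda>k. K' (L k) (W k)) holomorphic_on D"
      unfolding K'_def by (intro holomorphic_intros RW L W) (use sl in auto)
    show "(\<lambda>k. E' (L k) (W k)) holomorphic_on D"
      unfolding E'_def by (intro holomorphic_intros h W) (use sl n in auto)
  qed
  have vK: "K' (Ln w) w = ell_K (1 - w)" if "w \<in> ball 0 r - \<real>\<^sub>\<le>\<^sub>0" for w
    using K[OF that] by (simp add: K'_def)
  have vE: "E' (Ln w) w = ell_E (1 - w)" if w: "w \<in> ball 0 r - \<real>\<^sub>\<le>\<^sub>0" for w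
  proof -
    have "w \<in> cut_plane" using w slit by (auto simp: cut_plane_def slit_plane_def)
    from legendre_relation[OF this]
    have "of_real (pi / 2) = ell_E w * ell_K (1 - w) + ell_E (1 - w) * ell_K w - ell_K w * ell_K (1 - w)" by simp
    then show ?thesis
      unfolding E'_def vK[OF w] using nz[of w] w by (simp add: field_simps)
  qed
  have ne: "K' l w \<noteq> K' l' w" if "w \<in> ball 0 r" "l \<noteq> l'" for w l l'
    using nz[OF that(1)] that(2) by (simp add: K'_def)
  have "logarithmic_pair r K' E'"
    unfolding logarithmic_pair_def by (intro conjI allI impI ballI hK hE vK vE ne; assumption)
  then show ?thesis by (rule that[OF r])
qed

text \<open>The singular point is \<open>k = 1\<close>. With \<open>w = 1 - k\<close> the complementary parameter is \<open>1 - k\<^sup>2 = w (2 - w)\<close>, and only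
  the logarithm of the factor \<open>w\<close> is continued.\<close>

lemma J1_multi_valued: "multi_valued J1 legendre_K legendre_E"
proof -
  obtain r K' E' where r: "0 < r" "r \<le> 1" and pair: "logarithmic_pair r K' E'"
    by (rule logarithmic_continuation) blast
  note hol = logarithmic_pairD(1,2)[OF pair] and val = logarithmic_pairD(3,4)[OF pair] and inj = logarithmic_pairD(5)[OF pair]
  define F where "F = (\<lambda>l w. K' (l + Ln (2 - w)) (w * (2 - w)))"
  define G where "G = (\<lambda>l w. E' (l + Ln (2 - w)) (w * (2 - w)))"
  define q where "q = r / 3"
  have q: "0 < q" "q \<le> 1" using r by (auto simp: q_def)
  have W: "w * (2 - w) \<in> ball 0 r" if "w \<in> ball 0 q" for w :: complex
  proof -
    have w: "cmod w < r / 3" using that by (simp add: q_def)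
    have "cmod (2 - w) \<le> 3" using norm_triangle_ineq4[of 2 w] w r by simp
    then have "cmod w * cmod (2 - w) \<le> cmod w * 3" by (intro mult_left_mono) auto
    then show ?thesis using w by (simp add: norm_mult)
  qed
  have sl: "2 - w \<notin> \<real>\<^sub>\<le>\<^sub>0" if "w \<in> ball 0 q" for w :: complex
    using that complex_Re_le_cmod[of w] q by (auto simp: complex_nonpos_Reals_iff)
  have hF: "(\<lambda>w. F (L w) w) holomorphic_on D" and hG: "(\<lambda>w. G (L w) w) holomorphic_on D"
    if L: "L holomorphic_on D" "D \<subseteq> ball 0 q" for L D
    unfolding F_def G_def
    by (intro hol holomorphic_intros L; use W sl L(2) in blast)+
  have v: "F (Ln (1 - of_real k)) (1 - of_real k) = of_real (legendre_K k)
      \<and> G (Ln (1 - of_real k)) (1 - of_real k) = of_real (legendre_E k)"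
    if k: "k \<in> {0<..<1}" "1 - complex_of_real k \<in> ball 0 q" for k
  proof -
    have 1: "(1 - complex_of_real k) * (2 - (1 - of_real k)) = of_real (1 - k\<^sup>2)"
      by (simp add: power2_eq_square algebra_simps)
    have "Ln (1 - complex_of_real k) + Ln (2 - (1 - of_real k)) = of_real (ln (1 - k) + ln (1 + k))"
      using Ln_of_real[of "1 - k"] Ln_of_real[of "1 + k"] k by simp
    also have "ln (1 - k) + ln (1 + k) = ln ((1 - k) * (1 + k))"
      using k by (simp add: ln_mult)
    also have "(1 - k) * (1 + k) = 1 - k\<^sup>2" by (simp add: power2_eq_square algebra_simps)
    finally have 2: "Ln (1 - complex_of_real k) + Ln (2 - (1 - of_real k)) = Ln (of_real (1 - k\<^sup>2))"
      using Ln_of_real[of "1 - k\<^sup>2"] real_modulus_square[OF k(1)] by simp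
    have 3: "complex_of_real (1 - k\<^sup>2) \<in> ball 0 r - \<real>\<^sub>\<le>\<^sub>0"
      using W[OF k(2)] real_modulus_square[OF k(1)] unfolding 1 by (auto simp: complex_nonpos_Reals_iff)
    show ?thesis
      unfolding F_def G_def 1 2 val[OF 3] legendre_K_eq[OF k(1)] legendre_E_eq[OF k(1)] by simp
  qed
  have br: "branch [legendre_K, legendre_E] (ball (1 - - of_real (q/4)) (q/4))
      [\<lambda>k. F (log_branch s (1 - k)) (1 - k), \<lambda>k. G (log_branch s (1 - k)) (1 - k)]" if "s = 1 \<or> s = -1" for s
    by (rule branch_across_cut[of "\<lambda>k. 1 - k", OF _ q hF hG _ _ that]) (use v in auto)
  have "multi_valued (J_form (-2) 3) legendre_K legendre_E"
  proof (rule multi_valued_J_form[OF br[of 1] br[of "-1"]])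
    show "1 - - complex_of_real (q/4) \<in> ball (1 - - of_real (q/4)) (q/4)" using q by simp
    have "- complex_of_real (q/4) \<in> ball 0 q" using q by simp
    from inj[OF W[OF this]] log_branch_jump[of "q/4"] q
    show "F (log_branch 1 (1 - (1 - - of_real (q/4)))) (1 - (1 - - of_real (q/4)))
       \<noteq> F (log_branch (-1) (1 - (1 - - of_real (q/4)))) (1 - (1 - - of_real (q/4)))"
      by (simp add: F_def)
  qed auto
  moreover have "J1 = J_form (-2) 3" by (intro ext) (simp add: J1_eq)
  ultimately show ?thesis by simp
qed

text \<open>The singular point is \<open>k = 0\<close>, and the parameter is \<open>k\<^sup>2\<close>.\<close>

lemma J2_multi_valued: "multi_valued J2 legendre_K' legendre_E'"
proof -
  obtain r K' E' where r: "0 < r" "r \<le> 1" and pair: "logarithmic_pair r K' E'"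
    by (rule logarithmic_continuation) blast
  note hol = logarithmic_pairD(1,2)[OF pair] and val = logarithmic_pairD(3,4)[OF pair] and inj = logarithmic_pairD(5)[OF pair]
  define F where "F = (\<lambda>l w. K' (2 * l) (w\<^sup>2))"
  define G where "G = (\<lambda>l w. E' (2 * l) (w\<^sup>2))"
  have W: "w\<^sup>2 \<in> ball 0 r" if "w \<in> ball 0 r" for w :: complex
  proof -
    have "cmod w * cmod w \<le> cmod w * 1" using that r by (intro mult_left_mono) auto
    then show ?thesis using that by (simp add: power2_eq_square norm_mult)
  qed
  have hF: "(\<lambda>w. F (L w) w) holomorphic_on D" and hG: "(\<lambda>w. G (L w) w) holomorphic_on D"
    if L: "L holomorphic_on D" "D \<subseteq> ball 0 r" for L D
    unfolding F_def G_def
    by (intro hol holomorphic_intros L; use W L(2) in blast)+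
  have v: "F (Ln (of_real k)) (of_real k) = of_real (legendre_K' k)
      \<and> G (Ln (of_real k)) (of_real k) = of_real (legendre_E' k)"
    if k: "k \<in> {0<..<1}" "complex_of_real k \<in> ball 0 r" for k
  proof -
    have 2: "2 * Ln (complex_of_real k) = Ln ((of_real k)\<^sup>2)"
      using Ln_of_real[of k] Ln_of_real[of "k\<^sup>2"] k by (simp add: ln_realpow)
    have 3: "(complex_of_real k)\<^sup>2 \<in> ball 0 r - \<real>\<^sub>\<le>\<^sub>0"
      using W[OF k(2)] real_modulus_square[OF k(1)] by (auto simp: complex_nonpos_Reals_iff simp flip: of_real_power)
    show ?thesis
      unfolding F_def G_def 2 val[OF 3] legendre_K'_eq[OF k(1)] legendre_E'_eq[OF k(1)] by simp
  qed
  have br: "branch [legendre_K', legendre_E'] (ball (- of_real (r/4)) (r/4))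
      [\<lambda>k. F (log_branch s k) k, \<lambda>k. G (log_branch s k) k]" if "s = 1 \<or> s = -1" for s
    by (rule branch_across_cut[of "\<lambda>k. k", OF _ r hF hG _ _ that]) (use v in auto)
  have "multi_valued (J_form 1 (-3)) legendre_K' legendre_E'"
  proof (rule multi_valued_J_form[OF br[of 1] br[of "-1"]])
    show "- complex_of_real (r/4) \<in> ball (- of_real (r/4)) (r/4)" using r by simp
    have "- complex_of_real (r/4) \<in> ball 0 r" using r by simp
    from inj[OF W[OF this]] log_branch_jump[of "r/4"] r
    show "F (log_branch 1 (- of_real (r/4))) (- of_real (r/4)) \<noteq> F (log_branch (-1) (- of_real (r/4))) (- of_real (r/4))"
      by (simp add: F_def)
  qed auto
  moreover have "J2 = J_form 1 (-3)" by (intro ext) (simp add: J2_eq)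
  ultimately show ?thesis by simp
qed


section \<open>The identity between the integrals and the main theorem\<close>

text \<open>The combination \<open>J\<^sub>1 K' - J\<^sub>2 K\<close> eliminates \<open>u\<close> and leaves \<open>3 y\<close> times the left-hand side of Legendre's
  relation.\<close>

lemma J1_J2_identity:
  assumes br: "branch [legendre_K, legendre_K', legendre_E, legendre_E'] D [K, K', E, E']"
    and p: "p \<in> over D"
  shows "J1 K E p * K' (p $ 3 / p $ 2) - J2 K' E' p * K (p $ 3 / p $ 2) = 3 / 2 * complex_of_real pi * p $ 2"
proof -
  define y z u where defs: "y = p $ 2" "z = p $ 3" "u = p $ 4"
  define a b c d where vals: "a = K (z / y)" "b = K' (z / y)" "c = E (z / y)" "d = E' (z / y)"
  have y: "y \<noteq> 0" and k: "z / y \<in> D" using p by (auto simp: over_def defs)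
  have leg: "c * b + d * a - a * b = of_real (pi / 2)"
    unfolding vals by (rule branch_legendre_relation[OF br k])
  have "J1 K E p * b - J2 K' E' p * a
      = ((u - 2 * y\<^sup>2 + z\<^sup>2) - (u + y\<^sup>2 + z\<^sup>2)) / y * (a * b) + 3 * y * (c * b + d * a)"
    unfolding J1_def J2_def Let_def defs[symmetric] vals[symmetric] using y
    by (simp add: divide_simps) (simp add: algebra_simps)
  also have "((u - 2 * y\<^sup>2 + z\<^sup>2) - (u + y\<^sup>2 + z\<^sup>2)) / y = - 3 * y"
    using y by (simp add: divide_simps power2_eq_square)
  also have "- 3 * y * (a * b) + 3 * y * (c * b + d * a) = 3 * y * (c * b + d * a - a * b)"
    by (simp add: algebra_simps)
  also have "\<dots> = 3 / 2 * of_real pi * y" unfolding leg by simp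
  finally show ?thesis unfolding vals defs .
qed

theorem proposition7:
  shows "rational_on {p. p $ 1 \<noteq> 0} pi_I_squared
    \<and> first_integral_on {p. p $ 1 \<noteq> 0} pi_I_squared
    \<and> \<not> pi_I_squared constant_on {p. p $ 1 \<noteq> 0}
    \<and> (\<forall>S F. open S \<and> holomorphic_several_on S F \<and> algebraic_on S F \<and> first_integral_on S F
          \<longrightarrow> functionally_dependent_on S F pi_I_squared)
    \<and> (\<forall>D K E. branch [legendre_K, legendre_E] D [K, E]
          \<longrightarrow> first_integral_on (over D) (J1 K E) \<and> \<not> algebraic_on (over D) (J1 K E))
    \<and> (\<forall>D K' E'. branch [legendre_K', legendre_E'] D [K', E']
          \<longrightarrow> first_integral_on (over D) (J2 K' E') \<and> \<not> algebraic_on (over D) (J2 K' E'))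
    \<and> multi_valued J1 legendre_K legendre_E
    \<and> multi_valued J2 legendre_K' legendre_E'
    \<and> (\<forall>D K K' E E'. branch [legendre_K, legendre_K', legendre_E, legendre_E'] D [K, K', E, E']
          \<longrightarrow> (\<forall>p\<in>over D. J1 K E p * K' (p $ 3 / p $ 2) - J2 K' E' p * K (p $ 3 / p $ 2)
                 = 3 / 2 * complex_of_real pi * p $ 2))"
  by (intro conjI allI impI ballI pi_I_squared_rational pi_I_squared_first_integral
      pi_I_squared_not_constant J1_first_integral J1_not_algebraic J2_first_integral J2_not_algebraic
      J1_multi_valued J2_multi_valued J1_J2_identity)
     (blast intro: algebraic_integral_dependent)+

end
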